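(* Let $b,c>0$. (a) The operator $J_{b,c}$ is a unitary operator $$J_{b,c}:\ L^2\Bigl([0,\infty),\ x^{b+c-1}(1+x)^{b-c}\,dx\Bigr)\to L^2\Bigl([0,\infty),\ \Bigl|\frac{\Gamma(b+is)\Gamma(c+is)}{\Gamma(2is)}\Bigr|^2ds\Bigr).$$ In other words, the following Plancherel formula holds: $$\int_0^\infty f_1(x)\,\overline{f_2(x)}\,x^{b+c-1}(1+x)^{b-c}\,dx=\int_0^\infty J_{b,c}f_1(s)\,\overline{J_{b,c}f_2(s)}\,\Bigl|\frac{\Gamma(b+is)\Gamma(c+is)}{\Gamma(2is)}\Bigr|^2ds .$$ (b) The inverse operator is given by the formula $$f(x)=\frac1{\Gamma(b+c)}\int_0^\infty J_{b,c}f(s)\ {}_2F_1\bigl(b+is,\,b-is;\,b+c;\,-x\bigr)\,\Bigl|\frac{\Gamma(b+is)\Gamma(c+is)}{\Gamma(2is)}\Bigr|^2ds .$$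
   Context: For $b,c>0$ and a function $f$ on the half-line $[0,\infty)$, the index hypergeometric transform is the function of $s\ge 0$ given by $$J_{b,c}f(s)=\frac1{\Gamma(b+c)}\int_0^\infty f(x)\ {}_2F_1(b+is,b-is;b+c;-x)\,x^{b+c-1}(1+x)^{b-c}\,dx,$$ where ${}_2F_1$ is the Gauss hypergeometric function. The transform is first defined on functions with compact support and then extended by continuity to a unitary operator on the $L^2$ space.
   Formalization: The printed formulas lack a factor 1/(2π): with J as given, the spectral norm is 2π times the source norm. Here 1/(2π) multiplies the spectral measure in (a) and the integral in (b); the integral in (b) is extended by continuity, and pointwise a.e. where it converges absolutely. *)

theory Defs
  imports "HOL-Complex_Analysis.Complex_Analysis"
begin

(* The Gauss function on the complex plane slit along [1,\<infinity>): the analytic continuation of the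
   hypergeometric series from the unit disc.  It is needed off the disc, since its argument -x
   below ranges over the whole negative half-line.  Values on the slit are irrelevant. *)

definition is_hyp2F1 :: "complex \<Rightarrow> complex \<Rightarrow> complex \<Rightarrow> (complex \<Rightarrow> complex) \<Rightarrow> bool" where
  "is_hyp2F1 p q r F \<longleftrightarrow>
     F holomorphic_on - (complex_of_real ` {1..}) \<and>
     (\<forall>z\<in>ball 0 1. F z = eval_fps (fps_hypergeo [p, q] [r] 1) z)"

definition hyp2F1 :: "complex \<Rightarrow> complex \<Rightarrow> complex \<Rightarrow> complex \<Rightarrow> complex" where
  "hyp2F1 p q r = (SOME F. is_hyp2F1 p q r F)"

lemma hyp2F1_series:
  "eval_fps (fps_hypergeo [p, q] [r] 1) z =
     (\<Sum>n. pochhammer p n * pochhammer q n / (pochhammer r n * fact n) * (z::complex) ^ n)"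
  by (simp add: eval_fps_def mult.commute)

lemma is_hyp2F1_unique:
  assumes F: "is_hyp2F1 p q r F" and G: "is_hyp2F1 p q r G" and z: "z \<notin> complex_of_real ` {1..}"
  shows "F z = G z"
proof (rule analytic_continuation_open[of "ball 0 1" "- (complex_of_real ` {1..})" F G z])
  show "open (- (complex_of_real ` {1..}))"
    by (intro open_Compl closed_injective_linear_image) (auto simp: linear_of_real inj_def)
  show "connected (- (complex_of_real ` {1..}))"
    by (intro starlike_imp_connected starlike_slotted_complex_plane_right)
qed (use F G z in \<open>auto simp: is_hyp2F1_def\<close>)


(* L2 M consists of square-integrable functions, not of their classes modulo null sets.  All
   assertions about operators on L2 are therefore made up to null sets. *)

definition L2 :: "'a measure \<Rightarrow> ('a \<Rightarrow> complex) set" where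
  "L2 M = {f \<in> borel_measurable M. integrable M (\<lambda>x. (cmod (f x))\<^sup>2)}"

definition L2_compact_support :: "'a::topological_space measure \<Rightarrow> ('a \<Rightarrow> complex) set" where
  "L2_compact_support M = {f \<in> L2 M. \<exists>K. compact K \<and> (\<forall>x\<in>space M - K. f x = 0)}"

definition L2_tendsto :: "'a measure \<Rightarrow> (nat \<Rightarrow> 'a \<Rightarrow> complex) \<Rightarrow> ('a \<Rightarrow> complex) \<Rightarrow> bool" where
  "L2_tendsto M F f \<longleftrightarrow> (\<forall>n. F n \<in> L2 M) \<and> f \<in> L2 M \<and>
     (\<lambda>n. \<integral>\<^sup>+x. ennreal ((cmod (F n x - f x))\<^sup>2) \<partial>M) \<longlonglongrightarrow> 0"

definition unitary_L2 ::
  "'a measure \<Rightarrow> 'b measure \<Rightarrow> (('a \<Rightarrow> complex) \<Rightarrow> 'b \<Rightarrow> complex) \<Rightarrow> bool" where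
  "unitary_L2 M N U \<longleftrightarrow>
     (\<forall>f\<in>L2 M. U f \<in> L2 N) \<and>
     (\<forall>f\<in>L2 M. \<forall>g\<in>L2 M. (AE x in M. f x = g x) \<longrightarrow> (AE y in N. U f y = U g y)) \<and>
     (\<forall>f\<in>L2 M. \<forall>g\<in>L2 M. \<forall>\<alpha> \<beta>.
        AE y in N. U (\<lambda>x. \<alpha> * f x + \<beta> * g x) y = \<alpha> * U f y + \<beta> * U g y) \<and>
     (\<forall>f\<in>L2 M. \<forall>g\<in>L2 M. (\<integral>y. U f y * cnj (U g y) \<partial>N) = (\<integral>x. f x * cnj (g x) \<partial>M)) \<and>
     (\<forall>g\<in>L2 N. \<exists>f\<in>L2 M. AE y in N. U f y = g y)"

(* Extension by continuity to L2 M of an operator T given on compactly supported functions. *)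

definition L2_extension :: "'a::topological_space measure \<Rightarrow> 'b measure \<Rightarrow>
    (('a \<Rightarrow> complex) \<Rightarrow> 'b \<Rightarrow> complex) \<Rightarrow> ('a \<Rightarrow> complex) \<Rightarrow> 'b \<Rightarrow> complex" where
  "L2_extension M N T f = (SOME g. \<exists>h. (\<forall>n. h n \<in> L2_compact_support M) \<and>
     L2_tendsto M h f \<and> L2_tendsto N (\<lambda>n. T (h n)) g)"


definition source_weight :: "real \<Rightarrow> real \<Rightarrow> real \<Rightarrow> real" where
  "source_weight b c x = x powr (b + c - 1) * (1 + x) powr (b - c)"

definition spectral_weight :: "real \<Rightarrow> real \<Rightarrow> real \<Rightarrow> real" where
  "spectral_weight b c s =
     (cmod (Gamma (of_real b + \<i> * of_real s) * Gamma (of_real c + \<i> * of_real s)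
            / Gamma (2 * \<i> * of_real s)))\<^sup>2"

definition source_measure :: "real \<Rightarrow> real \<Rightarrow> real measure" where
  "source_measure b c =
     density (restrict_space lborel {0..}) (\<lambda>x. ennreal (source_weight b c x))"

definition spectral_measure :: "real \<Rightarrow> real \<Rightarrow> real measure" where
  "spectral_measure b c =
     density (restrict_space lborel {0..}) (\<lambda>s. ennreal (spectral_weight b c s))"

definition index_kernel :: "real \<Rightarrow> real \<Rightarrow> real \<Rightarrow> real \<Rightarrow> complex" where
  "index_kernel b c s x =
     hyp2F1 (of_real b + \<i> * of_real s) (of_real b - \<i> * of_real s) (of_real (b + c))
       (of_real (- x))"

definition index_integral :: "real \<Rightarrow> real \<Rightarrow> (real \<Rightarrow> complex) \<Rightarrow> real \<Rightarrow> complex" where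
  "index_integral b c f s = of_real (1 / Gamma (b + c)) *
     (LBINT x:{0..}. f x * index_kernel b c s x * of_real (source_weight b c x))"

definition index_transform :: "real \<Rightarrow> real \<Rightarrow> (real \<Rightarrow> complex) \<Rightarrow> real \<Rightarrow> complex" where
  "index_transform b c =
     L2_extension (source_measure b c) (spectral_measure b c) (index_integral b c)"

(* The factor 1 / (2 * pi) is needed for this to invert index_transform.  For example, for b = 1
   and c = 1/2 the substitution x = (sinh t)^2 gives the kernel sin (2*s*t) / (s * sinh (2*t))
   and the spectral weight 4 * pi * s^2, so that everything reduces to the sine transform, and
   index_transform multiplies the squared norm by 2 * pi. *)

definition inverse_index_integral :: "real \<Rightarrow> real \<Rightarrow> (real \<Rightarrow> complex) \<Rightarrow> real \<Rightarrow> complex" where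
  "inverse_index_integral b c g x = of_real (1 / (2 * pi)) * of_real (1 / Gamma (b + c)) *
     (LBINT s:{0..}. g s * index_kernel b c s x * of_real (spectral_weight b c s))"

definition inverse_index_transform :: "real \<Rightarrow> real \<Rightarrow> (real \<Rightarrow> complex) \<Rightarrow> real \<Rightarrow> complex" where
  "inverse_index_transform b c =
     L2_extension (spectral_measure b c) (source_measure b c) (inverse_index_integral b c)"

end

theory Submission
  imports Defs
begin

text \<open>
  Write \<open>u = 1/(1+x)\<close>. By Fubini and the Beta integral, the transform of
  \<open>(1+x)\<^bsup>-a-b\<^esup>\<close> is \<open>\<bar>\<Gamma>(a+\<i>s)\<bar>\<^sup>2 / (\<Gamma>(a+b) \<Gamma>(a+c))\<close>, so for these powers the Plancherel
  formula is Wilson's integral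
  \<open>1/2\<pi> \<integral>\<^sub>0\<^sup>\<infinity> \<bar>\<Gamma>(a+\<i>s) \<Gamma>(b+\<i>s) \<Gamma>(c+\<i>s) \<Gamma>(d+\<i>s) / \<Gamma>(2\<i>s)\<bar>\<^sup>2 ds =
  \<Gamma>(a+b) \<Gamma>(a+c) \<Gamma>(a+d) \<Gamma>(b+c) \<Gamma>(b+d) \<Gamma>(c+d) / \<Gamma>(a+b+c+d)\<close>.
  Shifting the contour gives the recurrence of Wilson's integral under \<open>a \<mapsto> a+1\<close>; since
  \<open>\<bar>\<Gamma>(a+\<i>s)\<bar> / \<Gamma>(a)\<close> increases with \<open>a\<close>, the recurrence determines the integral up to a
  constant factor, which is found from the limit \<open>a \<rightarrow> 0\<close>, \<open>b = c = d = 1/2\<close>.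

  By Weierstrass, the functions \<open>u\<^bsup>\<kappa>+b+n\<^esup>\<close>, \<open>n \<ge> 0\<close>, span a dense subspace, hence the transform is
  isometric. Its range is closed and contains \<open>\<bar>\<Gamma>(\<kappa>+n+\<i>s)\<bar>\<^sup>2\<close>. Division by
  \<open>s\<^sup>2+\<kappa>\<^sup>2\<close> is bounded and, by the functional equation of \<open>\<Gamma>\<close>, maps the functions with
  \<open>n \<ge> 1\<close> into the range; as these already come from a dense subspace, the range is invariant
  under the division. So it contains \<open>\<bar>\<Gamma>(\<kappa>+\<i>s)\<bar>\<^sup>2\<close> times every polynomial in
  \<open>1/(s\<^sup>2+\<kappa>\<^sup>2)\<close>, and, again by Weierstrass, it is everything. Finally, the integral
  defining the inverse transform is the adjoint one, because the kernel is real.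
\<close>

section \<open>Square-integrable functions\<close>

text \<open>Two families of functions have to be treated together: the transform is an integral by
  definition only on compactly supported functions, while it can be computed only for powers of
  \<open>u\<close>, which live on the whole half-line. The weighted space \<open>D2\<close> contains
  both. Its norm controls the L1 norm, so approximation by powers passes to the value of the
  transform at every point, and Fatou's lemma carries the norm identity along. The number \<kappa>
  of the overview is \<open>b + 1\<close> in the code: the Beta integral asks for exponents
  \<open>a > b\<close>, and \<open>a = b + 1 + n\<close> satisfies this for all n. The powers are
  not orthogonal. A multiple of an isometry is recognised by its Gram matrix instead, and Wilson's
  integral supplies the entries with a constant 2 pi, by which the spectral measure is divided in
  the unitarity statement. For the range, multiplication by \<open>s^2\<close> would be the natural
  operation, but it is unbounded and does not pass to limits. The function
  \<open>1 / (s^2 + (b + 1)^2)\<close> is bounded, and being injective on \<open>s \<ge> 0\<close>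
  it generates all Borel functions there.\<close>

definition L2_norm :: "'a measure \<Rightarrow> ('a \<Rightarrow> complex) \<Rightarrow> real" where
  "L2_norm M f = sqrt (\<integral>x. (cmod (f x))\<^sup>2 \<partial>M)"

lemma L2_measurable: "f \<in> L2 M \<Longrightarrow> f \<in> borel_measurable M"
  by (simp add: L2_def)

lemma L2_integrable: "f \<in> L2 M \<Longrightarrow> integrable M (\<lambda>x. (cmod (f x))\<^sup>2)"
  by (simp add: L2_def)

lemma L2_norm_nonneg [simp]: "0 \<le> L2_norm M f"
  by (simp add: L2_norm_def)

lemma L2_norm_squared: "(L2_norm M f)\<^sup>2 = (\<integral>x. (cmod (f x))\<^sup>2 \<partial>M)"
  by (simp add: L2_norm_def)

lemma L2_dominated:
  assumes "g \<in> L2 M" "f \<in> borel_measurable M" "AE x in M. cmod (f x) \<le> C * cmod (g x)"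
  shows "f \<in> L2 M"
proof -
  have "integrable M (\<lambda>x. C\<^sup>2 * (cmod (g x))\<^sup>2)"
    using L2_integrable[OF assms(1)] by simp
  moreover have "AE x in M. norm ((cmod (f x))\<^sup>2) \<le> norm (C\<^sup>2 * (cmod (g x))\<^sup>2)"
    using assms(3)
  proof eventually_elim
    case (elim x)
    hence "(cmod (f x))\<^sup>2 \<le> (C * cmod (g x))\<^sup>2" by (intro power_mono) auto
    thus ?case by (simp add: power_mult_distrib)
  qed
  ultimately have "integrable M (\<lambda>x. (cmod (f x))\<^sup>2)"
    using assms(2) by (elim Bochner_Integration.integrable_bound) measurable
  thus ?thesis using assms(2) by (simp add: L2_def)
qed

lemma L2_cmult: assumes "f \<in> L2 M" shows "(\<lambda>x. a * f x) \<in> L2 M"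
  using L2_measurable[OF assms]
  by (intro L2_dominated[OF assms, where C = "cmod a"]) (auto simp: norm_mult)

lemma cmod_add_square_le: "(cmod (a + b))\<^sup>2 \<le> 2 * (cmod a)\<^sup>2 + 2 * (cmod b)\<^sup>2"
proof -
  have "(cmod (a + b))\<^sup>2 \<le> (cmod a + cmod b)\<^sup>2"
    by (intro power_mono norm_triangle_ineq) auto
  also have "\<dots> \<le> 2 * (cmod a)\<^sup>2 + 2 * (cmod b)\<^sup>2"
    using sum_squares_bound[of "cmod a" "cmod b"] by (simp add: power2_sum)
  finally show ?thesis .
qed

lemma L2_add: assumes "f \<in> L2 M" "g \<in> L2 M" shows "(\<lambda>x. f x + g x) \<in> L2 M"
proof -
  have m: "(\<lambda>x. f x + g x) \<in> borel_measurable M"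
    using L2_measurable[OF assms(1)] L2_measurable[OF assms(2)] by measurable
  have "integrable M (\<lambda>x. 2 * (cmod (f x))\<^sup>2 + 2 * (cmod (g x))\<^sup>2)"
    using L2_integrable[OF assms(1)] L2_integrable[OF assms(2)] by simp
  hence "integrable M (\<lambda>x. (cmod (f x + g x))\<^sup>2)"
    using m by (rule_tac Bochner_Integration.integrable_bound) (auto simp: cmod_add_square_le)
  thus ?thesis using m by (simp add: L2_def)
qed

lemma L2_lincomb:
  assumes "f \<in> L2 M" "g \<in> L2 M" shows "(\<lambda>x. a * f x + b * g x) \<in> L2 M"
  using assms by (intro L2_add L2_cmult)

lemma L2_diff: assumes "f \<in> L2 M" "g \<in> L2 M" shows "(\<lambda>x. f x - g x) \<in> L2 M"
  using L2_lincomb[OF assms, of 1 "-1"] by simp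

lemma L2_zero: "(\<lambda>_. 0) \<in> L2 M"
  by (simp add: L2_def)

lemma L2_sum: "(\<And>i. i \<in> I \<Longrightarrow> f i \<in> L2 M) \<Longrightarrow> (\<lambda>x. \<Sum>i\<in>I. f i x) \<in> L2 M"
  by (induction I rule: infinite_finite_induct) (auto intro: L2_zero L2_add)

lemma L2_integrable_mult:
  assumes "f \<in> L2 M" "g \<in> L2 M" shows "integrable M (\<lambda>x. f x * g x)"
proof -
  have "integrable M (\<lambda>x. (cmod (f x))\<^sup>2 + (cmod (g x))\<^sup>2)"
    using L2_integrable[OF assms(1)] L2_integrable[OF assms(2)] by simp
  moreover have "norm (f x * g x) \<le> norm ((cmod (f x))\<^sup>2 + (cmod (g x))\<^sup>2)" for x
    using sum_squares_bound[of "cmod (f x)" "cmod (g x)"]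
      mult_nonneg_nonneg[OF norm_ge_zero[of "f x"] norm_ge_zero[of "g x"]]
    unfolding norm_mult real_norm_def by linarith
  ultimately show ?thesis using L2_measurable[OF assms(1)] L2_measurable[OF assms(2)]
    by (rule_tac Bochner_Integration.integrable_bound) auto
qed

lemma borel_measurable_cnj [measurable]: "cnj \<in> borel_measurable borel"
  by (intro borel_measurable_continuous_onI continuous_intros)

lemma L2_cnj: "f \<in> L2 M \<Longrightarrow> (\<lambda>x. cnj (f x)) \<in> L2 M"
  by (auto simp: L2_def intro: measurable_compose[OF _ borel_measurable_cnj])

lemma nn_integral_L2:
  assumes "f \<in> L2 M"
  shows "(\<integral>\<^sup>+x. ennreal ((cmod (f x))\<^sup>2) \<partial>M) = ennreal ((L2_norm M f)\<^sup>2)"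
  using L2_integrable[OF assms] by (simp add: L2_norm_squared nn_integral_eq_integral)

lemma L2_cauchy_schwarz:
  assumes "f \<in> L2 M" "g \<in> L2 M"
  shows "(\<integral>x. cmod (f x) * cmod (g x) \<partial>M) \<le> L2_norm M f * L2_norm M g"
proof -
  note m[measurable] = L2_measurable[OF assms(1)] L2_measurable[OF assms(2)]
  have "integrable M (\<lambda>x. norm (f x * g x))"
    using L2_integrable_mult[OF assms] by (rule integrable_norm)
  hence i: "integrable M (\<lambda>x. cmod (f x) * cmod (g x))" by (simp add: norm_mult)
  have p: "(\<integral>x. cmod (f x) * cmod (g x) \<partial>M) \<ge> 0" by simp
  have "(\<integral>\<^sup>+x. ennreal (cmod (f x)) * ennreal (cmod (g x)) \<partial>M)\<^sup>2
     \<le> (\<integral>\<^sup>+x. (ennreal (cmod (f x)))\<^sup>2 \<partial>M) * (\<integral>\<^sup>+x. (ennreal (cmod (g x)))\<^sup>2 \<partial>M)"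
    by (rule Cauchy_Schwarz_nn_integral) measurable
  also have "\<dots> = ennreal ((L2_norm M f)\<^sup>2) * ennreal ((L2_norm M g)\<^sup>2)"
    unfolding nn_integral_L2[OF assms(1), symmetric] nn_integral_L2[OF assms(2), symmetric]
    by (simp add: ennreal_power)
  also have "(\<integral>\<^sup>+x. ennreal (cmod (f x)) * ennreal (cmod (g x)) \<partial>M)
      = ennreal (\<integral>x. cmod (f x) * cmod (g x) \<partial>M)"
    by (subst nn_integral_eq_integral[OF i, symmetric]) (simp_all add: ennreal_mult)
  also have "(ennreal (\<integral>x. cmod (f x) * cmod (g x) \<partial>M))\<^sup>2 
      = ennreal ((\<integral>x. cmod (f x) * cmod (g x) \<partial>M)\<^sup>2)"
    by (rule ennreal_power[OF p])
  also have "ennreal ((L2_norm M f)\<^sup>2) * ennreal ((L2_norm M g)\<^sup>2) = ennreal ((L2_norm M f * L2_norm M g)\<^sup>2)"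
    by (subst ennreal_mult[symmetric]) (simp_all add: power_mult_distrib)
  finally have "ennreal ((\<integral>x. cmod (f x) * cmod (g x) \<partial>M)\<^sup>2) \<le> ennreal ((L2_norm M f * L2_norm M g)\<^sup>2)" .
  hence "(\<integral>x. cmod (f x) * cmod (g x) \<partial>M)\<^sup>2 \<le> (L2_norm M f * L2_norm M g)\<^sup>2"
    by (subst (asm) ennreal_le_iff) auto
  thus ?thesis by (rule power2_le_imp_le) auto
qed

lemma L2_norm_add_le:
  assumes "f \<in> L2 M" "g \<in> L2 M"
  shows "L2_norm M (\<lambda>x. f x + g x) \<le> L2_norm M f + L2_norm M g"
proof (rule power2_le_imp_le)
  have "integrable M (\<lambda>x. norm (f x * g x))"
    using L2_integrable_mult[OF assms] by (rule integrable_norm)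
  hence i: "integrable M (\<lambda>x. cmod (f x) * cmod (g x))" by (simp add: norm_mult)
  note ii = L2_integrable[OF assms(1)] L2_integrable[OF assms(2)] L2_integrable[OF L2_add[OF assms]]
  have "(L2_norm M (\<lambda>x. f x + g x))\<^sup>2 
    \<le> (\<integral>x. (cmod (f x))\<^sup>2 + (cmod (g x))\<^sup>2 + 2 * (cmod (f x) * cmod (g x)) \<partial>M)"
    unfolding L2_norm_squared
  proof (rule integral_mono)
    fix x 
    have "(cmod (f x + g x))\<^sup>2 \<le> (cmod (f x) + cmod (g x))\<^sup>2"
      by (intro power_mono norm_triangle_ineq) auto
    thus "(cmod (f x + g x))\<^sup>2 \<le> (cmod (f x))\<^sup>2 + (cmod (g x))\<^sup>2 + 2 * (cmod (f x) * cmod (g x))"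
      by (simp add: power2_sum)
  qed (use i ii in auto)
  also have "\<dots> = (L2_norm M f)\<^sup>2 + (L2_norm M g)\<^sup>2 + 2 * (\<integral>x. cmod (f x) * cmod (g x) \<partial>M)"
    using i ii by (simp add: L2_norm_squared)
  also have "\<dots> \<le> (L2_norm M f + L2_norm M g)\<^sup>2"
    using L2_cauchy_schwarz[OF assms] by (simp add: power2_sum)
  finally show "(L2_norm M (\<lambda>x. f x + g x))\<^sup>2 \<le> (L2_norm M f + L2_norm M g)\<^sup>2" .
qed simp

lemma L2_norm_cmult: "L2_norm M (\<lambda>x. a * f x) = cmod a * L2_norm M f"
  by (simp add: L2_norm_def norm_mult power_mult_distrib real_sqrt_mult)

lemma L2_norm_minus_commute: "L2_norm M (\<lambda>x. f x - g x) = L2_norm M (\<lambda>x. g x - f x)"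
  by (simp add: L2_norm_def norm_minus_commute)

lemma L2_norm_cong_AE:
  assumes "f \<in> borel_measurable M" "g \<in> borel_measurable M" "AE x in M. f x = g x"
  shows "L2_norm M f = L2_norm M g"
proof -
  have "(\<integral>x. (cmod (f x))\<^sup>2 \<partial>M) = (\<integral>x. (cmod (g x))\<^sup>2 \<partial>M)"
    using assms by (intro integral_cong_AE) (auto elim: eventually_mono)
  thus ?thesis by (simp add: L2_norm_def)
qed

lemma L2_norm_triangle:
  assumes "f \<in> L2 M" "g \<in> L2 M" "h \<in> L2 M"
  shows "L2_norm M (\<lambda>x. f x - h x) \<le> L2_norm M (\<lambda>x. f x - g x) + L2_norm M (\<lambda>x. g x - h x)"
  using L2_norm_add_le[OF L2_diff[OF assms(1,2)] L2_diff[OF assms(2,3)]] by simp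

lemma L2_norm_diff_ge:
  assumes "f \<in> L2 M" "g \<in> L2 M"
  shows "\<bar>L2_norm M f - L2_norm M g\<bar> \<le> L2_norm M (\<lambda>x. f x - g x)"
  using L2_norm_triangle[OF assms L2_zero] L2_norm_triangle[OF assms(2,1) L2_zero]
  by (simp add: L2_norm_minus_commute[of M f g])

lemma L2_norm_eq_0_iff:
  assumes "f \<in> L2 M" shows "L2_norm M f = 0 \<longleftrightarrow> (AE x in M. f x = 0)"
  using integral_nonneg_eq_0_iff_AE[OF L2_integrable[OF assms]] by (simp add: L2_norm_def)

lemma tendsto_ennreal_0_iff:
  assumes "\<And>n. X n \<ge> 0"
  shows "(\<lambda>n. ennreal (X n)) \<longlonglongrightarrow> 0 \<longleftrightarrow> X \<longlonglongrightarrow> 0"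
  using tendsto_ennreal_iff[of X sequentially 0] assms by simp

text \<open>The definition uses the extended integral of the squared distance, which is meaningful
  for all measurable functions; between members of L2 it is the square of the norm.\<close>

lemma L2_tendsto_iff:
  "L2_tendsto M F f \<longleftrightarrow> (\<forall>n. F n \<in> L2 M) \<and> f \<in> L2 M \<and> (\<lambda>n. L2_norm M (\<lambda>x. F n x - f x)) \<longlonglongrightarrow> 0"
proof (cases "(\<forall>n. F n \<in> L2 M) \<and> f \<in> L2 M")
  case True
  hence L: "(\<lambda>x. F n x - f x) \<in> L2 M" for n by (intro L2_diff) auto
  have "(\<lambda>n. \<integral>\<^sup>+x. ennreal ((cmod (F n x - f x))\<^sup>2) \<partial>M) \<longlonglongrightarrow> 0 \<longleftrightarrow>
      (\<lambda>n. (L2_norm M (\<lambda>x. F n x - f x))\<^sup>2) \<longlonglongrightarrow> 0"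
    unfolding nn_integral_L2[OF L] by (rule tendsto_ennreal_0_iff) simp
  also have "\<dots> \<longleftrightarrow> (\<lambda>n. L2_norm M (\<lambda>x. F n x - f x)) \<longlonglongrightarrow> 0" 
  proof
    assume "(\<lambda>n. (L2_norm M (\<lambda>x. F n x - f x))\<^sup>2) \<longlonglongrightarrow> 0"
    from tendsto_real_sqrt[OF this] show "(\<lambda>n. L2_norm M (\<lambda>x. F n x - f x)) \<longlonglongrightarrow> 0" by simp
  next
    assume "(\<lambda>n. L2_norm M (\<lambda>x. F n x - f x)) \<longlonglongrightarrow> 0"
    from tendsto_power[OF this, of 2] show "(\<lambda>n. (L2_norm M (\<lambda>x. F n x - f x))\<^sup>2) \<longlonglongrightarrow> 0" by simp
  qed
  finally show ?thesis using True by (simp add: L2_tendsto_def)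
qed (auto simp: L2_tendsto_def)

lemma L2_tendstoD:
  assumes "L2_tendsto M F f"
  shows "F n \<in> L2 M" "f \<in> L2 M" "(\<lambda>n. L2_norm M (\<lambda>x. F n x - f x)) \<longlonglongrightarrow> 0"
  using assms by (auto simp: L2_tendsto_iff)

lemma L2_tendstoI_le:
  assumes "\<And>n. F n \<in> L2 M" "f \<in> L2 M" "\<And>n. L2_norm M (\<lambda>x. F n x - f x) \<le> e n" "e \<longlonglongrightarrow> 0"
  shows "L2_tendsto M F f"
  unfolding L2_tendsto_iff using assms
  by (auto intro!: tendsto_sandwich[OF _ _ tendsto_const assms(4)])

lemma L2_norm_cong: "(\<And>x. x \<in> space M \<Longrightarrow> f x = g x) \<Longrightarrow> L2_norm M f = L2_norm M g"
  unfolding L2_norm_def by (intro arg_cong[where f = sqrt] Bochner_Integration.integral_cong) auto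

lemma L2_cong: 
  assumes "\<And>x. x \<in> space M \<Longrightarrow> f x = g x" shows "f \<in> L2 M \<longleftrightarrow> g \<in> L2 M"
proof -
  have "f \<in> borel_measurable M \<longleftrightarrow> g \<in> borel_measurable M" by (rule measurable_cong[OF assms])
  moreover have "integrable M (\<lambda>x. (cmod (f x))\<^sup>2) \<longleftrightarrow> integrable M (\<lambda>x. (cmod (g x))\<^sup>2)"
    by (rule Bochner_Integration.integrable_cong) (simp_all add: assms)
  ultimately show ?thesis by (simp add: L2_def)
qed

lemma L2_tendsto_cong:
  assumes "\<And>n x. x \<in> space M \<Longrightarrow> F n x = G n x" shows "L2_tendsto M F f \<longleftrightarrow> L2_tendsto M G f"
proof -
  have "F n \<in> L2 M \<longleftrightarrow> G n \<in> L2 M" for n by (rule L2_cong[OF assms])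
  moreover have "L2_norm M (\<lambda>x. F n x - f x) = L2_norm M (\<lambda>x. G n x - f x)" for n
    by (rule L2_norm_cong) (simp add: assms)
  ultimately show ?thesis by (simp add: L2_tendsto_iff)
qed

lemma L2_tendsto_const: "f \<in> L2 M \<Longrightarrow> L2_tendsto M (\<lambda>_. f) f"
  by (auto simp: L2_tendsto_iff L2_norm_def)

lemma L2_tendsto_norm:
  assumes "L2_tendsto M F f" shows "(\<lambda>n. L2_norm M (F n)) \<longlonglongrightarrow> L2_norm M f"
proof -
  have "(\<lambda>n. L2_norm M (F n) - L2_norm M f) \<longlonglongrightarrow> 0"
    by (rule Lim_null_comparison[OF always_eventually L2_tendstoD(3)[OF assms]])
       (use L2_norm_diff_ge L2_tendstoD[OF assms] in auto)
  thus ?thesis by (simp add: LIM_zero_iff)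
qed

lemma L2_tendsto_lincomb:
  assumes "L2_tendsto M F f" "L2_tendsto M G g"
  shows "L2_tendsto M (\<lambda>n x. a * F n x + b * G n x) (\<lambda>x. a * f x + b * g x)"
proof (rule L2_tendstoI_le)
  note A = L2_tendstoD[OF assms(1)] and B = L2_tendstoD[OF assms(2)]
  show "(\<lambda>x. a * F n x + b * G n x) \<in> L2 M" "(\<lambda>x. a * f x + b * g x) \<in> L2 M" for n
    using A B by (auto intro!: L2_lincomb)
  show "L2_norm M (\<lambda>x. a * F n x + b * G n x - (a * f x + b * g x)) \<le>
     cmod a * L2_norm M (\<lambda>x. F n x - f x) + cmod b * L2_norm M (\<lambda>x. G n x - g x)" for n
    using L2_norm_add_le[OF L2_cmult[OF L2_diff[OF A(1,2), of n], of a] 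
       L2_cmult[OF L2_diff[OF B(1,2), of n], of b]]
    unfolding L2_norm_cmult by (simp add: algebra_simps)
  show "(\<lambda>n. cmod a * L2_norm M (\<lambda>x. F n x - f x) + cmod b * L2_norm M (\<lambda>x. G n x - g x)) \<longlonglongrightarrow> 0"
    by (rule tendsto_eq_intros A B refl)+ simp
qed

lemma L2_tendsto_unique:
  assumes "L2_tendsto M F f" "L2_tendsto M F g" shows "AE x in M. f x = g x"
proof -
  have "L2_tendsto M (\<lambda>n x. 1 * F n x + (-1) * F n x) (\<lambda>x. 1 * f x + (-1) * g x)"
    by (rule L2_tendsto_lincomb[OF assms])
  from L2_tendsto_norm[OF this] have "L2_norm M (\<lambda>x. f x - g x) = 0"
    by (simp add: L2_norm_def LIMSEQ_const_iff)
  thus ?thesis 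
    using L2_norm_eq_0_iff[OF L2_diff[OF L2_tendstoD(2)[OF assms(1)] L2_tendstoD(2)[OF assms(2)]]]
    by simp
qed

text \<open>L2 convergence is L1 convergence of the squared differences, which tend to 0 almost
  everywhere along a subsequence. The pointwise inversion formula rests on this.\<close>

lemma L2_tendsto_AE_subseq:
  assumes "L2_tendsto M F f"
  shows "\<exists>r. strict_mono r \<and> (AE x in M. (\<lambda>n. F (r n) x) \<longlonglongrightarrow> f x)"
proof -
  note A = L2_tendstoD[OF assms]
  have "(\<lambda>n. (L2_norm M (\<lambda>x. F n x - f x))\<^sup>2) \<longlonglongrightarrow> 0" using tendsto_power[OF A(3), of 2] by simp
  hence "(\<lambda>n. \<integral>x. norm ((cmod (F n x - f x))\<^sup>2) \<partial>M) \<longlonglongrightarrow> 0" by (simp add: L2_norm_squared)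
  from tendsto_L1_AE_subseq[OF L2_integrable[OF L2_diff[OF A(1,2)]] this]
  obtain r where r: "strict_mono r" "AE x in M. (\<lambda>n. (cmod (F (r n) x - f x))\<^sup>2) \<longlonglongrightarrow> 0" by blast
  have "AE x in M. (\<lambda>n. F (r n) x) \<longlonglongrightarrow> f x"
    using r(2)
  proof eventually_elim
    case (elim x)
    from tendsto_real_sqrt[OF this] have "(\<lambda>n. cmod (F (r n) x - f x)) \<longlonglongrightarrow> 0" by simp
    thus ?case by (simp add: LIM_zero_iff tendsto_norm_zero_iff)
  qed
  thus ?thesis using r(1) by blast
qed

section \<open>Fatou's lemma and completeness of L2\<close>

lemma L2_fatou:
  assumes "\<And>n. F n \<in> L2 M" "f \<in> borel_measurable M" "AE x in M. (\<lambda>n. F n x) \<longlonglongrightarrow> f x"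
    and "\<And>n. L2_norm M (F n) \<le> C"
  shows "f \<in> L2 M" "L2_norm M f \<le> C"
proof -
  have C: "C \<ge> 0" using assms(4)[of 0] L2_norm_nonneg[of M "F 0"] by linarith
  note [measurable] = L2_measurable[OF assms(1)]
  have "(\<integral>\<^sup>+x. ennreal ((cmod (f x))\<^sup>2) \<partial>M) = (\<integral>\<^sup>+x. liminf (\<lambda>n. ennreal ((cmod (F n x))\<^sup>2)) \<partial>M)"
  proof (rule nn_integral_cong_AE, use assms(3) in eventually_elim)
    case (elim x)
    hence "(\<lambda>n. ennreal ((cmod (F n x))\<^sup>2)) \<longlonglongrightarrow> ennreal ((cmod (f x))\<^sup>2)"
      by (intro tendsto_intros tendsto_ennrealI)
    thus ?case using lim_imp_Liminf by (metis sequentially_bot)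
  qed
  also have "\<dots> \<le> liminf (\<lambda>n. \<integral>\<^sup>+x. ennreal ((cmod (F n x))\<^sup>2) \<partial>M)"
    by (rule nn_integral_liminf) measurable
  also have "\<dots> \<le> liminf (\<lambda>n. ennreal (C\<^sup>2))"
    using assms(4) by (intro Liminf_mono always_eventually) 
      (auto simp: nn_integral_L2[OF assms(1)] intro!: ennreal_leI power_mono)
  also have "\<dots> = ennreal (C\<^sup>2)" by (simp add: Liminf_const)
  finally have le: "(\<integral>\<^sup>+x. ennreal ((cmod (f x))\<^sup>2) \<partial>M) \<le> ennreal (C\<^sup>2)" .
  hence "integrable M (\<lambda>x. (cmod (f x))\<^sup>2)"
    using assms(2) by (intro integrableI_bounded) (auto simp: le_less_trans)
  thus f: "f \<in> L2 M" using assms(2) by (simp add: L2_def)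
  from le have "(L2_norm M f)\<^sup>2 \<le> C\<^sup>2" by (simp add: nn_integral_L2[OF f])
  thus "L2_norm M f \<le> C" using C by (rule power2_le_imp_le)
qed


text \<open>The squared increments stay summable in the mean after multiplication by 2^n, hence are
  summable almost everywhere, and the arithmetic-geometric inequality makes the telescoping series
  absolutely convergent. Squares are used because the L1 norm of an increment may be infinite on an
  infinite measure space.\<close>

lemma L2_complete_fast:
  assumes "\<And>n. F n \<in> L2 M" "\<And>n. (L2_norm M (\<lambda>x. F (Suc n) x - F n x))\<^sup>2 \<le> (1/4) ^ n"
  shows "\<exists>f\<in>borel_measurable M. AE x in M. (\<lambda>n. F n x) \<longlonglongrightarrow> f x"
proof -
  note [measurable] = L2_measurable[OF assms(1)]
  define d where "d n x = 2 ^ n * (cmod (F (Suc n) x - F n x))\<^sup>2" for n x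
  have d_meas [measurable]: "d n \<in> borel_measurable M" for n unfolding d_def by measurable
  have "(\<integral>\<^sup>+x. ennreal (d n x) \<partial>M) \<le> ennreal ((1/2) ^ n)" for n
  proof -
    have "(\<integral>\<^sup>+x. ennreal (d n x) \<partial>M) = ennreal (2 ^ n * (L2_norm M (\<lambda>x. F (Suc n) x - F n x))\<^sup>2)"
      unfolding d_def by (simp add: ennreal_mult nn_integral_cmult nn_integral_L2[OF L2_diff[OF assms(1) assms(1)]])
    also have "\<dots> \<le> ennreal (2 ^ n * (1/4) ^ n)"
      using assms(2)[of n] by (intro ennreal_leI mult_left_mono) auto
    also have "(2::real) ^ n * (1/4) ^ n = (1/2) ^ n" by (simp flip: power_mult_distrib)
    finally show ?thesis .
  qed
  hence "(\<Sum>n. \<integral>\<^sup>+x. ennreal (d n x) \<partial>M) \<le> (\<Sum>n. ennreal ((1/2) ^ n))"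
    by (intro suminf_le) auto
  also have "\<dots> = ennreal (\<Sum>n. (1/2) ^ n)"
    by (intro suminf_ennreal2 summable_geometric) auto
  also have "\<dots> < \<infinity>" by simp
  finally have "(\<integral>\<^sup>+x. (\<Sum>n. ennreal (d n x)) \<partial>M) < \<infinity>"
    by (simp add: nn_integral_suminf)
  hence "AE x in M. (\<Sum>n. ennreal (d n x)) \<noteq> \<infinity>"
    by (intro nn_integral_PInf_AE) auto
  hence conv: "AE x in M. convergent (\<lambda>n. F n x)"
  proof eventually_elim
    case (elim x)
    have sd: "summable (\<lambda>n. d n x)"
      by (rule summable_suminf_not_top) (use elim in \<open>auto simp: d_def\<close>)
    have "summable (\<lambda>n. norm (F (Suc n) x - F n x))"
    proof (rule summable_comparison_test'[where N = 0])
      show "summable (\<lambda>n. d n x + (1/2) ^ n)" by (intro summable_add sd summable_geometric) auto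
      fix n
      define t where "t = cmod (F (Suc n) x - F n x)"
      have t: "t \<ge> 0" by (simp add: t_def)
      \<comment> \<open>This is (2^n t - 1)^2 \<ge> 0 divided by 2^n.\<close>
      have "2 * t \<le> 2 ^ n * t\<^sup>2 + (1/2) ^ n"
      proof -
        have "0 \<le> (2 ^ n * t - 1)\<^sup>2" by simp
        hence "2 * (2 ^ n * t) \<le> (2 ^ n * t)\<^sup>2 + 1" by (simp add: power2_diff)
        hence "(2 * (2 ^ n * t)) / 2 ^ n \<le> ((2 ^ n * t)\<^sup>2 + 1) / 2 ^ n" by (intro divide_right_mono) auto
        thus ?thesis by (simp add: add_divide_distrib power_mult_distrib power2_eq_square power_one_over mult_ac)
      qed
      with t show "norm (norm (F (Suc n) x - F n x)) \<le> d n x + (1/2) ^ n"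
        by (simp add: d_def flip: t_def)
    qed
    hence "summable (\<lambda>n. F (Suc n) x - F n x)" by (rule summable_norm_cancel)
    hence "(\<lambda>n. \<Sum>k<n. F (Suc k) x - F k x) \<longlonglongrightarrow> (\<Sum>k. F (Suc k) x - F k x)" 
      by (rule summable_LIMSEQ)
    hence "(\<lambda>n. F n x - F 0 x) \<longlonglongrightarrow> (\<Sum>k. F (Suc k) x - F k x)" 
      using sum_lessThan_telescope[of "\<lambda>n. F n x"] by simp
    from tendsto_add[OF this tendsto_const[of "F 0 x"]] show ?case 
      by (auto simp: convergent_def)
  qed
  have "(\<lambda>x. lim (\<lambda>n. F n x)) \<in> borel_measurable M" by measurable
  moreover have "AE x in M. (\<lambda>n. F n x) \<longlonglongrightarrow> lim (\<lambda>n. F n x)"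
    using conv by eventually_elim (simp add: convergent_LIMSEQ_iff)
  ultimately show ?thesis by (intro bexI)
qed

lemma L2_complete:
  assumes F: "\<And>n. F n \<in> L2 M" 
    and cauchy: "\<And>e. e > 0 \<Longrightarrow> \<exists>N. \<forall>m\<ge>N. \<forall>n\<ge>N. L2_norm M (\<lambda>x. F m x - F n x) \<le> e"
  shows "\<exists>f. L2_tendsto M F f"
proof -
  have "\<exists>N. \<forall>m\<ge>N. \<forall>n\<ge>N. L2_norm M (\<lambda>x. F m x - F n x) \<le> (1/2) ^ k" for k :: nat
    by (rule cauchy) simp
  then obtain N where N: "\<And>k m n. m \<ge> N k \<Longrightarrow> n \<ge> N k \<Longrightarrow> L2_norm M (\<lambda>x. F m x - F n x) \<le> (1/2) ^ k"
    by metis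
  \<comment> \<open>A sum of thresholds is increasing and dominates each of them, so two consecutive
    terms of the subsequence both lie beyond \<open>N k\<close>.\<close>
  define r where "r k = (\<Sum>j\<le>k. N j)" for k
  have r: "r k \<ge> N k" "r (Suc k) \<ge> r k" for k
    by (auto simp: r_def intro: member_le_sum)
  have "(L2_norm M (\<lambda>x. F (r (Suc n)) x - F (r n) x))\<^sup>2 \<le> (1/4) ^ n" for n
  proof -
    have "L2_norm M (\<lambda>x. F (r (Suc n)) x - F (r n) x) \<le> (1/2) ^ n"
      using r[of n] by (intro N) auto
    hence "(L2_norm M (\<lambda>x. F (r (Suc n)) x - F (r n) x))\<^sup>2 \<le> ((1/2) ^ n)\<^sup>2"
      by (intro power_mono) auto
    also have "((1/2) ^ n)\<^sup>2 = (1/4 :: real) ^ n" 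
      by (simp add: power2_eq_square flip: power_mult_distrib)
    finally show ?thesis .
  qed
  from L2_complete_fast[OF F this] obtain f where f: "f \<in> borel_measurable M" 
    "AE x in M. (\<lambda>n. F (r n) x) \<longlonglongrightarrow> f x" by blast
  \<comment> \<open>Fatou's lemma in the second index: the bound on
    \<open>F m - F (r (n + k))\<close> survives the limit in n, so the full sequence converges in
    norm and not only the subsequence.\<close>
  have lim: "(\<lambda>x. F m x - f x) \<in> L2 M \<and> L2_norm M (\<lambda>x. F m x - f x) \<le> (1/2) ^ k" if "m \<ge> N k" for m k
  proof -
    have ge: "r (n + k) \<ge> N k" for n
    proof -
      have "N k \<le> r k" by (rule r)
      also have "r k \<le> r (n + k)" by (induction n) (use r in \<open>auto intro: order_trans\<close>)
      finally show ?thesis .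
    qed
    have "AE x in M. (\<lambda>n. F m x - F (r (n + k)) x) \<longlonglongrightarrow> F m x - f x"
      using f(2) by eventually_elim (intro tendsto_diff tendsto_const LIMSEQ_ignore_initial_segment)
    from L2_fatou[OF L2_diff[OF F F] _ this N[OF that ge]]
    show ?thesis using L2_measurable[OF F] f(1) by auto
  qed
  have "(\<lambda>x. F (N 0) x - (F (N 0) x - f x)) \<in> L2 M"
    using lim[of 0 "N 0"] F[of "N 0"] L2_diff[of "F (N 0)" M "\<lambda>x. F (N 0) x - f x"] by blast
  hence fL: "f \<in> L2 M" by simp
  have "(\<lambda>n. L2_norm M (\<lambda>x. F n x - f x)) \<longlonglongrightarrow> 0"
  proof (rule LIMSEQ_I)
    fix e :: real assume "e > 0"
    then obtain k where k: "(1/2) ^ k < e" using real_arch_pow_inv[of e "1/2"] by auto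
    show "\<exists>no. \<forall>n\<ge>no. norm (L2_norm M (\<lambda>x. F n x - f x) - 0) < e"
      using lim k by (intro exI[of _ "N k"]) (fastforce intro: le_less_trans)
  qed
  thus ?thesis using F fL by (auto simp: L2_tendsto_iff)
qed

section \<open>Extension of multiples of isometries by continuity\<close>

lemma L2_norm_polarization:
  assumes "u \<in> L2 K" "v \<in> L2 K"
  shows "(\<integral>x. u x * cnj (v x) \<partial>K) = 
     (of_real ((L2_norm K (\<lambda>x. 1 * u x + 1 * v x))\<^sup>2) - of_real ((L2_norm K (\<lambda>x. 1 * u x + (-1) * v x))\<^sup>2) 
      + \<i> * (of_real ((L2_norm K (\<lambda>x. 1 * u x + \<i> * v x))\<^sup>2) 
             - of_real ((L2_norm K (\<lambda>x. 1 * u x + (-\<i>) * v x))\<^sup>2))) / 4"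
proof -
  define Q where "Q a x = complex_of_real ((cmod (1 * u x + a * v x))\<^sup>2)" for a x
  have "integrable K (\<lambda>x. (cmod (1 * u x + a * v x))\<^sup>2)" for a
    by (intro L2_integrable L2_lincomb assms)
  hence i: "integrable K (Q a)" for a unfolding Q_def by (rule integrable_of_real)
  have sq: "of_real ((L2_norm K (\<lambda>x. 1 * u x + a * v x))\<^sup>2) = (\<integral>x. Q a x \<partial>K)" for a
    unfolding L2_norm_squared Q_def by (rule integral_complex_of_real[symmetric])
  have "u x * cnj (v x) = (Q 1 x - Q (-1) x + \<i> * (Q \<i> x - Q (-\<i>) x)) / 4" for x
    unfolding Q_def complex_norm_square by (simp add: algebra_simps)
  hence "(\<lambda>x. u x * cnj (v x)) = (\<lambda>x. (Q 1 x - Q (-1) x + \<i> * (Q \<i> x - Q (-\<i>) x)) / 4)" by (rule ext)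
  thus ?thesis unfolding sq using i by simp
qed

text \<open>The constant \<open>C\<close> serves two applications: the transform with
  \<open>sqrt (2 * pi)\<close> and the inverse integral with the reciprocal. Linearity is demanded
  at points of the space only, since the inverse integral is under control for
  \<open>x \<ge> 0\<close> alone. The extension is a choice among the limits of all approximating
  sequences, so the task is to see that such limits exist and agree up to null sets.\<close>

locale L2_isometry =
  fixes M :: "'a::topological_space measure" and N :: "'b measure" 
    and T :: "('a \<Rightarrow> complex) \<Rightarrow> 'b \<Rightarrow> complex" and C :: real
  assumes C_pos: "C > 0"
    and T_L2: "\<And>f. f \<in> L2_compact_support M \<Longrightarrow> T f \<in> L2 N"
    and T_norm: "\<And>f. f \<in> L2_compact_support M \<Longrightarrow> L2_norm N (T f) = C * L2_norm M f"
    and T_lin: "\<And>f g a b y. f \<in> L2_compact_support M \<Longrightarrow> g \<in> L2_compact_support M \<Longrightarrow> y \<in> space N \<Longrightarrow>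
       T (\<lambda>x. a * f x + b * g x) y = a * T f y + b * T g y"
    and dense: "\<And>f. f \<in> L2 M \<Longrightarrow> \<exists>h. (\<forall>n. h n \<in> L2_compact_support M) \<and> L2_tendsto M h f"
begin

abbreviation "U \<equiv> L2_extension M N T"

lemma D_L2: "f \<in> L2_compact_support M \<Longrightarrow> f \<in> L2 M"
  by (simp add: L2_compact_support_def)

lemma D_lincomb:
  assumes "f \<in> L2_compact_support M" "g \<in> L2_compact_support M"
  shows "(\<lambda>x. a * f x + b * g x) \<in> L2_compact_support M"
proof -
  from assms obtain K L where "compact K" "\<forall>x\<in>space M - K. f x = 0" "compact L" "\<forall>x\<in>space M - L. g x = 0"
    by (auto simp: L2_compact_support_def)
  hence "compact (K \<union> L)" "\<forall>x\<in>space M - (K \<union> L). a * f x + b * g x = 0" by auto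
  thus ?thesis using assms unfolding L2_compact_support_def by (blast intro: L2_lincomb)
qed

lemma T_diff_norm:
  assumes "f \<in> L2_compact_support M" "g \<in> L2_compact_support M"
  shows "L2_norm N (\<lambda>y. T f y - T g y) = C * L2_norm M (\<lambda>x. f x - g x)"
proof -
  have "L2_norm N (\<lambda>y. T f y - T g y) = L2_norm N (T (\<lambda>x. 1 * f x + (-1) * g x))"
    by (rule L2_norm_cong) (simp only: T_lin[OF assms], simp)
  thus ?thesis using T_norm[OF D_lincomb[OF assms, of 1 "-1"]] by simp
qed

lemma extension_ex:
  assumes h: "\<And>n. h n \<in> L2_compact_support M" "L2_tendsto M h f"
  shows "\<exists>g. L2_tendsto N (\<lambda>n. T (h n)) g"
proof (rule L2_complete)
  show "T (h n) \<in> L2 N" for n by (intro T_L2 h)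
  fix e :: real assume "e > 0"
  hence "e / (2 * C) > 0" using C_pos by simp
  from order_tendstoD(2)[OF L2_tendstoD(3)[OF h(2)] this] obtain n0 where
    n0: "\<And>n. n \<ge> n0 \<Longrightarrow> L2_norm M (\<lambda>x. h n x - f x) < e / (2 * C)" 
    by (auto simp: eventually_sequentially)
  show "\<exists>n0. \<forall>m\<ge>n0. \<forall>n\<ge>n0. L2_norm N (\<lambda>x. T (h m) x - T (h n) x) \<le> e"
  proof (intro exI allI impI)
    fix m n assume "m \<ge> n0" "n \<ge> n0"
    hence "L2_norm M (\<lambda>x. h m x - h n x) \<le> e / (2 * C) + e / (2 * C)"
      using L2_norm_triangle[OF D_L2[OF h(1)[of m]] L2_tendstoD(2)[OF h(2)] D_L2[OF h(1)[of n]]]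
        n0[of m] n0[of n] by (simp add: L2_norm_minus_commute[of M f])
    thus "L2_norm N (\<lambda>x. T (h m) x - T (h n) x) \<le> e" 
      using C_pos unfolding T_diff_norm[OF h(1) h(1)] by (simp add: field_simps)
  qed
qed

lemma U_approx:
  assumes "f \<in> L2 M"
  shows "\<exists>h. (\<forall>n. h n \<in> L2_compact_support M) \<and> L2_tendsto M h f \<and> L2_tendsto N (\<lambda>n. T (h n)) (U f)"
proof -
  from dense[OF assms] obtain h where h: "\<And>n. h n \<in> L2_compact_support M" "L2_tendsto M h f" by blast
  from extension_ex[OF this] obtain g where "L2_tendsto N (\<lambda>n. T (h n)) g" by blast
  with h have "\<exists>g h. (\<forall>n. h n \<in> L2_compact_support M) \<and> L2_tendsto M h f \<and> L2_tendsto N (\<lambda>n. T (h n)) g" 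
    by blast
  thus ?thesis unfolding L2_extension_def by (rule someI_ex)
qed

lemma U_L2: "f \<in> L2 M \<Longrightarrow> U f \<in> L2 N"
  using U_approx L2_tendstoD(2) by blast

text \<open>Two approximating sequences differ by a sequence of norm tending to 0, and
  \<open>T\<close> only multiplies these norms by \<open>C\<close>. Hence any convenient sequence
  may be used to identify \<open>U f\<close>.\<close>

lemma U_unique:
  assumes h: "\<And>n. h n \<in> L2_compact_support M" "L2_tendsto M h f" "L2_tendsto N (\<lambda>n. T (h n)) g"
  shows "AE y in N. U f y = g y"
proof -
  from U_approx[OF L2_tendstoD(2)[OF h(2)]] obtain k where
    k: "\<And>n. k n \<in> L2_compact_support M" "L2_tendsto M k f" "L2_tendsto N (\<lambda>n. T (k n)) (U f)" by blast
  have "L2_tendsto N (\<lambda>n y. 1 * T (k n) y + (-1) * T (h n) y) (\<lambda>y. 1 * U f y + (-1) * g y)"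
    by (intro L2_tendsto_lincomb k h)
  from L2_tendsto_norm[OF this]
  have "(\<lambda>n. C * L2_norm M (\<lambda>x. k n x - h n x)) \<longlonglongrightarrow> L2_norm N (\<lambda>y. U f y - g y)"
    by (simp add: T_diff_norm[OF k(1) h(1)])
  moreover have "L2_tendsto M (\<lambda>n y. 1 * k n y + (-1) * h n y) (\<lambda>y. 1 * f y + (-1) * f y)"
    by (intro L2_tendsto_lincomb k h)
  from L2_tendsto_norm[OF this] have "(\<lambda>n. L2_norm M (\<lambda>x. k n x - h n x)) \<longlonglongrightarrow> 0"
    by (simp add: L2_norm_def[of M "\<lambda>_. 0"])
  hence "(\<lambda>n. C * L2_norm M (\<lambda>x. k n x - h n x)) \<longlonglongrightarrow> C * 0" by (intro tendsto_intros)
  ultimately have "L2_norm N (\<lambda>y. U f y - g y) = C * 0" by (rule LIMSEQ_unique)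
  hence "L2_norm N (\<lambda>y. U f y - g y) = 0" by simp
  thus ?thesis 
    using L2_norm_eq_0_iff[OF L2_diff[OF L2_tendstoD(2)[OF k(3)] L2_tendstoD(2)[OF h(3)]]] by simp
qed

lemma U_eq_T: "f \<in> L2_compact_support M \<Longrightarrow> AE y in N. U f y = T f y"
  using U_unique[of "\<lambda>_. f" f "T f"] by (simp add: L2_tendsto_const D_L2 T_L2)

lemma U_norm: assumes "f \<in> L2 M" shows "L2_norm N (U f) = C * L2_norm M f"
proof -
  from U_approx[OF assms] obtain h where
    h: "\<And>n. h n \<in> L2_compact_support M" "L2_tendsto M h f" "L2_tendsto N (\<lambda>n. T (h n)) (U f)" by blast
  have "(\<lambda>n. C * L2_norm M (h n)) \<longlonglongrightarrow> C * L2_norm M f" 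
    by (intro tendsto_intros L2_tendsto_norm h)
  moreover have "(\<lambda>n. C * L2_norm M (h n)) \<longlonglongrightarrow> L2_norm N (U f)"
    using L2_tendsto_norm[OF h(3)] by (simp add: T_norm h(1))
  ultimately show ?thesis using LIMSEQ_unique by blast
qed

lemma U_lin: 
  assumes "f \<in> L2 M" "g \<in> L2 M"
  shows "AE y in N. U (\<lambda>x. a * f x + b * g x) y = a * U f y + b * U g y"
proof -
  from U_approx[OF assms(1)] obtain h where
    h: "\<And>n. h n \<in> L2_compact_support M" "L2_tendsto M h f" "L2_tendsto N (\<lambda>n. T (h n)) (U f)" by blast
  from U_approx[OF assms(2)] obtain k where
    k: "\<And>n. k n \<in> L2_compact_support M" "L2_tendsto M k g" "L2_tendsto N (\<lambda>n. T (k n)) (U g)" by blast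
  show ?thesis
  proof (rule U_unique[of "\<lambda>n x. a * h n x + b * k n x"])
    show "L2_tendsto N (\<lambda>n. T (\<lambda>x. a * h n x + b * k n x)) (\<lambda>y. a * U f y + b * U g y)"
      by (subst L2_tendsto_cong[OF T_lin[OF h(1) k(1)]], assumption) (intro L2_tendsto_lincomb h k)
  qed (intro D_lincomb L2_tendsto_lincomb h k)+
qed

lemma U_diff_norm:
  assumes "f \<in> L2 M" "g \<in> L2 M"
  shows "L2_norm N (\<lambda>y. U f y - U g y) = C * L2_norm M (\<lambda>x. f x - g x)"
proof -
  have "L2_norm N (\<lambda>y. U f y - U g y) = L2_norm N (U (\<lambda>x. 1 * f x + (-1) * g x))"
    using U_lin[OF assms, of 1 "-1"] assms
    by (intro L2_norm_cong_AE) (auto intro!: L2_measurable L2_diff U_L2 elim: eventually_mono)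
  thus ?thesis using U_norm[OF L2_lincomb[OF assms, of 1 "-1"]] by simp
qed

lemma U_cong:
  assumes "f \<in> L2 M" "g \<in> L2 M" "AE x in M. f x = g x"
  shows "AE y in N. U f y = U g y"
proof -
  have "L2_norm M (\<lambda>x. f x - g x) = 0"
    using assms by (subst L2_norm_eq_0_iff) (auto intro: L2_diff)
  hence "L2_norm N (\<lambda>y. U f y - U g y) = 0" by (simp add: U_diff_norm assms)
  thus ?thesis by (subst (asm) L2_norm_eq_0_iff) (auto intro: L2_diff U_L2 assms)
qed

lemma U_tendsto:
  assumes "L2_tendsto M h f" shows "L2_tendsto N (\<lambda>n. U (h n)) (U f)"
proof (rule L2_tendstoI_le[where e = "\<lambda>n. C * L2_norm M (\<lambda>x. h n x - f x)"])
  note h = L2_tendstoD[OF assms]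
  show "(\<lambda>n. C * L2_norm M (\<lambda>x. h n x - f x)) \<longlonglongrightarrow> 0"
    using tendsto_mult[OF tendsto_const[of C] h(3)] by simp
qed (use L2_tendstoD[OF assms] in \<open>auto simp: U_diff_norm U_L2\<close>)

text \<open>Since \<open>C > 0\<close>, a Cauchy sequence of images comes from a Cauchy sequence of
  preimages, and continuity maps the limit of the latter to the given limit.\<close>

lemma range_closed:
  assumes G: "L2_tendsto N G g" and ran: "\<And>n. \<exists>f\<in>L2 M. AE y in N. U f y = G n y"
  shows "\<exists>f\<in>L2 M. AE y in N. U f y = g y"
proof -
  from ran obtain F where F: "\<And>n. F n \<in> L2 M" "\<And>n. AE y in N. U (F n) y = G n y" by metis
  have lim: "L2_tendsto N (\<lambda>n. U (F n)) g"
    unfolding L2_tendsto_iff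
  proof (intro conjI allI)
    have "L2_norm N (\<lambda>y. G n y - g y) = L2_norm N (\<lambda>y. U (F n) y - g y)" for n
      using F(2)[of n] L2_tendstoD(1,2)[OF G] F(1) 
      by (intro L2_norm_cong_AE) (auto intro!: L2_measurable L2_diff U_L2 elim: eventually_mono)
    with L2_tendstoD(3)[OF G] show "(\<lambda>n. L2_norm N (\<lambda>y. U (F n) y - g y)) \<longlonglongrightarrow> 0" by simp
  qed (use L2_tendstoD(2)[OF G] F U_L2 in auto)
  have "\<exists>f. L2_tendsto M F f"
  proof (rule L2_complete[OF F(1)])
    fix e :: real assume "e > 0"
    hence "e * C / 2 > 0" using C_pos by simp
    from order_tendstoD(2)[OF L2_tendstoD(3)[OF lim] this] obtain n0 where
      n0: "\<And>n. n \<ge> n0 \<Longrightarrow> L2_norm N (\<lambda>x. U (F n) x - g x) < e * C / 2" 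
      by (auto simp: eventually_sequentially)
    show "\<exists>n0. \<forall>m\<ge>n0. \<forall>n\<ge>n0. L2_norm M (\<lambda>x. F m x - F n x) \<le> e"
    proof (intro exI allI impI)
      fix m n assume "m \<ge> n0" "n \<ge> n0"
      hence "C * L2_norm M (\<lambda>x. F m x - F n x) \<le> e * C / 2 + e * C / 2"
        using L2_norm_triangle[OF L2_tendstoD(1)[OF lim, of m] L2_tendstoD(2)[OF lim] L2_tendstoD(1)[OF lim, of n]]
          n0[of m] n0[of n] unfolding L2_norm_minus_commute[of N g] U_diff_norm[OF F(1) F(1)] by linarith
      thus "L2_norm M (\<lambda>x. F m x - F n x) \<le> e" 
        using C_pos by (simp add: field_simps)
    qed
  qed
  then obtain f where f: "L2_tendsto M F f" by blast
  from L2_tendsto_unique[OF U_tendsto[OF f] lim] L2_tendstoD(2)[OF f] show ?thesis by blast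
qed

lemma U_inner:
  assumes "f \<in> L2 M" "g \<in> L2 M"
  shows "(\<integral>y. U f y * cnj (U g y) \<partial>N) = of_real (C\<^sup>2) * (\<integral>x. f x * cnj (g x) \<partial>M)"
proof -
  \<comment> \<open>The four norms of the polarization identity belong to combinations
    \<open>1 * f + a * g\<close>, to which linearity and the norm law of the extension apply; the
    factor 1 keeps the shape of the linearity law.\<close>
  have eq: "(L2_norm N (\<lambda>y. 1 * U f y + a * U g y))\<^sup>2 = C\<^sup>2 * (L2_norm M (\<lambda>x. 1 * f x + a * g x))\<^sup>2" for a
  proof -
    have "L2_norm N (\<lambda>y. 1 * U f y + a * U g y) = L2_norm N (U (\<lambda>x. 1 * f x + a * g x))"
      using U_lin[OF assms, of 1 a] assms
      by (intro L2_norm_cong_AE L2_measurable L2_lincomb U_L2) (auto elim: eventually_mono)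
    also have "\<dots> = C * L2_norm M (\<lambda>x. 1 * f x + a * g x)" by (rule U_norm[OF L2_lincomb[OF assms]])
    finally show ?thesis by (simp only: power_mult_distrib)
  qed
  show ?thesis
    unfolding L2_norm_polarization[OF U_L2[OF assms(1)] U_L2[OF assms(2)]] L2_norm_polarization[OF assms] eq by (simp add: algebra_simps)
qed

end

section \<open>Density of polynomials\<close>

lemma L2_tendsto_dominated:
  assumes F: "\<And>n. F n \<in> borel_measurable M" and f: "f \<in> borel_measurable M"
    and G: "integrable M (\<lambda>x. (G x :: real)\<^sup>2)" 
    and lim: "\<And>x. x \<in> space M \<Longrightarrow> (\<lambda>n. F n x) \<longlonglongrightarrow> f x"
    and bound: "\<And>n x. x \<in> space M \<Longrightarrow> cmod (F n x) \<le> G x"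
  shows "L2_tendsto M F f"
proof -
  have fb: "cmod (f x) \<le> G x" if "x \<in> space M" for x
    by (rule Lim_norm_ubound[OF _ lim[OF that]]) (use bound that in auto)
  have L: "h \<in> L2 M" if "h \<in> borel_measurable M" "\<And>x. x \<in> space M \<Longrightarrow> cmod (h x) \<le> G x" for h
  proof -
    have "integrable M (\<lambda>x. (cmod (h x))\<^sup>2)"
      by (rule Bochner_Integration.integrable_bound[OF G]) (use that in \<open>auto intro!: AE_I2 power_mono\<close>)
    thus ?thesis using that by (simp add: L2_def)
  qed
  have "(\<lambda>n. \<integral>x. (cmod (F n x - f x))\<^sup>2 \<partial>M) \<longlonglongrightarrow> (\<integral>x. 0 \<partial>M)"
  proof (rule integral_dominated_convergence[where w = "\<lambda>x. 4 * (G x)\<^sup>2"])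
    show "AE x in M. (\<lambda>n. (cmod (F n x - f x))\<^sup>2) \<longlonglongrightarrow> 0"
    proof (rule AE_I2)
      fix x assume "x \<in> space M"
      from tendsto_power[OF tendsto_norm[OF tendsto_diff[OF lim[OF this] tendsto_const[of "f x"]]], of 2]
      show "(\<lambda>n. (cmod (F n x - f x))\<^sup>2) \<longlonglongrightarrow> 0" by simp
    qed
    show "AE x in M. norm ((cmod (F n x - f x))\<^sup>2) \<le> 4 * (G x)\<^sup>2" for n
    proof (rule AE_I2)
      fix x assume x: "x \<in> space M"
      have "cmod (F n x - f x) \<le> 2 * G x" 
        using norm_triangle_ineq4[of "F n x" "f x"] bound[OF x, of n] fb[OF x] by linarith
      hence "(cmod (F n x - f x))\<^sup>2 \<le> (2 * G x)\<^sup>2" by (intro power_mono) auto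
      thus "norm ((cmod (F n x - f x))\<^sup>2) \<le> 4 * (G x)\<^sup>2" by (simp add: power_mult_distrib)
    qed
  qed (use F f G in auto)
  hence "(\<lambda>n. (L2_norm M (\<lambda>x. F n x - f x))\<^sup>2) \<longlonglongrightarrow> 0" by (simp add: L2_norm_squared)
  from tendsto_real_sqrt[OF this] have "(\<lambda>n. L2_norm M (\<lambda>x. F n x - f x)) \<longlonglongrightarrow> 0" by simp
  thus ?thesis unfolding L2_tendsto_iff using L F f bound fb by auto
qed

text \<open>A finite measure and a function into [0,1] reduce density questions on a non-compact
  space to the Weierstrass theorem on a compact interval.\<close>

locale bounded_generator = finite_measure M for M :: "'a measure" +
  fixes u :: "'a \<Rightarrow> real"
  assumes u_meas [measurable]: "u \<in> borel_measurable M" 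
    and u_range: "\<And>x. x \<in> space M \<Longrightarrow> u x \<in> {0..1}"
begin

text \<open>The approximated function is kept as a Borel function on the line, which makes induction
  over Borel sets available; distances are measured after composition with \<open>u\<close>.\<close>

definition approx :: "(real \<Rightarrow> complex) \<Rightarrow> bool" where
  "approx g \<longleftrightarrow> g \<in> borel_measurable borel \<and> (\<lambda>x. g (u x)) \<in> L2 M \<and> 
     (\<forall>e>0. \<exists>P. L2_norm M (\<lambda>x. g (u x) - poly P (of_real (u x))) < e)"

lemma L2_bounded: "f \<in> borel_measurable M \<Longrightarrow> (\<And>x. x \<in> space M \<Longrightarrow> cmod (f x) \<le> B) \<Longrightarrow> f \<in> L2 M"
  unfolding L2_def
  by (auto intro!: integrable_const_bound[where B = "B\<^sup>2"] AE_I2 power_mono)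

lemma continuous_bounded_L2:
  assumes "continuous_on {0..1} h" "(\<lambda>x. h (u x)) \<in> borel_measurable M" 
  shows "(\<lambda>x. h (u x)) \<in> L2 M"
proof -
  have "bounded (h ` {0..1})" by (intro compact_imp_bounded compact_continuous_image assms) auto
  then obtain B where "\<forall>y\<in>{0..1}. cmod (h y) \<le> B" unfolding bounded_iff by auto
  thus ?thesis using u_range assms(2) by (intro L2_bounded[of _ B]) blast+
qed

lemma poly_L2: "(\<lambda>x. poly P (of_real (u x))) \<in> L2 M"
proof (rule continuous_bounded_L2)
  show "continuous_on {0..1} (\<lambda>y. poly P (complex_of_real y))" by (intro continuous_intros)
  have "(\<lambda>y. poly P (complex_of_real y)) \<in> borel_measurable borel"
    by (intro borel_measurable_continuous_onI continuous_intros)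
  thus "(\<lambda>x. poly P (complex_of_real (u x))) \<in> borel_measurable M" by measurable
qed

lemma approx_lim:
  assumes "\<And>n. approx (g n)" "h \<in> borel_measurable borel" "L2_tendsto M (\<lambda>n x. g n (u x)) (\<lambda>x. h (u x))"
  shows "approx h"
  unfolding approx_def
proof (intro conjI allI impI)
  note T = L2_tendstoD[OF assms(3)]
  fix e :: real assume "e > 0"
  hence "e / 2 > 0" by simp
  from order_tendstoD(2)[OF T(3) this] obtain n where n: "L2_norm M (\<lambda>x. g n (u x) - h (u x)) < e / 2"
    by (auto simp: eventually_sequentially)
  from assms(1)[of n] \<open>e / 2 > 0\<close> obtain P where P: "L2_norm M (\<lambda>x. g n (u x) - poly P (of_real (u x))) < e / 2"
    unfolding approx_def by blast
  have "L2_norm M (\<lambda>x. h (u x) - poly P (of_real (u x))) < e"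
    using L2_norm_triangle[OF T(2) T(1)[of n] poly_L2[of P]] n P by (simp add: L2_norm_minus_commute[of M "\<lambda>x. h (u x)"])
  thus "\<exists>P. L2_norm M (\<lambda>x. h (u x) - poly P (of_real (u x))) < e" by blast
qed (use assms L2_tendstoD in auto)

lemma approx_lincomb:
  assumes "approx g" "approx h" shows "approx (\<lambda>y. a * g y + b * h y)"
proof -
  have ip: "inverse (real (Suc n)) > 0" for n by simp
  have "\<exists>P. L2_norm M (\<lambda>x. g (u x) - poly P (of_real (u x))) < inverse (real (Suc n))"
    "\<exists>P. L2_norm M (\<lambda>x. h (u x) - poly P (of_real (u x))) < inverse (real (Suc n))" for n
    using assms ip[of n] unfolding approx_def by blast+
  then obtain P Q where P: "\<And>n. L2_norm M (\<lambda>x. g (u x) - poly (P n) (of_real (u x))) < inverse (real (Suc n))"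
    and Q: "\<And>n. L2_norm M (\<lambda>x. h (u x) - poly (Q n) (of_real (u x))) < inverse (real (Suc n))" by metis
  have gh: "(\<lambda>x. g (u x)) \<in> L2 M" "(\<lambda>x. h (u x)) \<in> L2 M" using assms by (auto simp: approx_def)
  have T1: "L2_tendsto M (\<lambda>n x. poly (P n) (of_real (u x))) (\<lambda>x. g (u x))"
    by (rule L2_tendstoI_le[OF poly_L2 gh(1) _ LIMSEQ_inverse_real_of_nat])
       (use P in \<open>auto simp: L2_norm_minus_commute[of M "\<lambda>x. poly (_ x) (_ x)"] L2_norm_minus_commute[of M _ "\<lambda>x. g (u x)"] intro: less_imp_le\<close>)
  have T2: "L2_tendsto M (\<lambda>n x. poly (Q n) (of_real (u x))) (\<lambda>x. h (u x))"
    by (rule L2_tendstoI_le[OF poly_L2 gh(2) _ LIMSEQ_inverse_real_of_nat])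
       (use Q in \<open>auto simp: L2_norm_minus_commute[of M _ "\<lambda>x. h (u x)"] intro: less_imp_le\<close>)
  have ap: "approx (\<lambda>y. poly R (complex_of_real y))" for R
    unfolding approx_def
  proof (intro conjI allI impI)
    show "(\<lambda>y. poly R (complex_of_real y)) \<in> borel_measurable borel"
      by (intro borel_measurable_continuous_onI continuous_intros)
    fix e :: real assume "e > 0"
    thus "\<exists>P. L2_norm M (\<lambda>x. poly R (of_real (u x)) - poly P (of_real (u x))) < e"
      by (intro exI[of _ R]) (simp add: L2_norm_def)
  qed (rule poly_L2)
  show ?thesis
  proof (rule approx_lim[of "\<lambda>n y. poly (smult a (P n) + smult b (Q n)) (complex_of_real y)"])
    show "L2_tendsto M (\<lambda>n x. poly (smult a (P n) + smult b (Q n)) (of_real (u x))) (\<lambda>x. a * g (u x) + b * h (u x))"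
      using L2_tendsto_lincomb[OF T1 T2, of a b] by simp
    have "g \<in> borel_measurable borel" "h \<in> borel_measurable borel" using assms by (auto simp: approx_def)
    thus "(\<lambda>y. a * g y + b * h y) \<in> borel_measurable borel" by measurable
  qed (rule ap)
qed

lemma approx_const_1: "approx (\<lambda>_. 1)"
  unfolding approx_def
proof (intro conjI allI impI)
  show "(\<lambda>_. 1) \<in> L2 M" using poly_L2[of 1] by simp
  fix e :: real assume "e > 0"
  thus "\<exists>P. L2_norm M (\<lambda>x. 1 - poly P (of_real (u x))) < e"
    by (intro exI[of _ 1]) (simp add: L2_norm_def)
qed auto

lemma approx_0: "approx (\<lambda>_. 0)"
  using approx_lincomb[OF approx_const_1 approx_const_1, of 0 0] by simp

lemma approx_add: "approx g \<Longrightarrow> approx h \<Longrightarrow> approx (\<lambda>y. g y + h y)"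
  using approx_lincomb[of g h 1 1] by simp

lemma approx_cmult: "approx g \<Longrightarrow> approx (\<lambda>y. a * g y)"
  using approx_lincomb[of g g a 0] by simp

lemma approx_sum: "(\<And>i. i \<in> I \<Longrightarrow> approx (g i)) \<Longrightarrow> approx (\<lambda>y. \<Sum>i\<in>I. g i y)"
  by (induction I rule: infinite_finite_induct) (auto intro: approx_0 approx_add)

lemma approx_continuous:
  assumes "continuous_on UNIV (h :: real \<Rightarrow> real)"
  shows "approx (\<lambda>y. of_real (h y))"
  unfolding approx_def
proof (intro conjI allI impI)
  have [measurable]: "h \<in> borel_measurable borel" by (rule borel_measurable_continuous_onI[OF assms])
  show "(\<lambda>y. complex_of_real (h y)) \<in> borel_measurable borel" by measurable
  show hL: "(\<lambda>x. complex_of_real (h (u x))) \<in> L2 M"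
    by (rule continuous_bounded_L2) (auto intro!: continuous_intros continuous_on_subset[OF assms])
  fix e :: real assume e: "e > 0"
  define m where "m = measure M (space M)"
  have m: "m \<ge> 0" by (simp add: m_def)
  \<comment> \<open>A uniform error \<open>d\<close> costs \<open>d * sqrt m\<close> in norm; the
    added 1 covers a space of mass zero.\<close>
  define d where "d = e / (sqrt m + 1)"
  have "sqrt m + 1 > 0" using m by (intro add_nonneg_pos) auto
  hence d: "d > 0" "d * sqrt m < e" using e by (auto simp: d_def field_simps)
  obtain p where p: "real_polynomial_function p" "\<And>y. y \<in> {0..1} \<Longrightarrow> \<bar>h y - p y\<bar> < d"
    using Stone_Weierstrass_real_polynomial_function[of "{0..1}" h d] d continuous_on_subset[OF assms] by auto
  obtain a n where an: "p = (\<lambda>y. \<Sum>i\<le>n. a i * y ^ i)"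
    using p(1) real_polynomial_function_iff_sum by blast
  define P where "P = (\<Sum>i\<le>n. monom (complex_of_real (a i)) i)"
  have P: "poly P (of_real y) = of_real (p y)" for y
    by (simp add: P_def an poly_sum poly_monom)
  have "(L2_norm M (\<lambda>x. of_real (h (u x)) - poly P (of_real (u x))))\<^sup>2 \<le> (\<integral>x. d\<^sup>2 \<partial>M)"
    unfolding L2_norm_squared
  proof (rule integral_mono)
    show "integrable M (\<lambda>x. (cmod (of_real (h (u x)) - poly P (of_real (u x))))\<^sup>2)"
      by (intro L2_integrable L2_diff hL poly_L2)
    fix x assume "x \<in> space M"
    hence "\<bar>h (u x) - p (u x)\<bar> < d" using u_range by (intro p) auto
    hence "\<bar>h (u x) - p (u x)\<bar>\<^sup>2 \<le> d\<^sup>2" by (intro power_mono) auto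
    thus "(cmod (of_real (h (u x)) - poly P (of_real (u x))))\<^sup>2 \<le> d\<^sup>2"
      unfolding P of_real_diff[symmetric] norm_of_real by simp
  qed simp
  also have "\<dots> = (d * sqrt m)\<^sup>2" using m by (simp add: m_def power_mult_distrib)
  finally have "L2_norm M (\<lambda>x. of_real (h (u x)) - poly P (of_real (u x))) \<le> d * sqrt m"
    by (rule power2_le_imp_le) (use d m in auto)
  with d show "\<exists>P. L2_norm M (\<lambda>x. of_real (h (u x)) - poly P (of_real (u x))) < e" by (intro exI[of _ P]) linarith
qed

lemma approx_lim_bounded:
  assumes "\<And>n. approx (g n)" "h \<in> borel_measurable borel" "\<And>y. (\<lambda>n. g n y) \<longlonglongrightarrow> h y" "\<And>n y. cmod (g n y) \<le> B"
  shows "approx h"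
proof (rule approx_lim[OF assms(1,2)])
  note [measurable] = assms(2)
  have [measurable]: "g n \<in> borel_measurable borel" for n using assms(1) by (simp add: approx_def)
  show "L2_tendsto M (\<lambda>n x. g n (u x)) (\<lambda>x. h (u x))"
    by (rule L2_tendsto_dominated[where G = "\<lambda>_. B"]) (use assms(3,4) in auto)
qed

lemma approx_indicator_atMost: "approx (\<lambda>y. of_real (indicator {..t::real} y))"
proof (rule approx_lim_bounded[where B = 1])
  \<comment> \<open>For n > 0 this is the ramp that equals 1 up to \<open>t\<close> and 0 from
    \<open>t + 1/n\<close> on.\<close>
  define k where "k n y = max 0 (min 1 (1 - real n * (y - t)))" for n y
  show "approx (\<lambda>y. of_real (k n y))" for n
    unfolding k_def by (intro approx_continuous continuous_intros)
  show "cmod (of_real (k n y)) \<le> 1" for n y by (simp add: k_def)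
  show "(\<lambda>n. complex_of_real (k n y)) \<longlonglongrightarrow> of_real (indicator {..t} y)" for y
  proof (intro tendsto_of_real)
    show "(\<lambda>n. k n y) \<longlonglongrightarrow> indicator {..t} y"
    proof (cases "y \<le> t")
      case True
      have "real n * (y - t) \<le> 0" for n using True by (intro mult_nonneg_nonpos) auto
      hence "k n y = 1" for n by (simp add: k_def)
      thus ?thesis using True by simp
    next
      case False
      then obtain N where N: "1 < real N * (y - t)" using ex_less_of_nat_mult[of "y - t" 1] by auto
      have "k n y = 0" if "n \<ge> N" for n
      proof -
        have "real N * (y - t) \<le> real n * (y - t)" using that False by (intro mult_right_mono) auto
        thus ?thesis using N by (simp add: k_def)
      qed
      hence "eventually (\<lambda>n. k n y = 0) sequentially" by (auto simp: eventually_sequentially)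
      thus ?thesis using False by (simp add: tendsto_eventually)
    qed
  qed
qed measurable

text \<open>Dynkin's lemma: closed left rays are stable under intersection and generate the Borel
  sets, and approximability passes to complements and, by bounded convergence of the partial sums,
  to disjoint unions.\<close>

lemma approx_indicator:
  assumes "A \<in> sets borel" shows "approx (\<lambda>y. of_real (indicator A (y::real)))"
proof -
  have sb: "sets (borel :: real measure) = sigma_sets UNIV (range (\<lambda>a::real. {..a}))"
    unfolding borel_eq_atMost by (rule sets_measure_of) simp
  have s: "A \<in> sigma_sets UNIV (range (\<lambda>a::real. {..a}))"
    using assms unfolding sb .
  show ?thesis
  proof (rule sigma_sets_induct_disjoint[OF _ _ s])
    show "Int_stable (range (\<lambda>a::real. {..a}))"
      by (auto simp: Int_stable_def)
    show "range (\<lambda>a::real. {..a}) \<subseteq> Pow UNIV" by simp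
    show "approx (\<lambda>y. of_real (indicator {} y))" using approx_0 by simp
    show "approx (\<lambda>y. of_real (indicator B y))" if "B \<in> range (\<lambda>a::real. {..a})" for B
      using that approx_indicator_atMost by auto
  next
    fix B assume "approx (\<lambda>y. of_real (indicator B (y::real)))"
    from approx_lincomb[OF approx_const_1 this, of 1 "-1"]
    have "approx (\<lambda>y. 1 - of_real (indicator B y))" by simp
    moreover have "complex_of_real (indicator (UNIV - B) y) = 1 - of_real (indicator B y)" for y
      by (simp add: indicator_def)
    ultimately show "approx (\<lambda>y. of_real (indicator (UNIV - B) y))" by simp
  next
    fix B :: "nat \<Rightarrow> real set"
    assume B: "disjoint_family B" "range B \<subseteq> sigma_sets UNIV (range (\<lambda>a::real. {..a}))"
      "\<And>i. approx (\<lambda>y. of_real (indicator (B i) y))"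
    have Bb: "B i \<in> sets borel" for i
      unfolding sb by (rule subsetD[OF B(2) rangeI])
    have eq: "(\<Sum>i<n. complex_of_real (indicator (B i) y)) = of_real (indicator (\<Union>i<n. B i) y)" for n y
    proof (induction n)
      case (Suc n)
      have "B n \<inter> B i = {}" if "i < n" for i 
        using disjoint_family_onD[OF B(1), of n i] that by simp
      hence "B n \<inter> (\<Union>i<n. B i) = {}" by blast
      thus ?case unfolding sum.lessThan_Suc Suc by (auto simp: indicator_def lessThan_Suc)
    qed simp
    show "approx (\<lambda>y. of_real (indicator (\<Union>i. B i) y))"
    proof (rule approx_lim_bounded[where B = 1])
      show "approx (\<lambda>y. \<Sum>i<n. complex_of_real (indicator (B i) y))" for n by (intro approx_sum B(3))
      show "cmod (\<Sum>i<n. complex_of_real (indicator (B i) y)) \<le> 1" for n y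
        unfolding eq by (simp add: indicator_def)
      show "(\<lambda>n. \<Sum>i<n. complex_of_real (indicator (B i) y)) \<longlonglongrightarrow> of_real (indicator (\<Union>i. B i) y)" for y
        unfolding eq by (intro tendsto_of_real LIMSEQ_indicator_UN)
      show "(\<lambda>y. complex_of_real (indicator (\<Union>i. B i) y)) \<in> borel_measurable borel"
        using Bb by measurable
    qed
  qed
qed

text \<open>Simple functions of modulus at most \<open>2 * cmod (g y)\<close> converge to
  \<open>g\<close>. This bound, composed with \<open>u\<close>, is a square-integrable majorant, so
  unbounded \<open>g\<close> are covered.\<close>

theorem approx_L2:
  assumes g: "g \<in> borel_measurable borel" and L: "(\<lambda>x. g (u x)) \<in> L2 M"
  shows "approx g"
proof -
  obtain S where S: "\<And>i. simple_function borel (S i)" "\<And>y. (\<lambda>i. S i y) \<longlonglongrightarrow> g y" 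
     "\<And>i y. dist (S i y) 0 \<le> 2 * dist (g y) 0"
    using borel_measurable_implies_sequence_metric[OF g, of 0] by auto
  have ap: "approx (S i)" for i
  proof -
    have "S i = (\<lambda>y. \<Sum>z\<in>range (S i). z * of_real (indicator (S i -` {z}) y))"
    proof
      fix y
      have "finite (range (S i))" using simple_functionD(1)[OF S(1)[of i]] by simp
      hence "(\<Sum>z\<in>range (S i). z * of_real (indicator (S i -` {z}) y)) = (\<Sum>z\<in>{S i y}. z * of_real (indicator (S i -` {z}) y))"
        by (intro sum.mono_neutral_right) (auto simp: indicator_def)
      thus "S i y = (\<Sum>z\<in>range (S i). z * of_real (indicator (S i -` {z}) y))" by simp
    qed
    moreover have "S i -` {z} \<in> sets borel" for z
      using simple_functionD(2)[OF S(1)[of i], of "{z}"] by simp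
    hence "approx (\<lambda>y. \<Sum>z\<in>range (S i). z * of_real (indicator (S i -` {z}) y))"
      by (intro approx_sum approx_cmult approx_indicator)
    ultimately show ?thesis by simp
  qed
  show ?thesis
  proof (rule approx_lim[OF ap g])
    note [measurable] = g
    have [measurable]: "S i \<in> borel_measurable borel" for i using ap by (simp add: approx_def)
    show "L2_tendsto M (\<lambda>n x. S n (u x)) (\<lambda>x. g (u x))"
    proof (rule L2_tendsto_dominated[where G = "\<lambda>x. 2 * cmod (g (u x))"])
      show "integrable M (\<lambda>x. (2 * cmod (g (u x)))\<^sup>2)"
        using L2_integrable[OF L] by (simp add: power_mult_distrib)
    qed (use S(2,3) in auto)
  qed
qed

end

section \<open>Bounds for the Gamma function\<close>

abbreviation gam :: "real \<Rightarrow> real \<Rightarrow> complex" where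
  "gam x t \<equiv> Gamma (of_real x + \<i> * of_real t)"

lemma not_nonpos_Int_Re_pos: "Re z > 0 \<Longrightarrow> z \<notin> \<int>\<^sub>\<le>\<^sub>0"
  by (auto simp: nonpos_Ints_def)

lemma gam_nonzero: "x > 0 \<Longrightarrow> gam x t \<noteq> 0"
  by (subst Gamma_eq_zero_iff, rule not_nonpos_Int_Re_pos) simp

text \<open>By Gauss's product the quotient is the infinite product of (x+k)/|x+k+it|, and every
  factor increases with \<open>x\<close>. This comparison takes the place of Stirling's formula: it
  transfers decay from integers to all parameters, and later it makes Wilson's integral
  monotone.\<close>

lemma cmod_gam_mono:
  assumes "0 < x" "x \<le> y"
  shows "cmod (gam x t) / Gamma x \<le> cmod (gam y t) / Gamma y"
proof -
  define \<rho> where "\<rho> x n = (\<Prod>k<Suc n. (x + real k) / cmod (of_real x + \<i> * of_real t + of_nat k))" for x n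
  have lim: "(\<lambda>n. \<rho> x n) \<longlonglongrightarrow> cmod (gam x t) / Gamma x" if x: "x > 0" for x
  proof (rule Lim_transform_eventually)
    show "(\<lambda>n. cmod (Gamma_series (of_real x + \<i> * of_real t) n) / Gamma_series x n) \<longlonglongrightarrow> cmod (gam x t) / Gamma x"
      using Gamma_real_pos[OF x] by (intro tendsto_intros) auto
    show "\<forall>\<^sub>F n in sequentially. cmod (Gamma_series (of_real x + \<i> * of_real t) n) / Gamma_series x n = \<rho> x n"
      using eventually_gt_at_top[of 0]
    proof eventually_elim
      case (elim n)
      have P: "pochhammer x (Suc n) > 0" using x by (rule pochhammer_pos)
      have "cmod (Gamma_series (of_real x + \<i> * of_real t) n) 
          = fact n * exp (x * ln (real n)) / cmod (pochhammer (of_real x + \<i> * of_real t) (Suc n))"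
        by (simp only: Gamma_series_def norm_mult norm_divide norm_exp_eq_Re norm_fact) simp
      hence "cmod (Gamma_series (of_real x + \<i> * of_real t) n) / Gamma_series x n
          = pochhammer x (Suc n) / cmod (pochhammer (of_real x + \<i> * of_real t) (Suc n))"
        using P by (simp add: Gamma_series_def)
      also have "\<dots> = \<rho> x n"
        unfolding \<rho>_def pochhammer_prod prod_norm[symmetric] prod_dividef atLeast0LessThan ..
      finally show ?case .
    qed
  qed
  have "\<rho> x n \<le> \<rho> y n" for n
    unfolding \<rho>_def
  proof (intro prod_mono conjI)
    fix k
    define u v where "u = x + real k" and "v = y + real k"
    have uv: "0 < u" "u \<le> v" using assms by (auto simp: u_def v_def)
    have c: "cmod (of_real z + \<i> * of_real t + of_nat k) = sqrt ((z + real k)\<^sup>2 + t\<^sup>2)" for z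
      by (simp add: cmod_def)
    have "(u / sqrt (u\<^sup>2 + t\<^sup>2))\<^sup>2 \<le> (v / sqrt (v\<^sup>2 + t\<^sup>2))\<^sup>2"
    proof -
      have "u\<^sup>2 * t\<^sup>2 \<le> v\<^sup>2 * t\<^sup>2" using uv by (intro mult_right_mono power_mono) auto
      moreover have "u\<^sup>2 + t\<^sup>2 > 0" "v\<^sup>2 + t\<^sup>2 > 0" using uv by (auto intro: add_pos_nonneg)
      ultimately show ?thesis by (simp add: power_divide divide_simps algebra_simps)
    qed
    hence "u / sqrt (u\<^sup>2 + t\<^sup>2) \<le> v / sqrt (v\<^sup>2 + t\<^sup>2)"
      by (rule power2_le_imp_le) (use uv in auto)
    thus "(x + real k) / cmod (of_real x + \<i> * of_real t + of_nat k)
        \<le> (y + real k) / cmod (of_real y + \<i> * of_real t + of_nat k)"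
      unfolding c u_def v_def .
  qed (use assms in auto)
  with lim[of x] lim[of y] assms show ?thesis by (intro LIMSEQ_le) auto
qed

lemma gam_plus1: "x > 0 \<Longrightarrow> gam (x + 1) t = (of_real x + \<i> * of_real t) * gam x t"
  using Gamma_plus1[OF not_nonpos_Int_Re_pos, of "of_real x + \<i> * of_real t"] by (simp add: algebra_simps)

lemma cmod_gam_plus1: "x > 0 \<Longrightarrow> (cmod (gam (x + 1) t))\<^sup>2 = (x\<^sup>2 + t\<^sup>2) * (cmod (gam x t))\<^sup>2"
  by (simp only: gam_plus1 norm_mult power_mult_distrib) (simp add: cmod_power2)

lemma cnj_gam: "cnj (gam x t) = Gamma (of_real x - \<i> * of_real t)"
  by (simp add: cnj_Gamma)

lemma cmod_gam_squared: "of_real ((cmod (gam x t))\<^sup>2) = gam x t * Gamma (of_real x - \<i> * of_real t)"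
  unfolding complex_norm_square cnj_gam ..

lemma sin_i_real: "sin (\<i> * of_real x) = \<i> * of_real (sinh x)"
  by (simp add: sin_i_times sinh_field_def exp_of_real exp_minus)

lemma cmod_gam_1: "(cmod (gam 1 t))\<^sup>2 * sinh (pi * t) = pi * t"
proof (cases "t = 0")
  case False
  have "\<i> * of_real t \<notin> \<int>\<^sub>\<le>\<^sub>0" using False by (auto simp: complex_eq_iff elim!: nonpos_Ints_cases)
  hence "gam 1 t = \<i> * of_real t * Gamma (\<i> * of_real t)" 
    using Gamma_plus1[of "\<i> * of_real t"] by (simp add: add.commute)
  hence "of_real ((cmod (gam 1 t))\<^sup>2) = \<i> * of_real t * (Gamma (\<i> * of_real t) * Gamma (1 - \<i> * of_real t))"
    unfolding cmod_gam_squared by simp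
  also have "\<dots> = \<i> * of_real t * (of_real pi / sin (\<i> * of_real (pi * t)))"
    unfolding Gamma_reflection_complex by (simp add: mult_ac)
  also have "\<dots> = of_real (pi * t / sinh (pi * t))" 
    unfolding sin_i_real by simp
  finally have "(cmod (gam 1 t))\<^sup>2 = pi * t / sinh (pi * t)" unfolding of_real_eq_iff .
  thus ?thesis using False by simp
qed auto

lemma cmod_gam_half: "(cmod (gam (1/2) t))\<^sup>2 = pi / cosh (pi * t)"
proof -
  have "of_real ((cmod (gam (1/2) t))\<^sup>2) = Gamma (1/2 + \<i> * of_real t) * Gamma (1 - (1/2 + \<i> * of_real t))"
    unfolding cmod_gam_squared by simp
  also have "\<dots> = of_real pi / sin (of_real pi * (1/2 + \<i> * of_real t))"
    by (rule Gamma_reflection_complex)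
  also have "of_real pi * (1/2 + \<i> * of_real t) = of_real pi / 2 + \<i> * of_real (pi * t)"
    by (simp add: algebra_simps)
  also have "sin \<dots> = cos (\<i> * of_real (pi * t))" by (simp add: sin_add)
  also have "\<dots> = of_real (cosh (pi * t))" by (simp add: cosh_conv_cos[symmetric] cosh_field_def exp_minus flip: exp_of_real)
  finally have "complex_of_real ((cmod (gam (1/2) t))\<^sup>2) = of_real (pi / cosh (pi * t))" by simp
  thus ?thesis unfolding of_real_eq_iff .
qed

text \<open>At x = pi |t| the left side is x / sinh x, and the bound is a rearrangement of 1 + x
  \<le> exp(2x).\<close>

lemma cmod_gam_1_bound: "(cmod (gam 1 t))\<^sup>2 \<le> 2 * (1 + pi * \<bar>t\<bar>) * exp (- pi * \<bar>t\<bar>)"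
proof (cases "t = 0")
  case False
  define x where "x = pi * \<bar>t\<bar>"
  have x: "x > 0" using False by (simp add: x_def)
  have "(cmod (gam 1 t))\<^sup>2 * sinh x = x"
    using cmod_gam_1[of t] by (cases "t \<ge> 0") (auto simp: x_def)
  moreover have "sinh x > 0" using x by simp
  ultimately have "(cmod (gam 1 t))\<^sup>2 = x / sinh x" by (simp add: field_simps)
  also have "\<dots> \<le> 2 * (1 + x) * exp (- x)"
  proof -
    have "1 + x \<le> exp (2 * x)" using exp_ge_add_one_self[of "2 * x"] x by linarith
    hence "(1 + x) * exp (-x) \<le> exp (2 * x) * exp (-x)" using x by (intro mult_right_mono) auto
    hence "(1 + x) * exp (-x) \<le> exp x" by (simp flip: exp_add)
    hence "(1 + x) * exp (-x) * exp (-x) \<le> exp x * exp (-x)" by (intro mult_right_mono) auto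
    hence "x \<le> (1 + x) * (1 - exp (-x) * exp (-x))" by (simp add: algebra_simps flip: exp_add)
    also have "\<dots> = (1 + x) * exp (-x) * (exp x - exp (-x))" by (simp add: algebra_simps flip: exp_add)
    also have "\<dots> = 2 * (1 + x) * exp (-x) * sinh x" by (simp add: sinh_field_def) (simp add: algebra_simps)
    finally show ?thesis using \<open>sinh x > 0\<close> by (simp add: pos_divide_le_eq)
  qed
  finally show ?thesis by (simp add: x_def)
qed auto

lemma cmod_gam_nat_bound: 
  "\<exists>C>0. \<forall>t. (cmod (gam (real n + 1) t))\<^sup>2 \<le> C * (1 + \<bar>t\<bar>) ^ (2 * n + 1) * exp (- pi * \<bar>t\<bar>)"
proof (induction n)
  case 0
  have "2 * (1 + pi * \<bar>t\<bar>) * exp (- pi * \<bar>t\<bar>) \<le> 2 * pi * (1 + \<bar>t\<bar>) * exp (- pi * \<bar>t\<bar>)" for t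
    using pi_ge_two by (intro mult_right_mono) (auto simp: algebra_simps)
  with cmod_gam_1_bound have "(cmod (gam 1 t))\<^sup>2 \<le> 2 * pi * (1 + \<bar>t\<bar>) * exp (- pi * \<bar>t\<bar>)" for t
    by (rule order_trans)
  thus ?case by (intro exI[of _ "2 * pi"]) auto
next
  case (Suc n)
  then obtain C where C: "C > 0" "\<And>t. (cmod (gam (real n + 1) t))\<^sup>2 \<le> C * (1 + \<bar>t\<bar>) ^ (2 * n + 1) * exp (- pi * \<bar>t\<bar>)"
    by auto
  show ?case
  proof (intro exI[of _ "(real n + 1)\<^sup>2 * C"] conjI allI)
    fix t
    have "(real n + 1)\<^sup>2 + t\<^sup>2 \<le> (real n + 1)\<^sup>2 * (1 + \<bar>t\<bar>)\<^sup>2"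
    proof -
      have "1 * t\<^sup>2 \<le> (real n + 1)\<^sup>2 * t\<^sup>2" by (intro mult_right_mono) auto
      moreover have "0 \<le> (real n + 1)\<^sup>2 * (2 * \<bar>t\<bar>)" by simp
      moreover have "(real n + 1)\<^sup>2 * (1 + \<bar>t\<bar>)\<^sup>2 
        = (real n + 1)\<^sup>2 + (real n + 1)\<^sup>2 * t\<^sup>2 + (real n + 1)\<^sup>2 * (2 * \<bar>t\<bar>)"
        unfolding power2_sum[of 1 "\<bar>t\<bar>"] distrib_left by simp
      ultimately show ?thesis by linarith
    qed
    hence "((real n + 1)\<^sup>2 + t\<^sup>2) * (cmod (gam (real n + 1) t))\<^sup>2 
      \<le> ((real n + 1)\<^sup>2 * (1 + \<bar>t\<bar>)\<^sup>2) * (C * (1 + \<bar>t\<bar>) ^ (2 * n + 1) * exp (- pi * \<bar>t\<bar>))"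
      by (intro mult_mono C) auto
    thus "(cmod (gam (real (Suc n) + 1) t))\<^sup>2 
        \<le> (real n + 1)\<^sup>2 * C * (1 + \<bar>t\<bar>) ^ (2 * Suc n + 1) * exp (- pi * \<bar>t\<bar>)"
    proof -
      have "real (Suc n) + 1 = (real n + 1) + 1" by simp
      moreover have "(1 + \<bar>t\<bar>) ^ (2 * Suc n + 1) = (1 + \<bar>t\<bar>)\<^sup>2 * (1 + \<bar>t\<bar>) ^ (2 * n + 1)"
        by (simp flip: power_add)
      moreover note cmod_gam_plus1[of "real n + 1" t]
      moreover note \<open>((real n + 1)\<^sup>2 + t\<^sup>2) * (cmod (gam (real n + 1) t))\<^sup>2 \<le> _\<close>
      ultimately show ?thesis by (simp only: mult_ac)
    qed
  qed (use C in auto)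
qed

lemma polynomial_exp_bound:
  assumes "k > (0::real)"
  shows "\<exists>C>0. \<forall>t\<ge>0. (1 + t) ^ m \<le> C * exp (k * t)"
proof -
  \<comment> \<open>The estimate is 1 + t \<le> (1 + d t)/d \<le> exp(d t)/d. The first inequality
    uses d \<le> 1; for the m-th power m d \<le> k is wanted.\<close>
  define d where "d = min 1 (k / (real m + 1))"
  have d: "0 < d" "d \<le> 1" "real m * d \<le> k"
  proof -
    have "real m * d \<le> (real m + 1) * (k / (real m + 1))" 
      using assms by (intro mult_mono) (auto simp: d_def)
    thus "real m * d \<le> k" by simp
  qed (use assms in \<open>auto simp: d_def\<close>)
  have "(1 + t) ^ m \<le> (1 / d) ^ m * exp (k * t)" if "t \<ge> 0" for t
  proof -
    have "1 + t \<le> (1 / d) * (1 + d * t)" using d by (simp add: field_simps)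
    also have "\<dots> \<le> (1 / d) * exp (d * t)" using d by (intro mult_left_mono exp_ge_add_one_self) auto
    finally have "(1 + t) ^ m \<le> ((1 / d) * exp (d * t)) ^ m" using that by (intro power_mono) auto
    also have "\<dots> = (1 / d) ^ m * exp (real m * d * t)"
      unfolding power_mult_distrib by (simp only: exp_of_nat_mult[symmetric] mult.assoc)
    also have "\<dots> \<le> (1 / d) ^ m * exp (k * t)"
      using d that by (intro mult_left_mono) (auto intro: mult_right_mono)
    finally show ?thesis .
  qed
  thus ?thesis using d by (intro exI[of _ "(1 / d) ^ m"]) auto
qed

text \<open>The true rate is pi; a quarter of it is given away to absorb polynomial factors. Four
  such squares still decay like exp(-3 pi |t|), enough against the growth exp(2 pi |t|) of
  \<open>sinh (2 * pi * t)\<close>. All parameters are compared with one integer to their right, and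
  the real Gamma values are bounded by compactness, which gives uniformity in
  \<open>x\<close>.\<close>

lemma cmod_gam_decay:
  assumes "0 < x0"
  shows "\<exists>C>0. \<forall>x\<in>{x0..x1}. \<forall>t. (cmod (gam x t))\<^sup>2 \<le> C * exp (- (3 * pi / 4) * \<bar>t\<bar>)"
proof -
  obtain n :: nat where n: "x1 \<le> real n" using real_arch_simple by blast
  from cmod_gam_nat_bound[of n] obtain C1 where C1: "C1 > 0" 
    "\<And>t. (cmod (gam (real n + 1) t))\<^sup>2 \<le> C1 * (1 + \<bar>t\<bar>) ^ (2 * n + 1) * exp (- pi * \<bar>t\<bar>)" by auto
  from polynomial_exp_bound[of "pi / 4" "2 * n + 1"] obtain C2 where C2: "C2 > 0"
    "\<And>t. t \<ge> 0 \<Longrightarrow> (1 + t) ^ (2 * n + 1) \<le> C2 * exp (pi / 4 * t)" by auto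
  have "compact (Gamma ` {x0..x1})"
    using assms by (intro compact_continuous_image continuous_on_Gamma) (auto elim!: nonpos_Ints_cases)
  hence "bounded (Gamma ` {x0..x1})" by (rule compact_imp_bounded)
  then obtain B where B: "B > 0" "\<And>x. x \<in> {x0..x1} \<Longrightarrow> \<bar>Gamma x\<bar> \<le> B" 
    unfolding bounded_pos by auto
  define G where "G = Gamma (real n + 1)"
  have G: "G > 0" by (simp add: G_def)
  show ?thesis
  proof (intro exI[of _ "(B / G)\<^sup>2 * (C1 * C2)"] conjI ballI allI)
    fix x t assume x: "x \<in> {x0..x1}"
    have g: "Gamma x > 0" "x > 0" using x assms by auto
    have "cmod (gam x t) / Gamma x \<le> cmod (gam (real n + 1) t) / G"
      unfolding G_def using x assms n by (intro cmod_gam_mono) auto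
    hence "cmod (gam x t) \<le> Gamma x / G * cmod (gam (real n + 1) t)"
      using g G by (simp add: field_simps)
    also have "\<dots> \<le> B / G * cmod (gam (real n + 1) t)"
      using B(2)[OF x] G by (intro mult_right_mono divide_right_mono) auto
    finally have "(cmod (gam x t))\<^sup>2 \<le> (B / G * cmod (gam (real n + 1) t))\<^sup>2"
      by (intro power_mono) auto
    also have "\<dots> = (B / G)\<^sup>2 * (cmod (gam (real n + 1) t))\<^sup>2" by (rule power_mult_distrib)
    also have "\<dots> \<le> (B / G)\<^sup>2 * (C1 * (C2 * exp (pi / 4 * \<bar>t\<bar>)) * exp (- pi * \<bar>t\<bar>))"
      using C1 C2(2)[of "\<bar>t\<bar>"] 
      by (intro mult_left_mono order_trans[OF C1(2)] mult_right_mono) auto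
    also have "\<dots> = (B / G)\<^sup>2 * (C1 * C2) * (exp (pi / 4 * \<bar>t\<bar>) * exp (- pi * \<bar>t\<bar>))" by (simp add: mult_ac)
    also have "exp (pi / 4 * \<bar>t\<bar>) * exp (- pi * \<bar>t\<bar>) = exp (- (3 * pi / 4) * \<bar>t\<bar>)"
      by (simp add: field_simps flip: exp_add)
    finally show "(cmod (gam x t))\<^sup>2 \<le> (B / G)\<^sup>2 * (C1 * C2) * exp (- (3 * pi / 4) * \<bar>t\<bar>)" .
  qed (use B G C1 C2 in auto)
qed

text \<open>Besides serving as a majorant for exponential decay, this is the limiting integral from
  which the constant in Wilson's formula is read off.\<close>

lemma sech_squared_integral:
  assumes "k > (0::real)"
  shows "integrable lborel (\<lambda>t. 1 / (cosh (k * t))\<^sup>2)" "(\<integral>t. 1 / (cosh (k * t))\<^sup>2 \<partial>lborel) = 2 / k"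
proof -
  have D: "((\<lambda>t. tanh (k * t) / k) has_real_derivative 1 / (cosh (k * t))\<^sup>2) (at t)" for t
  proof -
    have "1 - (tanh (k * t))\<^sup>2 = ((cosh (k * t))\<^sup>2 - (sinh (k * t))\<^sup>2) / (cosh (k * t))\<^sup>2"
      by (simp add: tanh_def power_divide diff_divide_distrib)
    hence "1 - (tanh (k * t))\<^sup>2 = 1 / (cosh (k * t))\<^sup>2" by (simp only: hyperbolic_pythagoras)
    thus ?thesis using assms by (auto intro!: derivative_eq_intros)
  qed
  have inf: "((\<lambda>t. tanh (k * t) / k) \<longlongrightarrow> 1 / k) at_top"
    using assms by (intro tendsto_divide filterlim_compose[OF tanh_real_at_top] 
      filterlim_tendsto_pos_mult_at_top[OF tendsto_const] filterlim_ident) auto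
  have minf: "((\<lambda>t. tanh (k * t) / k) \<longlongrightarrow> -1 / k) at_bot"
    using assms by (intro tendsto_divide filterlim_compose[OF tanh_real_at_bot] 
      filterlim_tendsto_pos_mult_at_bot[OF tendsto_const] filterlim_ident) auto
  have c: "isCont (\<lambda>t. 1 / (cosh (k * t))\<^sup>2) t" for t by (intro continuous_intros) auto
  have "set_integrable lborel (einterval (-\<infinity>) \<infinity>) (\<lambda>t. 1 / (cosh (k * t))\<^sup>2)"
   and "(LBINT t=-\<infinity>..\<infinity>. 1 / (cosh (k * t))\<^sup>2) = 1 / k - (-1 / k)"
    by (rule interval_integral_FTC_nonneg[where F = "\<lambda>t. tanh (k * t) / k"]; 
        use D c inf minf in \<open>auto simp: ereal_tendsto_simps\<close>)+
  thus "integrable lborel (\<lambda>t. 1 / (cosh (k * t))\<^sup>2)" "(\<integral>t. 1 / (cosh (k * t))\<^sup>2 \<partial>lborel) = 2 / k"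
    by (auto simp: set_integrable_def interval_lebesgue_integral_def set_lebesgue_integral_def)
qed

lemma integrable_exp_minus_abs:
  assumes "k > (0::real)" shows "integrable lborel (\<lambda>t. exp (- k * \<bar>t\<bar>))"
proof (rule Bochner_Integration.integrable_bound)
  show "integrable lborel (\<lambda>t. 1 / (cosh (k / 2 * t))\<^sup>2)" by (rule sech_squared_integral(1)) (use assms in simp)
  have "exp (- k * \<bar>t\<bar>) \<le> 1 / (cosh (k / 2 * t))\<^sup>2" for t
  proof -
    have "cosh (k / 2 * t) \<le> exp (k / 2 * \<bar>t\<bar>)"
    proof -
      have "exp (k / 2 * t) \<le> exp (k / 2 * \<bar>t\<bar>)" "exp (- (k / 2 * t)) \<le> exp (k / 2 * \<bar>t\<bar>)" 
        unfolding exp_le_cancel_iff using assms by (auto simp: abs_if field_simps)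
      thus ?thesis unfolding cosh_field_def 
by argo
    qed
    hence "(cosh (k / 2 * t))\<^sup>2 \<le> (exp (k / 2 * \<bar>t\<bar>))\<^sup>2" by (intro power_mono) auto
    also have "\<dots> = exp (k * \<bar>t\<bar>)" by (simp add: power2_eq_square flip: exp_add)
    finally have "1 / exp (k * \<bar>t\<bar>) \<le> 1 / (cosh (k / 2 * t))\<^sup>2" 
      by (rule frac_le[OF zero_le_one order_refl zero_less_power[OF cosh_real_pos]])
    thus ?thesis unfolding minus_mult_left[symmetric] exp_minus by (simp only: inverse_eq_divide)
  qed
  thus "AE t in lborel. norm (exp (- k * \<bar>t\<bar>)) \<le> norm (1 / (cosh (k / 2 * t))\<^sup>2)" 
    by (intro always_eventually allI) (simp only: real_norm_def abs_exp_cancel, metis abs_ge_self order_trans)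
qed measurable

section \<open>Wilson's integral\<close>

text \<open>By reflection 1/|Gamma(2it)|^2 = (2/pi) t sinh(2 pi t). In this form there is no
  exceptional point at t = 0, and the weight is an even function on the whole line, where a contour
  can be shifted.\<close>

definition wilson_weight :: "real \<Rightarrow> real \<Rightarrow> real \<Rightarrow> real \<Rightarrow> real \<Rightarrow> real" where
  "wilson_weight a b c d t = t * sinh (2 * pi * t) * 
     ((cmod (gam a t))\<^sup>2 * (cmod (gam b t))\<^sup>2 * (cmod (gam c t))\<^sup>2 * (cmod (gam d t))\<^sup>2)"

lemma t_sinh_nonneg: "0 \<le> t * sinh (2 * pi * t)"
  by (cases "t \<ge> 0") (auto intro!: mult_nonneg_nonneg mult_nonpos_nonpos simp: mult_nonneg_nonpos)

lemma wilson_weight_nonneg: "0 \<le> wilson_weight a b c d t"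
  unfolding wilson_weight_def by (intro mult_nonneg_nonneg t_sinh_nonneg) auto

lemma continuous_gam: "x > 0 \<Longrightarrow> isCont (\<lambda>t. gam x t) t"
  by (intro continuous_intros not_nonpos_Int_Re_pos) auto

lemma gam_measurable [measurable]: "x > 0 \<Longrightarrow> (\<lambda>t. gam x t) \<in> borel_measurable borel"
  by (intro borel_measurable_continuous_onI continuous_at_imp_continuous_on ballI continuous_gam)

lemma isCont_wilson_weight:
  assumes "a > 0" "b > 0" "c > 0" "d > 0" shows "isCont (wilson_weight a b c d) t"
proof -
  have "isCont (\<lambda>t. t * sinh (2 * pi * t)) t" by (intro continuous_intros)
  from this show ?thesis unfolding wilson_weight_def[abs_def] 
    by (rule isCont_mult) (intro isCont_mult isCont_power isCont_norm continuous_gam assms)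
qed

lemma abs_sinh_le: "\<bar>sinh x\<bar> \<le> exp \<bar>x :: real\<bar>"
proof -
  have "exp x > 0" "exp (-x) > 0" "exp x \<le> exp \<bar>x\<bar>" "exp (-x) \<le> exp \<bar>x\<bar>" by auto
  thus ?thesis unfolding sinh_field_def by argo
qed

lemma cmod_gam_decay4:
  assumes "a > 0" "b > 0" "c > 0" "d > 0"
  shows "\<exists>C>0. \<forall>t. (cmod (gam a t))\<^sup>2 * (cmod (gam b t))\<^sup>2 * (cmod (gam c t))\<^sup>2 * (cmod (gam d t))\<^sup>2
     \<le> C * exp (- (3 * pi) * \<bar>t\<bar>)"
proof -
  define x0 x1 where "x0 = Min {a, b, c, d}" and "x1 = Max {a, b, c, d}"
  have "x0 > 0" using assms by (simp add: x0_def)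
  then obtain C where C: "C > 0" 
    "\<And>x t. x \<in> {x0..x1} \<Longrightarrow> (cmod (gam x t))\<^sup>2 \<le> C * exp (- (3 * pi / 4) * \<bar>t\<bar>)"
    using cmod_gam_decay[of x0 x1] by blast
  have I: "a \<in> {x0..x1}" "b \<in> {x0..x1}" "c \<in> {x0..x1}" "d \<in> {x0..x1}"
    by (auto simp: x0_def x1_def)
  show ?thesis
  proof (intro exI[of _ "C ^ 4"] conjI allI)
    fix t
    define e where "e = exp (- (3 * pi / 4) * \<bar>t\<bar>)"
    have "(cmod (gam a t))\<^sup>2 * (cmod (gam b t))\<^sup>2 * (cmod (gam c t))\<^sup>2 * (cmod (gam d t))\<^sup>2
        \<le> (C * e) * (C * e) * (C * e) * (C * e)"
      unfolding e_def by (intro mult_mono C I mult_nonneg_nonneg) (use C(1) in auto)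
    also have "\<dots> = C ^ 4 * e ^ 4" by (simp add: power4_eq_xxxx mult_ac)
    also have "e ^ 4 = exp (- (3 * pi) * \<bar>t\<bar>)"
      unfolding e_def exp_of_nat_mult[symmetric] by simp
    finally show "(cmod (gam a t))\<^sup>2 * (cmod (gam b t))\<^sup>2 * (cmod (gam c t))\<^sup>2 * (cmod (gam d t))\<^sup>2 
        \<le> C ^ 4 * exp (- (3 * pi) * \<bar>t\<bar>)" .
  qed (use C in auto)
qed

lemma wilson_weight_integrable:
  assumes "a > 0" "b > 0" "c > 0" "d > 0"
  shows "integrable lborel (wilson_weight a b c d)"
proof -
  obtain C where C: "C > 0" 
    "\<And>t. (cmod (gam a t))\<^sup>2 * (cmod (gam b t))\<^sup>2 * (cmod (gam c t))\<^sup>2 * (cmod (gam d t))\<^sup>2 \<le> C * exp (- (3 * pi) * \<bar>t\<bar>)"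
    using cmod_gam_decay4[OF assms] by blast
  have bound: "wilson_weight a b c d t \<le> C * exp (- (pi - 1) * \<bar>t\<bar>)" for t
  proof -
    have "t * sinh (2 * pi * t) = \<bar>t\<bar> * \<bar>sinh (2 * pi * t)\<bar>" 
      using t_sinh_nonneg[of t] by (simp flip: abs_mult)
    also have "\<dots> \<le> exp \<bar>t\<bar> * exp \<bar>2 * pi * t\<bar>"
      by (intro mult_mono abs_sinh_le order_trans[OF _ exp_ge_add_one_self[of "\<bar>t\<bar>"]]) auto
    finally have "wilson_weight a b c d t \<le> (exp \<bar>t\<bar> * exp \<bar>2 * pi * t\<bar>) * (C * exp (- (3 * pi) * \<bar>t\<bar>))"
      unfolding wilson_weight_def by (intro mult_mono[OF _ C(2)]) auto
    also have "\<dots> = C * exp (\<bar>t\<bar> + \<bar>2 * pi * t\<bar> - (3 * pi) * \<bar>t\<bar>)" 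
      by (simp add: exp_add exp_diff exp_minus divide_inverse)
    also have "\<bar>t\<bar> + \<bar>2 * pi * t\<bar> - (3 * pi) * \<bar>t\<bar> = - (pi - 1) * \<bar>t\<bar>" 
      by (simp add: abs_mult algebra_simps)
    finally show ?thesis .
  qed
  show ?thesis
  proof (rule Bochner_Integration.integrable_bound)
    show "integrable lborel (\<lambda>t. C * exp (- (pi - 1) * \<bar>t\<bar>))"
      using pi_ge_two by (intro integrable_mult_right integrable_exp_minus_abs) auto
    show "wilson_weight a b c d \<in> borel_measurable lborel"
      using isCont_wilson_weight[OF assms] 
      by (simp add: borel_measurable_continuous_onI continuous_at_imp_continuous_on)
    show "AE t in lborel. norm (wilson_weight a b c d t) \<le> norm (C * exp (- (pi - 1) * \<bar>t\<bar>))"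
      using bound C wilson_weight_nonneg by auto
  qed
qed

lemma wilson_weight_plus1:
  "a > 0 \<Longrightarrow> wilson_weight (a + 1) b c d t = (a\<^sup>2 + t\<^sup>2) * wilson_weight a b c d t"
  unfolding wilson_weight_def by (simp only: cmod_gam_plus1 mult_ac)

text \<open>By the functional equation the function is the weight at \<open>a + 1\<close> minus
  \<open>a^2\<close> times the weight at \<open>a\<close>.\<close>

lemma t2_wilson_weight_integrable:
  assumes "a > 0" "b > 0" "c > 0" "d > 0"
  shows "integrable lborel (\<lambda>t. t\<^sup>2 * wilson_weight a b c d t)"
proof -
  have "integrable lborel (\<lambda>t. wilson_weight (a + 1) b c d t - a\<^sup>2 * wilson_weight a b c d t)"
    using assms by (intro Bochner_Integration.integrable_diff integrable_mult_right wilson_weight_integrable) auto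
  also have "(\<lambda>t. wilson_weight (a + 1) b c d t - a\<^sup>2 * wilson_weight a b c d t) = (\<lambda>t. t\<^sup>2 * wilson_weight a b c d t)"
    unfolding wilson_weight_plus1[OF assms(1)] by (simp add: algebra_simps)
  finally show ?thesis .
qed

text \<open>The integrand below is \<open>\<i> \<cdot> (h (1/2 + \<i>t) - h (-1/2 + \<i>t))\<close> up to a constant, for
  \<open>h z = sin (2\<pi>z) \<Prod>\<^sub>j \<Gamma>(a\<^sub>j + 1/2 + z) \<Gamma>(a\<^sub>j + 1/2 - z)\<close>, which is holomorphic
  and rapidly decreasing in a strip around \<open>\<bar>Re z\<bar> \<le> 1/2\<close>.\<close>

lemma wilson_first_moment:
  assumes pos: "a > 0" "b > 0" "c > 0" "d > 0"
  shows "(\<integral>t. wilson_weight a b c d t * ((a * b * c + a * b * d + a * c * d + b * c * d) - (a + b + c + d) * t\<^sup>2) \<partial>lborel) = 0"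
proof -
  \<comment> \<open>The shift by 1/2 centres the strip: on Re z = 1/2 and on Re z = -1/2 one Gamma
    argument of each pair has real part x + 1 and the other x, and the functional equation turns the
    former into a linear factor.\<close>
  define p where "p x z = Gamma (of_real (x + 1/2) + z) * Gamma (of_real (x + 1/2) - z)" for x and z :: complex
  define h where "h z = sin (of_real (2 * pi) * z) * (p a z * p b z * p c z * p d z)" for z
  define \<epsilon> where "\<epsilon> = Min {a, b, c, d}"
  have \<epsilon>: "\<epsilon> > 0" "\<epsilon> \<le> a" "\<epsilon> \<le> b" "\<epsilon> \<le> c" "\<epsilon> \<le> d" using pos by (auto simp: \<epsilon>_def)
  \<comment> \<open>The poles of \<open>p x\<close> begin at |Re z| = x + 1/2, so this open strip
    contains both lines and no pole.\<close>
  define S where "S = {z. Re z > - (1/2 + \<epsilon>)} \<inter> {z. Re z < 1/2 + \<epsilon>}"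
  have S: "convex S" "open S" unfolding S_def 
    by (intro convex_Int convex_halfspace_Re_gt convex_halfspace_Re_lt open_Int open_halfspace_Re_gt open_halfspace_Re_lt)+
  have hol: "h holomorphic_on S"
    unfolding h_def p_def 
    by (intro holomorphic_intros not_nonpos_Int_Re_pos) (use \<epsilon> in \<open>auto simp: S_def\<close>)
  \<comment> \<open>A primitive on the convex strip replaces Cauchy's theorem on growing
    rectangles.\<close>
  obtain H where H: "\<And>z. z \<in> S \<Longrightarrow> (H has_field_derivative h z) (at z)"
    using holomorphic_convex_primitive'[OF S hol] at_within_open[OF _ S(2)] by metis
  have strip: "of_real x + \<i> * of_real t \<in> S" if "\<bar>x\<bar> \<le> 1/2" for x t
    using that \<epsilon> by (auto simp: S_def)

  define x0 x1 where "x0 = \<epsilon>" and "x1 = Max {a, b, c, d} + 1"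
  obtain C where C: "C > 0" 
    "\<And>x t. x \<in> {x0..x1} \<Longrightarrow> (cmod (gam x t))\<^sup>2 \<le> C * exp (- (3 * pi / 4) * \<bar>t\<bar>)"
    using cmod_gam_decay[of x0 x1] \<epsilon> unfolding x0_def by blast
  have p_bound: "cmod (p y (of_real x + \<i> * of_real t)) \<le> C * exp (- (3 * pi / 4) * \<bar>t\<bar>)"
    if "\<bar>x\<bar> \<le> 1/2" "y \<in> {a, b, c, d}" for x y t
  proof -
    have m: "y \<le> Max {a, b, c, d}" "\<epsilon> \<le> y" using that \<epsilon> by auto
    have I: "y + 1/2 + x \<in> {x0..x1}" "y + 1/2 - x \<in> {x0..x1}" 
      using m that(1) unfolding x0_def x1_def atLeastAtMost_iff by (intro conjI; linarith)+
    have "p y (of_real x + \<i> * of_real t) = gam (y + 1/2 + x) t * gam (y + 1/2 - x) (- t)"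
      unfolding p_def by (simp add: algebra_simps)
    moreover have "cmod (gam (y + 1/2 + x) t) \<le> sqrt (C * exp (- (3 * pi / 4) * \<bar>t\<bar>))"
      using C(2)[OF I(1), of t] by (rule real_le_rsqrt)
    moreover have "cmod (gam (y + 1/2 - x) (-t)) \<le> sqrt (C * exp (- (3 * pi / 4) * \<bar>-t\<bar>))"
      using C(2)[OF I(2), of "-t"] by (rule real_le_rsqrt)
    ultimately have "cmod (p y (of_real x + \<i> * of_real t)) \<le> 
        sqrt (C * exp (- (3 * pi / 4) * \<bar>t\<bar>)) * sqrt (C * exp (- (3 * pi / 4) * \<bar>t\<bar>))"
      by (simp only: norm_mult abs_minus_cancel) (intro mult_mono, use C(1) in auto)
    thus ?thesis using C(1) by simp
  qed
  have h_bound: "cmod (h (of_real x + \<i> * of_real t)) \<le> C ^ 4 * exp (- pi * \<bar>t\<bar>)"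
    if x: "\<bar>x\<bar> \<le> 1/2" for x t
  proof -
    define e where "e = exp (- (3 * pi / 4) * \<bar>t\<bar>)"
    have "cmod (sin (1 *\<^sub>R (of_real (2 * pi) * (of_real x + \<i> * of_real t)))) 
        \<le> exp \<bar>Im (of_real (2 * pi) * (of_real x + \<i> * of_real t))\<bar>"
      by (rule cmod_sin_le_exp) auto
    hence s: "cmod (sin (of_real (2 * pi) * (of_real x + \<i> * of_real t))) \<le> exp (2 * pi * \<bar>t\<bar>)"
      by (simp add: abs_mult)
    have "cmod (h (of_real x + \<i> * of_real t)) \<le> exp (2 * pi * \<bar>t\<bar>) * ((C * e) * (C * e) * (C * e) * (C * e))"
      unfolding h_def norm_mult e_def using C(1)
      by (intro mult_mono s[unfolded norm_mult] p_bound x mult_nonneg_nonneg) auto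
    also have "\<dots> = C ^ 4 * (exp (2 * pi * \<bar>t\<bar>) * e ^ 4)" by (simp add: power4_eq_xxxx mult_ac)
    also have "e ^ 4 = exp (- (3 * pi) * \<bar>t\<bar>)"
      unfolding e_def exp_of_nat_mult[symmetric] by simp
    also have "exp (2 * pi * \<bar>t\<bar>) * exp (- (3 * pi) * \<bar>t\<bar>) = exp (- pi * \<bar>t\<bar>)"
      unfolding exp_add[symmetric] by (simp add: algebra_simps)
    finally show ?thesis .
  qed

  \<comment> \<open>The derivative of \<open>K\<close> is \<i> times the integrand in question. As
    an increment of \<open>H\<close> along a horizontal segment of length 1, \<open>K t\<close> is
    bounded by the values of \<open>h\<close> there and so vanishes at both ends of the
    line.\<close>
  define K where "K t = H (of_real (1/2) + \<i> * of_real t) - H (of_real (-1/2) + \<i> * of_real t)" for t :: real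
  have K_bound: "cmod (K t) \<le> C ^ 4 * exp (- pi * \<bar>t\<bar>)" for t
  proof -
    have "cmod (K t) \<le> C ^ 4 * exp (- pi * \<bar>t\<bar>) * cmod ((of_real (1/2) + \<i> * of_real t) - (of_real (-1/2) + \<i> * of_real t))"
      unfolding K_def
    proof (rule field_differentiable_bound[where S = "S \<inter> {z. Im z = t \<and> \<bar>Re z\<bar> \<le> 1/2}" and f' = h])
      have "{z. Im z = t \<and> \<bar>Re z\<bar> \<le> 1/2} = {z. Im z \<le> t} \<inter> {z. Im z \<ge> t} \<inter> {z. Re z \<le> 1/2} \<inter> {z. Re z \<ge> -1/2}"
        by auto
      moreover have "convex \<dots>"
        by (intro convex_Int convex_halfspace_Re_le convex_halfspace_Re_ge convex_halfspace_Im_le convex_halfspace_Im_ge)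
      ultimately show "convex (S \<inter> {z. Im z = t \<and> \<bar>Re z\<bar> \<le> 1/2})" using S(1) by (simp add: convex_Int)
      fix z assume z: "z \<in> S \<inter> {z. Im z = t \<and> \<bar>Re z\<bar> \<le> 1/2}"
      thus "(H has_field_derivative h z) (at z within S \<inter> {z. Im z = t \<and> \<bar>Re z\<bar> \<le> 1/2})"
        using H by (auto intro: has_field_derivative_at_within)
      have "z = of_real (Re z) + \<i> * of_real t" using z by (simp add: complex_eq_iff)
      thus "cmod (h z) \<le> C ^ 4 * exp (- pi * \<bar>t\<bar>)" using h_bound[of "Re z" t] z by auto
    qed (use strip[of "1/2" t] strip[of "-1/2" t] in auto)
    thus ?thesis by simp
  qed

  define k where "k t = 2 * (wilson_weight a b c d t * 
      ((a * b * c + a * b * d + a * c * d + b * c * d) - (a + b + c + d) * t\<^sup>2))" for t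
  have hk: "h (of_real (1/2) + \<i> * of_real t) - h (of_real (-1/2) + \<i> * of_real t) = of_real (k t)" for t
  proof -
    define z where "z = \<i> * complex_of_real t"
    define G where "G x = Gamma (of_real x + z) * Gamma (of_real x - z)" for x
    have nz: "of_real x + z \<notin> \<int>\<^sub>\<le>\<^sub>0" "of_real x - z \<notin> \<int>\<^sub>\<le>\<^sub>0" if "x > 0" for x
      using that by (auto intro!: not_nonpos_Int_Re_pos simp: z_def)
    have p1: "p x (of_real (1/2) + z) = (of_real x + z) * G x" if "x > 0" for x
      using Gamma_plus1[OF nz(1)[OF that]] by (simp add: p_def G_def add_ac)
    have p2: "p x (of_real (-1/2) + z) = (of_real x - z) * G x" if "x > 0" for x
    proof -
      have "p x (of_real (-1/2) + z) = Gamma (of_real x + z) * Gamma (of_real x - z + 1)"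
        by (simp add: p_def algebra_simps)
      thus ?thesis unfolding Gamma_plus1[OF nz(2)[OF that]] G_def by simp
    qed
    have s1: "sin (of_real (2 * pi) * (of_real (1/2) + z)) = - sin (of_real (2 * pi) * z)"
      by (simp add: algebra_simps sin_add)
    have s2: "sin (of_real (2 * pi) * (of_real (-1/2) + z)) = - sin (of_real (2 * pi) * z)"
      by (simp add: algebra_simps sin_diff)
    have "h (of_real (1/2) + z) - h (of_real (-1/2) + z) = - sin (of_real (2 * pi) * z) * (G a * G b * G c * G d) *
       ((of_real a + z) * (of_real b + z) * (of_real c + z) * (of_real d + z) -
        (of_real a - z) * (of_real b - z) * (of_real c - z) * (of_real d - z))"
      unfolding h_def s1 s2 p1[OF pos(1)] p1[OF pos(2)] p1[OF pos(3)] p1[OF pos(4)]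
        p2[OF pos(1)] p2[OF pos(2)] p2[OF pos(3)] p2[OF pos(4)] by (simp add: algebra_simps)
    \<comment> \<open>Only the part odd in \<open>z\<close> survives; its coefficients are the
      elementary symmetric polynomials of degree 3 and 1.\<close>
    also have "(of_real a + z) * (of_real b + z) * (of_real c + z) * (of_real d + z) -
        (of_real a - z) * (of_real b - z) * (of_real c - z) * (of_real d - z)
        = 2 * z * (of_real (a * b * c + a * b * d + a * c * d + b * c * d) + of_real (a + b + c + d) * z\<^sup>2)"
      by (simp add: algebra_simps power2_eq_square)
    also have "z\<^sup>2 = of_real (- t\<^sup>2)" by (simp add: z_def power_mult_distrib)
    also have "sin (of_real (2 * pi) * z) = \<i> * of_real (sinh (2 * pi * t))"
      using sin_i_real[of "2 * pi * t"] by (simp add: z_def mult_ac)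
    also have "G a * G b * G c * G d = of_real ((cmod (gam a t))\<^sup>2) * of_real ((cmod (gam b t))\<^sup>2)
         * of_real ((cmod (gam c t))\<^sup>2) * of_real ((cmod (gam d t))\<^sup>2)"
      unfolding cmod_gam_squared G_def z_def ..
    finally have A: "h (of_real (1/2) + z) - h (of_real (-1/2) + z) = 
      - (\<i> * of_real (sinh (2 * pi * t))) * (of_real ((cmod (gam a t))\<^sup>2) * of_real ((cmod (gam b t))\<^sup>2)
         * of_real ((cmod (gam c t))\<^sup>2) * of_real ((cmod (gam d t))\<^sup>2)) * (2 * (\<i> * of_real t) 
       * (of_real (a * b * c + a * b * d + a * c * d + b * c * d) + of_real (a + b + c + d) * of_real (- t\<^sup>2)))"
      by (simp only: z_def)
    have B: "- (\<i> * S) * P * (2 * (\<i> * T) * Q) = 2 * (T * S * P * Q)" for S P T Q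
      by (simp add: algebra_simps)
    have R: "k t = 2 * (t * sinh (2 * pi * t) * ((cmod (gam a t))\<^sup>2 * (cmod (gam b t))\<^sup>2 
         * (cmod (gam c t))\<^sup>2 * (cmod (gam d t))\<^sup>2) * ((a * b * c + a * b * d + a * c * d + b * c * d) 
         + (a + b + c + d) * (- t\<^sup>2)))"
      unfolding k_def wilson_weight_def by (simp only: mult_minus_right diff_conv_add_uminus)
    show ?thesis
      unfolding A[unfolded z_def] B R of_real_mult of_real_add of_real_numeral ..
  qed
  have k_int: "integrable lborel k"
  proof -
    have "integrable lborel (\<lambda>t. 2 * ((a * b * c + a * b * d + a * c * d + b * c * d) * wilson_weight a b c d t
        - (a + b + c + d) * (t\<^sup>2 * wilson_weight a b c d t)))"
      by (intro integrable_mult_right Bochner_Integration.integrable_diff wilson_weight_integrable 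
           t2_wilson_weight_integrable pos)
    thus ?thesis unfolding k_def by (simp add: algebra_simps)
  qed
  have "(LBINT t=-\<infinity>..\<infinity>. \<i> * complex_of_real (k t)) = 0 - 0"
  proof (rule interval_integral_FTC_integrable[where F = K])
    fix t :: real
    have D: "((\<lambda>t. H (of_real x + \<i> * of_real t)) has_vector_derivative \<i> * h (of_real x + \<i> * of_real t)) (at t)"
      if "\<bar>x\<bar> \<le> 1/2" for x
    proof -
      have x: "of_real x + \<i> * of_real t \<in> S" using that by (rule strip)
      have "((\<lambda>t. of_real x + \<i> * of_real t) has_vector_derivative \<i>) (at t)"
        by (auto simp: has_vector_derivative_def scaleR_conv_of_real intro!: derivative_eq_intros)
      from field_vector_diff_chain_at[OF this, where g = H, OF H[OF x]] show ?thesis by (simp add: o_def)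
    qed
    have "(K has_vector_derivative (\<i> * h (of_real (1/2) + \<i> * of_real t) - \<i> * h (of_real (-1/2) + \<i> * of_real t))) (at t)"
      unfolding K_def by (intro has_vector_derivative_diff D) auto
    also have "\<i> * h (of_real (1/2) + \<i> * of_real t) - \<i> * h (of_real (-1/2) + \<i> * of_real t) = \<i> * of_real (k t)"
      unfolding hk[symmetric] by (simp add: algebra_simps)
    finally show "(K has_vector_derivative \<i> * of_real (k t)) (at t)" .
    show "isCont (\<lambda>t. \<i> * complex_of_real (k t)) t"
      unfolding k_def by (intro continuous_intros isCont_wilson_weight pos)
  next
    show "set_integrable lborel (einterval (-\<infinity>) \<infinity>) (\<lambda>t. \<i> * complex_of_real (k t))"
      using k_int by (auto simp: set_integrable_def intro!: integrable_mult_right integrable_of_real)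
    have T: "((\<lambda>t. C ^ 4 * exp (- pi * \<bar>t\<bar>)) \<longlongrightarrow> 0) at_top" "((\<lambda>t. C ^ 4 * exp (- pi * \<bar>t\<bar>)) \<longlongrightarrow> 0) at_bot"
      by real_asymp+
    have "(K \<longlongrightarrow> 0) at_top" "(K \<longlongrightarrow> 0) at_bot"
      using K_bound by (auto intro!: Lim_null_comparison[OF _ T(1)] Lim_null_comparison[OF _ T(2)])
    thus "((K \<circ> real_of_ereal) \<longlongrightarrow> 0) (at_right (-\<infinity>))" "((K \<circ> real_of_ereal) \<longlongrightarrow> 0) (at_left \<infinity>)"
      by (auto simp: ereal_tendsto_simps)
  qed simp
  hence "(\<integral>t. \<i> * complex_of_real (k t) \<partial>lborel) = 0"
    by (simp add: interval_lebesgue_integral_def set_lebesgue_integral_def)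
  hence "(\<integral>t. k t \<partial>lborel) = 0" by simp
  thus ?thesis by (simp add: k_def)
qed


section \<open>Wilson's formula from its recurrence\<close>

definition wilson_int :: "real \<Rightarrow> real \<Rightarrow> real \<Rightarrow> real \<Rightarrow> real" where
  "wilson_int a b c d = (\<integral>t. wilson_weight a b c d t \<partial>lborel)"

text \<open>The right side of Wilson's formula without its constant. Passing from the half-line with
  1/|Gamma(2is)|^2 to the whole line with t sinh(2 pi t) changes the classical factor 2 pi into 2
  pi^2.\<close>

definition wilson_prod :: "real \<Rightarrow> real \<Rightarrow> real \<Rightarrow> real \<Rightarrow> real" where
  "wilson_prod a b c d = Gamma (a + b) * Gamma (a + c) * Gamma (a + d) * Gamma (b + c) * Gamma (b + d) * Gamma (c + d)
     / Gamma (a + b + c + d)"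

lemma wilson_prod_pos: "a > 0 \<Longrightarrow> b > 0 \<Longrightarrow> c > 0 \<Longrightarrow> d > 0 \<Longrightarrow> wilson_prod a b c d > 0"
  unfolding wilson_prod_def by (intro divide_pos_pos mult_pos_pos Gamma_real_pos) auto

text \<open>The weight at \<open>a + 1\<close> has the extra factor a^2 + t^2. The vanishing
  integral expresses the second moment through the integral itself, and a^2 e1 + e3 factors as
  (a+b)(a+c)(a+d).\<close>

lemma wilson_int_plus1:
  assumes pos: "a > 0" "b > 0" "c > 0" "d > 0"
  shows "(a + b + c + d) * wilson_int (a + 1) b c d = (a + b) * (a + c) * (a + d) * wilson_int a b c d"
proof -
  define e1 e3 where "e1 = a + b + c + d" and "e3 = a * b * c + a * b * d + a * c * d + b * c * d"
  define m where "m = (\<integral>t. t\<^sup>2 * wilson_weight a b c d t \<partial>lborel)"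
  note i = wilson_weight_integrable[OF pos] t2_wilson_weight_integrable[OF pos]
  have "(\<integral>t. e3 * wilson_weight a b c d t - e1 * (t\<^sup>2 * wilson_weight a b c d t) \<partial>lborel) = 0"
    using wilson_first_moment[OF pos] by (simp add: e1_def e3_def algebra_simps)
  hence 1: "e3 * wilson_int a b c d = e1 * m" using i by (simp add: wilson_int_def m_def)
  have "wilson_int (a + 1) b c d = (\<integral>t. a\<^sup>2 * wilson_weight a b c d t + t\<^sup>2 * wilson_weight a b c d t \<partial>lborel)"
    unfolding wilson_int_def wilson_weight_plus1[OF pos(1)] by (simp add: algebra_simps)
  also have "\<dots> = a\<^sup>2 * wilson_int a b c d + m" using i by (simp add: wilson_int_def m_def)
  finally have "e1 * wilson_int (a + 1) b c d = (a\<^sup>2 * e1 + e3) * wilson_int a b c d"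
    using 1 by (simp add: algebra_simps)
  also have "a\<^sup>2 * e1 + e3 = (a + b) * (a + c) * (a + d)"
    by (simp add: e1_def e3_def power2_eq_square algebra_simps)
  finally show ?thesis by (simp add: e1_def)
qed

lemma wilson_prod_plus1:
  assumes pos: "a > 0" "b > 0" "c > 0" "d > 0"
  shows "(a + b + c + d) * wilson_prod (a + 1) b c d = (a + b) * (a + c) * (a + d) * wilson_prod a b c d"
proof -
  have G: "Gamma (a + 1 + x) = (a + x) * Gamma (a + x)" if "x > 0" for x
  proof -
    have "a + x \<notin> \<int>\<^sub>\<le>\<^sub>0" using that pos by (auto elim!: nonpos_Ints_cases)
    from Gamma_plus1[OF this] show ?thesis by (simp add: add_ac)
  qed
  have "Gamma (a + 1 + b + c + d) = (a + b + c + d) * Gamma (a + b + c + d)"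
    using G[of "b + c + d"] pos by (simp add: add_ac)
  hence "wilson_prod (a + 1) b c d = ((a + b) * (a + c) * (a + d)) * 
      (Gamma (a + b) * Gamma (a + c) * Gamma (a + d) * Gamma (b + c) * Gamma (b + d) * Gamma (c + d)) 
      / ((a + b + c + d) * Gamma (a + b + c + d))"
    unfolding wilson_prod_def using G[OF pos(2)] G[OF pos(3)] G[OF pos(4)] by simp
  moreover have "a + b + c + d > 0" using pos by simp
  ultimately show ?thesis unfolding wilson_prod_def by simp
qed

lemma wilson_int_mono:
  assumes "0 < a" "a \<le> a'" "b > 0" "c > 0" "d > 0"
  shows "wilson_int a b c d / (Gamma a)\<^sup>2 \<le> wilson_int a' b c d / (Gamma a')\<^sup>2"
proof -
  have "(\<integral>t. wilson_weight a b c d t / (Gamma a)\<^sup>2 \<partial>lborel) \<le> (\<integral>t. wilson_weight a' b c d t / (Gamma a')\<^sup>2 \<partial>lborel)"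
  proof (rule integral_mono)
    fix t
    define s where "s = t * sinh (2 * pi * t) * ((cmod (gam b t))\<^sup>2 * (cmod (gam c t))\<^sup>2 * (cmod (gam d t))\<^sup>2)"
    have s: "s \<ge> 0" unfolding s_def by (intro mult_nonneg_nonneg t_sinh_nonneg) auto
    have w: "wilson_weight x b c d t / (Gamma x)\<^sup>2 = s * (cmod (gam x t) / Gamma x)\<^sup>2" for x
      by (simp add: s_def wilson_weight_def power_divide mult_ac)
    have "(cmod (gam a t) / Gamma a)\<^sup>2 \<le> (cmod (gam a' t) / Gamma a')\<^sup>2"
      using assms by (intro power_mono cmod_gam_mono) (auto intro: less_imp_le)
    thus "wilson_weight a b c d t / (Gamma a)\<^sup>2 \<le> wilson_weight a' b c d t / (Gamma a')\<^sup>2"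
      unfolding w by (rule mult_left_mono[OF _ s])
  qed (use assms in \<open>auto intro!: wilson_weight_integrable\<close>)
  thus ?thesis by (simp add: wilson_int_def)
qed

text \<open>Gauss's limit formula read backwards; the denominator is n! n^x.\<close>

lemma Gamma_asymptotic:
  assumes "x > (0::real)"
  shows "(\<lambda>n. Gamma (x + real n + 1) / (fact n * exp (x * ln (real n)))) \<longlonglongrightarrow> 1"
proof -
  have nz: "x \<notin> \<int>\<^sub>\<le>\<^sub>0" using assms by (auto elim!: nonpos_Ints_cases)
  have "(\<lambda>n. Gamma x / Gamma_series x n) \<longlonglongrightarrow> Gamma x / Gamma x"
    using Gamma_real_pos[OF assms] by (intro tendsto_intros) auto
  moreover have "Gamma x / Gamma_series x n = Gamma (x + real n + 1) / (fact n * exp (x * ln (real n)))" for n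
    using Gamma_real_pos[OF assms] pochhammer_Gamma[OF nz, of "n + 1"] unfolding Gamma_series_def 
    by (simp add: field_simps)
  ultimately show ?thesis using Gamma_real_pos[OF assms] by simp
qed

text \<open>Three Gamma values do not move with n. In the others the powers of n cancel because
  (a+b)+(a+c)+(a+d) = 2a + (a+b+c+d), and three factorials stand over three.\<close>

lemma wilson_prod_asymptotic:
  assumes pos: "a > 0" "b > 0" "c > 0" "d > 0"
  shows "(\<lambda>n. wilson_prod (a + real n + 1) b c d / (Gamma (a + real n + 1))\<^sup>2)
     \<longlonglongrightarrow> Gamma (b + c) * Gamma (b + d) * Gamma (c + d)"
proof -
  define E :: "real \<Rightarrow> nat \<Rightarrow> real" where "E x n = fact n * exp (x * ln (real n))" for x n
  define q where "q x n = Gamma (x + real n + 1) / E x n" for x n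
  have q: "q x \<longlonglongrightarrow> 1" if "x > 0" for x
    using Gamma_asymptotic[OF that] unfolding q_def E_def .
  have E: "E x n > 0" for x n by (simp add: E_def)
  have "(\<lambda>n. Gamma (b + c) * Gamma (b + d) * Gamma (c + d) * 
      (q (a + b) n * q (a + c) n * q (a + d) n / ((q a n)\<^sup>2 * q (a + b + c + d) n)))
     \<longlonglongrightarrow> Gamma (b + c) * Gamma (b + d) * Gamma (c + d) * (1 * 1 * 1 / (1\<^sup>2 * 1))"
    using pos by (intro tendsto_intros q) auto
  moreover have "wilson_prod (a + real n + 1) b c d / (Gamma (a + real n + 1))\<^sup>2 = 
     Gamma (b + c) * Gamma (b + d) * Gamma (c + d) * 
      (q (a + b) n * q (a + c) n * q (a + d) n / ((q a n)\<^sup>2 * q (a + b + c + d) n))" for n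
  proof -
    have g: "Gamma (x + real n + 1) = q x n * E x n" for x using E[of x n] by (simp add: q_def)
    have s: "a + real n + 1 + b = (a + b) + real n + 1" "a + real n + 1 + c = (a + c) + real n + 1"
      "a + real n + 1 + d = (a + d) + real n + 1" "(a + b) + real n + 1 + c + d = (a + b + c + d) + real n + 1"
      by auto
    have e: "E (a + b) n * E (a + c) n * E (a + d) n = (E a n)\<^sup>2 * E (a + b + c + d) n"
      by (simp add: E_def power2_eq_square algebra_simps exp_add)
    have "wilson_prod (a + real n + 1) b c d / (Gamma (a + real n + 1))\<^sup>2 = 
      Gamma (b + c) * Gamma (b + d) * Gamma (c + d) *
       (q (a + b) n * q (a + c) n * q (a + d) n * (E (a + b) n * E (a + c) n * E (a + d) n) 
       / ((q a n)\<^sup>2 * q (a + b + c + d) n * ((E a n)\<^sup>2 * E (a + b + c + d) n)))"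
      unfolding wilson_prod_def s g by (simp add: power_mult_distrib mult_ac)
    thus ?thesis unfolding e using E[of a n] E[of "a + b + c + d" n] by simp
  qed
  ultimately show ?thesis by simp
qed

text \<open>The ratio of the two sides of Wilson's formula has period 1 in each parameter, and by the
  monotonicity of the left side (and the asymptotics of the right side) it is monotone.\<close>

lemma wilson_ratio_const:
  assumes pos: "a > 0" "a' > 0" "b > 0" "c > 0" "d > 0"
  shows "wilson_int a b c d / wilson_prod a b c d = wilson_int a' b c d / wilson_prod a' b c d"
proof -
  define R where "R x = wilson_int x b c d / wilson_prod x b c d" for x
  have R1: "R (x + 1) = R x" if "x > 0" for x
  proof -
    have s: "x + b + c + d > 0" and P: "wilson_prod x b c d > 0" "wilson_prod (x + 1) b c d > 0"
      using that pos by (auto intro!: wilson_prod_pos)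
    have "(x + b + c + d) * wilson_int (x + 1) b c d * wilson_prod x b c d 
        = wilson_int x b c d * ((x + b + c + d) * wilson_prod (x + 1) b c d)"
      unfolding wilson_prod_plus1[OF that pos(3-5)] wilson_int_plus1[OF that pos(3-5)] by simp
    hence "wilson_int (x + 1) b c d * wilson_prod x b c d = wilson_int x b c d * wilson_prod (x + 1) b c d"
      using s by simp
    thus ?thesis using P by (simp add: R_def field_simps)
  qed
  have Rn: "R (x + real n) = R x" if "x > 0" for x n
  proof (induction n)
    case (Suc n)
    have "R (x + real n + 1) = R (x + real n)" using that by (intro R1) auto
    thus ?case using Suc by (simp add: add_ac)
  qed simp
  have mono: "R x \<le> R y" if xy: "0 < x" "x \<le> y" for x y
  proof -
    \<comment> \<open>\<open>\<theta>\<close> has the same limit along x + n + 1 and y + n + 1, so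
      the quotient of its values tends to 1. By periodicity \<open>R x\<close> and
      \<open>R y\<close> may be compared that far out.\<close>
    define \<theta> where "\<theta> x = wilson_prod x b c d / (Gamma x)\<^sup>2" for x
    define K where "K = Gamma (b + c) * Gamma (b + d) * Gamma (c + d)"
    have K: "K > 0" unfolding K_def using pos by (intro mult_pos_pos Gamma_real_pos) auto
    have lim: "(\<lambda>n. \<theta> (z + real n + 1)) \<longlonglongrightarrow> K" if "z > 0" for z
      unfolding \<theta>_def K_def by (rule wilson_prod_asymptotic[OF that pos(3-5)])
    have "R x \<le> R y * (\<theta> (y + real n + 1) / \<theta> (x + real n + 1))" for n
    proof -
      define u v where "u = x + real n + 1" and "v = y + real n + 1"
      have uv: "0 < u" "u \<le> v" "v > 0" using xy by (auto simp: u_def v_def)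
      have "\<theta> u > 0" "\<theta> v > 0" unfolding \<theta>_def using uv pos 
        by (auto intro!: divide_pos_pos wilson_prod_pos zero_less_power)
      moreover have Rz: "R z = (wilson_int z b c d / (Gamma z)\<^sup>2) / \<theta> z" if "z > 0" for z
        using Gamma_real_pos[OF that] by (simp add: R_def \<theta>_def)
      moreover have "wilson_int u b c d / (Gamma u)\<^sup>2 \<le> wilson_int v b c d / (Gamma v)\<^sup>2"
        by (rule wilson_int_mono[OF uv(1,2) pos(3-5)])
      hence "(wilson_int u b c d / (Gamma u)\<^sup>2) / \<theta> u \<le> (wilson_int v b c d / (Gamma v)\<^sup>2) / \<theta> u"
        using \<open>\<theta> u > 0\<close> by (intro divide_right_mono) auto
      ultimately have "R u \<le> R v * (\<theta> v / \<theta> u)" 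
        unfolding Rz[OF uv(1)] Rz[OF uv(3)] by simp
      moreover have "R u = R x" "R v = R y" 
        using Rn[of x "Suc n"] Rn[of y "Suc n"] xy by (auto simp: u_def v_def add_ac)
      ultimately show ?thesis by (simp add: u_def v_def)
    qed
    moreover have "(\<lambda>n. R y * (\<theta> (y + real n + 1) / \<theta> (x + real n + 1))) \<longlonglongrightarrow> R y * (K / K)"
      using K xy by (intro tendsto_intros lim) auto
    ultimately have "R x \<le> R y * (K / K)" by (intro LIMSEQ_le_const) auto
    thus ?thesis using K by simp
  qed
  \<comment> \<open>Periodicity moves \<open>y\<close> beyond \<open>x\<close>, so monotonicity
    yields the inequality for every pair in either order.\<close>
  have le: "R x \<le> R y" if "0 < x" "0 < y" for x y
  proof -
    obtain n :: nat where "x \<le> real n" using real_arch_simple by blast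
    hence "R x \<le> R (y + real n)" using that by (intro mono) auto
    thus ?thesis using that by (simp add: Rn)
  qed
  have "R a = R a'" using le[of a a'] le[of a' a] pos by simp
  thus ?thesis by (simp add: R_def)
qed

lemma wilson_commute1: "wilson_int b a c d = wilson_int a b c d" "wilson_prod b a c d = wilson_prod a b c d"
  by (simp_all add: wilson_int_def wilson_weight_def wilson_prod_def mult_ac add_ac)

lemma wilson_commute2: "wilson_int c b a d = wilson_int a b c d" "wilson_prod c b a d = wilson_prod a b c d"
  by (simp_all add: wilson_int_def wilson_weight_def wilson_prod_def mult_ac add_ac)

lemma wilson_commute3: "wilson_int d b c a = wilson_int a b c d" "wilson_prod d b c a = wilson_prod a b c d"
  by (simp_all add: wilson_int_def wilson_weight_def wilson_prod_def mult_ac add_ac)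

text \<open>Here |Gamma(a+it)|^2 = |Gamma(a+1+it)|^2 / (a^2+t^2), and the double zero of
  \<open>t * sinh (2 * pi * t)\<close> cancels the denominator as \<open>a\<close> tends to 0. The
  remaining Gamma values, at 1 and 1/2, are elementary by reflection, and the integrand tends to 2
  pi^4 / cosh(pi t)^2.\<close>

lemma wilson_special:
  shows "(\<lambda>n. wilson_int (1 / real (Suc n)) (1/2) (1/2) (1/2)) \<longlonglongrightarrow> 4 * pi ^ 3"
proof -
  define a where "a n = 1 / real (Suc n)" for n
  have a: "0 < a n" "a n \<le> 1" for n by (auto simp: a_def)
  have a_lim: "a \<longlonglongrightarrow> 0" unfolding a_def by (rule LIMSEQ_Suc[OF lim_1_over_n])
  obtain C1 where C1: "C1 > 0" "\<And>x t. x \<in> {1..2} \<Longrightarrow> (cmod (gam x t))\<^sup>2 \<le> C1 * exp (- (3 * pi / 4) * \<bar>t\<bar>)"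
    using cmod_gam_decay[of 1 2] by auto
  obtain C2 where C2: "C2 > 0" "\<And>t. (cmod (gam (1/2) t))\<^sup>2 \<le> C2 * exp (- (3 * pi / 4) * \<bar>t\<bar>)"
    using cmod_gam_decay[of "1/2" "1/2"] by auto
  have ga: "(cmod (gam (a n) t))\<^sup>2 = (cmod (gam (a n + 1) t))\<^sup>2 / ((a n)\<^sup>2 + t\<^sup>2)" for n t
  proof -
    have "(a n)\<^sup>2 + t\<^sup>2 > 0" using a(1)[of n] by (intro add_pos_nonneg) auto
    thus ?thesis unfolding cmod_gam_plus1[OF a(1)] by simp
  qed
  have "(\<lambda>n. \<integral>t. wilson_weight (a n) (1/2) (1/2) (1/2) t \<partial>lborel) \<longlonglongrightarrow> 
      (\<integral>t. 2 * pi ^ 4 * (1 / (cosh (pi * t))\<^sup>2) \<partial>lborel)"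
  \<comment> \<open>The majorant combines 2 pi t^2 exp(2 pi |t|) from the hyperbolic factor, 1/t^2
    from the functional equation, and four decay bounds with total exponent -3 pi |t|.\<close>
  proof (rule integral_dominated_convergence[where w = "\<lambda>t. (2 * pi) * (C1 * (C2 * C2 * C2)) * exp (- pi * \<bar>t\<bar>)"])
    show "integrable lborel (\<lambda>t. (2 * pi) * (C1 * (C2 * C2 * C2)) * exp (- pi * \<bar>t\<bar>))"
      by (intro integrable_mult_right integrable_exp_minus_abs pi_gt_zero)
    show "wilson_weight (a n) (1/2) (1/2) (1/2) \<in> borel_measurable lborel" for n
      using wilson_weight_integrable[of "a n" "1/2" "1/2" "1/2"] a by auto
    show "(\<lambda>t. 2 * pi ^ 4 * (1 / (cosh (pi * t))\<^sup>2)) \<in> borel_measurable lborel"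
      by (intro borel_measurable_integrable integrable_mult_right sech_squared_integral(1) pi_gt_zero)
    have nz: "AE t in lborel. t \<noteq> (0::real)" by (rule AE_lborel_singleton)
    show "AE t in lborel. (\<lambda>n. wilson_weight (a n) (1/2) (1/2) (1/2) t) \<longlonglongrightarrow> 2 * pi ^ 4 * (1 / (cosh (pi * t))\<^sup>2)"
      using nz
    proof eventually_elim
      case (elim t)
      have "((\<lambda>x. (cmod (gam (x + 1) t))\<^sup>2) \<longlongrightarrow> (cmod (gam (0 + 1) t))\<^sup>2) (at 0)"
        by (intro tendsto_intros not_nonpos_Int_Re_pos) auto
      hence "isCont (\<lambda>x. (cmod (gam (x + 1) t))\<^sup>2) 0" by (simp add: isCont_def)
      from isCont_tendsto_compose[OF this a_lim]
      have L: "(\<lambda>n. (cmod (gam (a n + 1) t))\<^sup>2) \<longlonglongrightarrow> (cmod (gam 1 t))\<^sup>2" by simp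
      have "(\<lambda>n. (cmod (gam (a n + 1) t))\<^sup>2 / ((a n)\<^sup>2 + t\<^sup>2)) \<longlonglongrightarrow> (cmod (gam 1 t))\<^sup>2 / (0\<^sup>2 + t\<^sup>2)"
        using elim by (intro tendsto_divide[OF L] tendsto_add tendsto_power[OF a_lim] tendsto_const) auto
      hence "(\<lambda>n. wilson_weight (a n) (1/2) (1/2) (1/2) t) \<longlonglongrightarrow> t * sinh (2 * pi * t) * 
         ((cmod (gam 1 t))\<^sup>2 / (0\<^sup>2 + t\<^sup>2) * (cmod (gam (1/2) t))\<^sup>2 * (cmod (gam (1/2) t))\<^sup>2 * (cmod (gam (1/2) t))\<^sup>2)"
        unfolding wilson_weight_def ga by (intro tendsto_mult tendsto_const)
      also have "t * sinh (2 * pi * t) * 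
         ((cmod (gam 1 t))\<^sup>2 / (0\<^sup>2 + t\<^sup>2) * (cmod (gam (1/2) t))\<^sup>2 * (cmod (gam (1/2) t))\<^sup>2 * (cmod (gam (1/2) t))\<^sup>2) =
         (2 * ((cmod (gam 1 t))\<^sup>2 * sinh (pi * t)) / t) * (cosh (pi * t) * (pi / cosh (pi * t)) ^ 3)"
        unfolding cmod_gam_half using elim sinh_double[of "pi * t"]
        by (simp add: field_simps power2_eq_square power3_eq_cube)
      also have "\<dots> = 2 * pi * (cosh (pi * t) * (pi / cosh (pi * t)) ^ 3)"
        unfolding cmod_gam_1 using elim by simp
      also have "\<dots> = 2 * pi ^ 4 * (1 / (cosh (pi * t))\<^sup>2)"
        using cosh_real_pos[of "pi * t"] by (simp add: field_simps power2_eq_square power3_eq_cube power4_eq_xxxx)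
      finally show ?case .
    qed
    show "AE t in lborel. norm (wilson_weight (a n) (1/2) (1/2) (1/2) t) 
        \<le> (2 * pi) * (C1 * (C2 * C2 * C2)) * exp (- pi * \<bar>t\<bar>)" for n
      using nz
    proof eventually_elim
      case (elim t)
      define e where "e = exp (- (3 * pi / 4) * \<bar>t\<bar>)"
      have "sinh \<bar>x\<bar> \<le> \<bar>x\<bar> * exp \<bar>x\<bar>" for x :: real
      proof -
        have "1 - 2 * \<bar>x\<bar> \<le> exp (- (2 * \<bar>x\<bar>))" using exp_ge_add_one_self[of "- (2 * \<bar>x\<bar>)"] by simp
        hence "exp \<bar>x\<bar> * (1 - 2 * \<bar>x\<bar>) \<le> exp \<bar>x\<bar> * exp (- (2 * \<bar>x\<bar>))" by (intro mult_left_mono) auto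
        also have "\<dots> = exp (- \<bar>x\<bar>)" by (simp flip: exp_add)
        finally show ?thesis by (simp add: sinh_field_def algebra_simps)
      qed
      from this[of "2 * pi * t"] have sh: "\<bar>sinh (2 * pi * t)\<bar> \<le> 2 * pi * \<bar>t\<bar> * exp (2 * pi * \<bar>t\<bar>)"
      proof -
        have "\<bar>sinh x\<bar> = sinh \<bar>x\<bar>" for x :: real by (auto simp: abs_if)
        from this[of "2 * pi * t"] \<open>sinh \<bar>2 * pi * t\<bar> \<le> _\<close> show ?thesis 
          by (simp only: abs_mult abs_numeral abs_of_pos[OF pi_gt_zero])
      qed
      have "t * sinh (2 * pi * t) = \<bar>t\<bar> * \<bar>sinh (2 * pi * t)\<bar>"
        using t_sinh_nonneg[of t] by (simp flip: abs_mult)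
      also have "\<dots> \<le> \<bar>t\<bar> * (2 * pi * \<bar>t\<bar> * exp (2 * pi * \<bar>t\<bar>))" by (intro mult_left_mono sh) auto
      also have "\<dots> = 2 * pi * t\<^sup>2 * exp (2 * pi * \<bar>t\<bar>)" by (simp add: power2_eq_square)
      finally have s: "t * sinh (2 * pi * t) \<le> 2 * pi * t\<^sup>2 * exp (2 * pi * \<bar>t\<bar>)" .
      have "(cmod (gam (a n) t))\<^sup>2 \<le> (cmod (gam (a n + 1) t))\<^sup>2 / t\<^sup>2"
        unfolding ga using elim by (intro divide_left_mono) (auto intro!: mult_pos_pos add_nonneg_pos)
      also have "\<dots> \<le> C1 * e / t\<^sup>2" unfolding e_def using a[of n] by (intro divide_right_mono C1) auto
      finally have g: "(cmod (gam (a n) t))\<^sup>2 \<le> C1 * e / t\<^sup>2" .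
      have "wilson_weight (a n) (1/2) (1/2) (1/2) t \<le> 
         2 * pi * t\<^sup>2 * exp (2 * pi * \<bar>t\<bar>) * ((C1 * e / t\<^sup>2) * (C2 * e) * (C2 * e) * (C2 * e))"
        unfolding wilson_weight_def using C2 C1 
        by (intro mult_mono s g C2(2)[folded e_def] mult_nonneg_nonneg) (auto simp: e_def)
      also have "\<dots> = 2 * pi * (C1 * (C2 * C2 * C2)) * (exp (2 * pi * \<bar>t\<bar>) * e ^ 4)"
        using elim by (simp add: power4_eq_xxxx mult_ac)
      also have "e ^ 4 = exp (- (3 * pi) * \<bar>t\<bar>)"
        unfolding e_def exp_of_nat_mult[symmetric] by simp
      also have "exp (2 * pi * \<bar>t\<bar>) * exp (- (3 * pi) * \<bar>t\<bar>) = exp (- pi * \<bar>t\<bar>)"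
        unfolding exp_add[symmetric] by (simp add: algebra_simps)
      finally show ?case using wilson_weight_nonneg[of "a n" "1/2" "1/2" "1/2" t] by simp
    qed
  qed
  also have "(\<integral>t. 2 * pi ^ 4 * (1 / (cosh (pi * t))\<^sup>2) \<partial>lborel) = 2 * pi ^ 4 * (2 / pi)"
    unfolding integral_mult_right_zero sech_squared_integral(2)[OF pi_gt_zero] ..
  also have "\<dots> = 4 * pi ^ 3" by (simp add: power4_eq_xxxx power3_eq_cube)
  finally show ?thesis by (simp add: a_def wilson_int_def)
qed

theorem wilson_integral:
  assumes "a > 0" "b > 0" "c > 0" "d > 0"
  shows "wilson_int a b c d = 2 * pi\<^sup>2 * wilson_prod a b c d"
proof -
  define R where "R a b c d = wilson_int a b c d / wilson_prod a b c d" for a b c d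
  have 1: "R a b c d = R a' b c d" if "a > 0" "a' > 0" "b > 0" "c > 0" "d > 0" for a a' b c d
    unfolding R_def by (rule wilson_ratio_const[OF that])
  have sw: "R b a c d = R a b c d" "R c b a d = R a b c d" "R d b c a = R a b c d" for a b c d
    unfolding R_def wilson_commute1[of b a c d] wilson_commute2[of c b a d] wilson_commute3[of d b c a] by simp_all
  \<comment> \<open>Only the first parameter may be altered. Transpositions bring \<open>b\<close>,
    \<open>c\<close> and \<open>d\<close> there one after the other, while \<open>a'\<close> waits
    in the second place.\<close>
  have all: "R a b c d = R a' (1/2) (1/2) (1/2)" if a': "a' > 0" for a'
  proof -
    have "R a b c d = R a' b c d" using assms that by (intro 1) auto
    also have "\<dots> = R b a' c d" by (rule sw(1))
    also have "\<dots> = R (1/2) a' c d" using assms that by (intro 1) auto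
    also have "\<dots> = R c a' (1/2) d" by (rule sw(2))
    also have "\<dots> = R (1/2) a' (1/2) d" using assms that by (intro 1) auto
    also have "\<dots> = R d a' (1/2) (1/2)" by (rule sw(3))
    also have "\<dots> = R (1/2) a' (1/2) (1/2)" using assms that by (intro 1) auto
    also have "\<dots> = R a' (1/2) (1/2) (1/2)" by (rule sw(1))
    finally show ?thesis .
  qed
  have G3: "Gamma (3/2 :: real) = sqrt pi / 2"
  proof -
    have "(1/2 :: real) \<notin> \<int>\<^sub>\<le>\<^sub>0" using nonpos_Ints_nonpos[of "1/2 :: real"] by auto
    from Gamma_plus1[OF this] show ?thesis by (simp add: Gamma_one_half_real)
  qed
  have lim: "(\<lambda>n. 1 / real (Suc n)) \<longlonglongrightarrow> 0" by (rule LIMSEQ_Suc[OF lim_1_over_n])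
  have "((\<lambda>x. wilson_prod x (1/2) (1/2) (1/2)) \<longlongrightarrow> wilson_prod 0 (1/2) (1/2) (1/2)) (at 0)"
    unfolding wilson_prod_def by (intro tendsto_intros) (auto elim!: nonpos_Ints_cases simp: Gamma_eq_zero_iff)
  hence "isCont (\<lambda>x. wilson_prod x (1/2) (1/2) (1/2)) 0" by (simp add: isCont_def)
  from isCont_tendsto_compose[OF this lim]
  have p: "(\<lambda>n. wilson_prod (1 / real (Suc n)) (1/2) (1/2) (1/2)) \<longlonglongrightarrow> wilson_prod 0 (1/2) (1/2) (1/2)" by simp
  \<comment> \<open>The product is Gamma(1/2)^3 Gamma(1)^3 / Gamma(3/2), with Gamma(3/2) =
    sqrt(pi)/2.\<close>
  have v: "wilson_prod 0 (1/2) (1/2) (1/2) = 2 * pi"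
    by (simp add: wilson_prod_def Gamma_one_half_real G3)
  have "(\<lambda>n. R (1 / real (Suc n)) (1/2) (1/2) (1/2)) \<longlonglongrightarrow> 4 * pi ^ 3 / (2 * pi)"
    unfolding R_def using p unfolding v by (intro tendsto_divide wilson_special) auto
  moreover have "R (1 / real (Suc n)) (1/2) (1/2) (1/2) = R a b c d" for n
    by (rule all[symmetric]) simp
  ultimately have "R a b c d = 4 * pi ^ 3 / (2 * pi)" by (simp add: LIMSEQ_const_iff)
  hence "R a b c d = 2 * pi\<^sup>2" by (simp add: power2_eq_square power3_eq_cube)
  thus ?thesis using wilson_prod_pos[OF assms] by (simp add: R_def field_simps)
qed

section \<open>Beta integrals\<close>

text \<open>The half-line is taken open so that logarithms and complex powers are never evaluated at
  0.\<close>

abbreviation lpos :: "real measure" where "lpos \<equiv> restrict_space lborel {0<..}"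

lemma space_lpos [simp]: "space lpos = {0<..}"
  by (simp add: space_restrict_space)

lemma lpos_measurable: "f \<in> borel_measurable borel \<Longrightarrow> f \<in> borel_measurable lpos"
  by (intro measurable_restrict_space1) simp

lemma lpos_scale_integrable:
  fixes f :: "real \<Rightarrow> 'a::{banach, second_countable_topology}"
  assumes "c > 0" shows "integrable lpos (\<lambda>x. f (c * x)) \<longleftrightarrow> integrable lpos f"
proof -
  have "(\<lambda>x. indicator {0<..} (0 + c * x) *\<^sub>R f (0 + c * x)) = (\<lambda>x. indicator {0<..} x *\<^sub>R f (c * x))"
    using assms by (auto simp: indicator_def zero_less_mult_iff)
  with lborel_integrable_real_affine_iff[of c "\<lambda>x. indicator {0<..} x *\<^sub>R f x" 0] assms 
  show ?thesis by (simp add: integrable_restrict_space)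
qed

lemma lpos_scale_integral:
  fixes f :: "real \<Rightarrow> 'a::{banach, second_countable_topology}"
  assumes "c > 0" shows "(\<integral>x. f x \<partial>lpos) = c *\<^sub>R (\<integral>x. f (c * x) \<partial>lpos)"
proof -
  have "(\<lambda>x. indicator {0<..} (0 + c * x) *\<^sub>R f (0 + c * x)) = (\<lambda>x. indicator {0<..} x *\<^sub>R f (c * x))"
    using assms by (auto simp: indicator_def zero_less_mult_iff)
  with lborel_integral_real_affine[of c "\<lambda>x. indicator {0<..} x *\<^sub>R f x" 0] assms 
  show ?thesis by (simp add: integral_restrict_space)
qed

interpretation lpos: sigma_finite_measure lpos
  by (rule sigma_finite_measure_restrict_space) (auto intro: sigma_finite_lborel)

interpretation lpos2: pair_sigma_finite lpos lpos ..

text \<open>Agrees with \<open>of_real x powr z\<close> for \<open>x > 0\<close>; all other values are junk.\<close>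

definition cpow :: "real \<Rightarrow> complex \<Rightarrow> complex" where
  "cpow x z = exp (z * of_real (ln x))"

lemma cpow_measurable [measurable (raw)]:
  assumes [measurable]: "f \<in> borel_measurable M" "g \<in> borel_measurable M" 
  shows "(\<lambda>x. cpow (f x) (g x)) \<in> borel_measurable M"
  unfolding cpow_def by measurable

lemma cpow_nonzero [simp]: "cpow x z \<noteq> 0" by (simp add: cpow_def)

lemma cpow_add: "cpow x (z + w) = cpow x z * cpow x w"
  by (simp add: cpow_def exp_add algebra_simps)

lemma cpow_diff: "cpow x (z - w) = cpow x z / cpow x w"
  by (simp add: cpow_def exp_diff algebra_simps)

lemma cpow_minus: "cpow x (- z) = inverse (cpow x z)"
  by (simp add: cpow_def exp_minus)

lemma cpow_mult: "x > 0 \<Longrightarrow> y > 0 \<Longrightarrow> cpow (x * y) z = cpow x z * cpow y z"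
  by (simp add: cpow_def exp_add ln_mult algebra_simps)

lemma cpow_divide: "x > 0 \<Longrightarrow> y > 0 \<Longrightarrow> cpow (x / y) z = cpow x z / cpow y z"
  by (simp add: cpow_def exp_diff ln_div algebra_simps)

lemma cpow_1 [simp]: "x > 0 \<Longrightarrow> cpow x 1 = of_real x"
  by (simp add: cpow_def exp_of_real)

lemma cpow_0 [simp]: "cpow x 0 = 1"
  by (simp add: cpow_def)

lemma cpow_of_nat: "x > 0 \<Longrightarrow> cpow x (of_nat n) = of_real x ^ n"
  by (simp add: cpow_def exp_of_nat_mult exp_of_real)

lemma cpow_of_real: "x > 0 \<Longrightarrow> cpow x (of_real a) = of_real (x powr a)"
  by (simp add: cpow_def powr_def flip: exp_of_real)

lemma norm_cpow: "x > 0 \<Longrightarrow> cmod (cpow x z) = x powr (Re z)"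
  by (simp add: cpow_def powr_def)

lemma of_real_norm_cpow: "x > 0 \<Longrightarrow> of_real (cmod (cpow x z)) = cpow x (of_real (Re z))"
  by (simp add: norm_cpow cpow_of_real)

lemma of_real_powr_cpow: "x > 0 \<Longrightarrow> of_real x powr z = cpow x z"
  by (simp add: cpow_def powr_def Ln_of_real)

lemma cnj_cpow: "cnj (cpow x z) = cpow x (cnj z)"
  by (simp add: cpow_def exp_cnj)

lemma integrable_of_real_iff:
  "integrable M (\<lambda>x. complex_of_real (f x)) \<longleftrightarrow> integrable M f"
  using integrable_Re[of M "\<lambda>x. complex_of_real (f x)"] integrable_of_real[of M f] by auto

lemma integrable_cmult_iff:
  "c \<noteq> 0 \<Longrightarrow> integrable M (\<lambda>x. c * f x) \<longleftrightarrow> integrable M (f :: _ \<Rightarrow> complex)"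
  using integrable_mult_right[of c M f] integrable_mult_right[of "inverse c" M "\<lambda>x. c * f x"]
  by (auto simp: mult.assoc[symmetric])

lemma lpos_Gamma:
  assumes "Re z > 0"
  shows "integrable lpos (\<lambda>x. cpow x (z - 1) * of_real (exp (- x)))" 
    "(\<integral>x. cpow x (z - 1) * of_real (exp (- x)) \<partial>lpos) = Gamma z"
proof -
  define f where "f t = complex_of_real t powr (z - 1) / of_real (exp t)" for t
  have f: "indicator {0<..} t *\<^sub>R f t = indicator {0<..} t *\<^sub>R (cpow t (z - 1) * of_real (exp (- t)))" for t
    by (auto simp: f_def indicator_def of_real_powr_cpow exp_minus divide_inverse)
  have m: "(\<lambda>t. indicator {0<..} t *\<^sub>R f t) \<in> borel_measurable lborel"
    unfolding f by measurable
  have s: "set_integrable lebesgue {0<..} f"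
    unfolding f_def by (rule absolutely_integrable_Gamma_integral'[OF assms])
  hence i: "integrable lborel (\<lambda>t. indicator {0<..} t *\<^sub>R f t)"
    unfolding set_integrable_def using integrable_completion[OF m] by simp
  have "(LINT t:{0<..}|lebesgue. f t) = integral {0<..} f"
    by (rule set_lebesgue_integral_eq_integral(2)[OF s])
  also have "\<dots> = Gamma z"
    using Gamma_integral_complex'[OF assms] unfolding f_def by (rule integral_unique)
  finally have v: "(\<integral>t. indicator {0<..} t *\<^sub>R f t \<partial>lborel) = Gamma z"
    unfolding set_lebesgue_integral_def using integral_completion[OF m] by simp
  show "integrable lpos (\<lambda>x. cpow x (z - 1) * of_real (exp (- x)))" 
    "(\<integral>x. cpow x (z - 1) * of_real (exp (- x)) \<partial>lpos) = Gamma z"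
    using i v unfolding f by (simp_all add: integrable_restrict_space integral_restrict_space)
qed

lemma lpos_Gamma_scaled:
  assumes "Re z > 0" "c > 0"
  shows "integrable lpos (\<lambda>x. cpow x (z - 1) * of_real (exp (- (c * x))))" 
    "(\<integral>x. cpow x (z - 1) * of_real (exp (- (c * x))) \<partial>lpos) = cpow c (- z) * Gamma z"
proof -
  define f where "f x = cpow x (z - 1) * of_real (exp (- x))" for x
  have f: "f (c * x) = cpow c (z - 1) * (cpow x (z - 1) * of_real (exp (- (c * x))))" if "x \<in> space lpos" for x
    using that assms(2) by (simp add: f_def cpow_mult)
  have "integrable lpos (\<lambda>x. f (c * x))"
    unfolding lpos_scale_integrable[OF assms(2)] unfolding f_def by (rule lpos_Gamma[OF assms(1)])
  hence "integrable lpos (\<lambda>x. cpow c (z - 1) * (cpow x (z - 1) * of_real (exp (- (c * x)))))"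
    by (subst (asm) Bochner_Integration.integrable_cong[OF refl f]) auto
  thus "integrable lpos (\<lambda>x. cpow x (z - 1) * of_real (exp (- (c * x))))" 
    by (simp only: integrable_cmult_iff[OF cpow_nonzero])
  have "Gamma z = c *\<^sub>R (\<integral>x. f (c * x) \<partial>lpos)"
    using lpos_Gamma(2)[OF assms(1)] lpos_scale_integral[OF assms(2), of f] by (simp add: f_def)
  also have "(\<integral>x. f (c * x) \<partial>lpos) = (\<integral>x. cpow c (z - 1) * (cpow x (z - 1) * of_real (exp (- (c * x)))) \<partial>lpos)"
    by (rule Bochner_Integration.integral_cong[OF refl f])
  also have "c *\<^sub>R \<dots> = cpow c z * (\<integral>x. cpow x (z - 1) * of_real (exp (- (c * x))) \<partial>lpos)"
  proof -
    have "of_real c * cpow c (z - 1) = cpow c z" using assms(2) by (simp add: cpow_diff)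
    thus ?thesis unfolding integral_mult_right_zero scaleR_conv_of_real by (simp flip: mult.assoc)
  qed
  finally show "(\<integral>x. cpow x (z - 1) * of_real (exp (- (c * x))) \<partial>lpos) = cpow c (- z) * Gamma z"
    by (simp add: cpow_minus)
qed

text \<open>The double integral of x^(p+q-1) v^(p-1) exp(-x(1+v)) is computed in both orders: over
  \<open>v\<close> the inner integral is Gamma(p) times the integrand of Gamma(q), over
  \<open>x\<close> it is Gamma(p+q) times the Beta integrand.\<close>

lemma lpos_Beta:
  assumes p: "Re p > 0" and q: "Re q > 0"
  shows "integrable lpos (\<lambda>v. cpow v (p - 1) * cpow (1 + v) (- (p + q)))"
    "(\<integral>v. cpow v (p - 1) * cpow (1 + v) (- (p + q)) \<partial>lpos) = Gamma p * Gamma q / Gamma (p + q)"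
proof -
  define \<Phi> where "\<Phi> p q x v = cpow x (p + q - 1) * cpow v (p - 1) * of_real (exp (- (x * (1 + v))))" for p q and x v :: real
  have meas: "case_prod (\<Phi> p q) \<in> borel_measurable (lpos \<Otimes>\<^sub>M lpos)" for p q
  proof -
    have [measurable]: "fst \<in> borel_measurable (lpos \<Otimes>\<^sub>M lpos)" "snd \<in> borel_measurable (lpos \<Otimes>\<^sub>M lpos)"
      using measurable_compose[OF measurable_fst lpos_measurable[of "\<lambda>x. x"]]
        measurable_compose[OF measurable_snd lpos_measurable[of "\<lambda>x. x"]] by auto
    show ?thesis unfolding \<Phi>_def split_beta' by measurable
  qed
  have v: "integrable lpos (\<Phi> p q x)" 
     "(\<integral>v. \<Phi> p q x v \<partial>lpos) = Gamma p * (cpow x (q - 1) * of_real (exp (- x)))" 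
    if "Re p > 0" "x > 0" for p q x
  proof -
    have eq: "\<Phi> p q x = (\<lambda>v. cpow x (p + q - 1) * of_real (exp (-x)) * (cpow v (p - 1) * of_real (exp (- (x * v)))))"
    proof
      fix v
      have "complex_of_real (exp (- (x * (1 + v)))) = of_real (exp (-x)) * of_real (exp (- (x * v)))"
        by (simp add: distrib_left flip: of_real_mult exp_add)
      thus "\<Phi> p q x v = cpow x (p + q - 1) * of_real (exp (-x)) * (cpow v (p - 1) * of_real (exp (- (x * v))))"
        unfolding \<Phi>_def by (simp only: mult_ac)
    qed
    show "integrable lpos (\<Phi> p q x)" unfolding eq by (intro integrable_mult_right lpos_Gamma_scaled that)
    have "cpow x (p + q - 1) * cpow x (- p) = cpow x (q - 1)" by (simp flip: cpow_add)
    thus "(\<integral>v. \<Phi> p q x v \<partial>lpos) = Gamma p * (cpow x (q - 1) * of_real (exp (- x)))"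
      unfolding eq integral_mult_right_zero lpos_Gamma_scaled(2)[OF that]
      by (simp only: mult_ac)
  qed
  \<comment> \<open>Absolute values replace the parameters by their real parts, so the integrability
    required by Fubini is the inner formula at real parameters.\<close>
  have norm: "complex_of_real (norm (\<Phi> p q x v)) = \<Phi> (of_real (Re p)) (of_real (Re q)) x v" if "x > 0" "v > 0" for x v
    using that by (simp add: \<Phi>_def norm_mult of_real_norm_cpow)
  have "complex_of_real (\<integral>v. norm (\<Phi> p q x v) \<partial>lpos) = 
      Gamma (of_real (Re p)) * (cpow x (of_real (Re q) - 1) * of_real (exp (- x)))" if "x > 0" for x
  proof -
    have "complex_of_real (\<integral>v. norm (\<Phi> p q x v) \<partial>lpos) = (\<integral>v. complex_of_real (norm (\<Phi> p q x v)) \<partial>lpos)"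
      by (rule integral_complex_of_real[symmetric])
    also have "\<dots> = (\<integral>v. \<Phi> (of_real (Re p)) (of_real (Re q)) x v \<partial>lpos)"
      using that by (intro Bochner_Integration.integral_cong) (auto simp: norm)
    finally show ?thesis using v(2)[of "of_real (Re p)" x] that p by simp
  qed
  hence "integrable lpos (\<lambda>x. complex_of_real (\<integral>v. norm (\<Phi> p q x v) \<partial>lpos)) \<longleftrightarrow> 
     integrable lpos (\<lambda>x. Gamma (of_real (Re p)) * (cpow x (of_real (Re q) - 1) * of_real (exp (- x))))"
    by (intro Bochner_Integration.integrable_cong) auto
  moreover have "integrable lpos (\<lambda>x. Gamma (of_real (Re p)) * (cpow x (of_real (Re q) - 1) * of_real (exp (- x))))"
    using q by (intro integrable_mult_right lpos_Gamma) auto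
  ultimately have i1: "integrable lpos (\<lambda>x. \<integral>v. norm (\<Phi> p q x v) \<partial>lpos)" by (simp only: integrable_of_real_iff)
  have int: "integrable (lpos \<Otimes>\<^sub>M lpos) (case_prod (\<Phi> p q))"
    by (rule lpos2.Fubini_integrable[OF meas]) (use i1 v(1)[OF p] in \<open>auto intro!: AE_I2\<close>)
  have x: "(\<integral>x. \<Phi> p q x v \<partial>lpos) = Gamma (p + q) * (cpow v (p - 1) * cpow (1 + v) (- (p + q)))" if "v > 0" for v
  proof -
    have eq: "(\<lambda>x. \<Phi> p q x v) = (\<lambda>x. cpow v (p - 1) * (cpow x (p + q - 1) * of_real (exp (- ((1 + v) * x)))))"
      by (simp add: \<Phi>_def fun_eq_iff mult_ac)
    show ?thesis unfolding eq integral_mult_right_zero using that p q by (subst lpos_Gamma_scaled(2)) auto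
  qed
  have nz: "Gamma (p + q) \<noteq> 0" using p q by (subst Gamma_eq_zero_iff) (auto intro!: not_nonpos_Int_Re_pos)
  have "integrable lpos (\<lambda>v. \<integral>x. \<Phi> p q x v \<partial>lpos)"
    by (rule lpos2.integrable_snd[OF int])
  hence "integrable lpos (\<lambda>v. Gamma (p + q) * (cpow v (p - 1) * cpow (1 + v) (- (p + q))))"
    by (subst (asm) Bochner_Integration.integrable_cong[OF refl x]) auto
  thus "integrable lpos (\<lambda>v. cpow v (p - 1) * cpow (1 + v) (- (p + q)))" by (simp only: integrable_cmult_iff[OF nz])
  have "(\<integral>v. \<integral>x. \<Phi> p q x v \<partial>lpos \<partial>lpos) = (\<integral>x. \<integral>v. \<Phi> p q x v \<partial>lpos \<partial>lpos)"
    by (rule lpos2.Fubini_integral[OF int])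
  also have "(\<integral>v. \<integral>x. \<Phi> p q x v \<partial>lpos \<partial>lpos) = (\<integral>v. Gamma (p + q) * (cpow v (p - 1) * cpow (1 + v) (- (p + q))) \<partial>lpos)"
    by (intro Bochner_Integration.integral_cong refl x) auto
  also have "(\<integral>x. \<integral>v. \<Phi> p q x v \<partial>lpos \<partial>lpos) = (\<integral>x. Gamma p * (cpow x (q - 1) * of_real (exp (- x))) \<partial>lpos)"
    by (intro Bochner_Integration.integral_cong refl v p) auto
  also have "\<dots> = Gamma p * Gamma q" using q by (simp add: lpos_Gamma)
  finally show "(\<integral>v. cpow v (p - 1) * cpow (1 + v) (- (p + q)) \<partial>lpos) = Gamma p * Gamma q / Gamma (p + q)"
    using nz by (simp add: field_simps)
qed

text \<open>Cauchy's estimate on discs of radius r/2 bounds the derivative in the parameter by 2g/r,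
  hence also the difference quotients; dominated convergence along sequences differentiates under
  the integral.\<close>

lemma holomorphic_on_integral:
  fixes f :: "complex \<Rightarrow> 'a \<Rightarrow> complex"
  assumes "open A" and hol: "\<And>x. x \<in> space M \<Longrightarrow> (\<lambda>z. f z x) holomorphic_on A"
    and meas: "\<And>z. z \<in> A \<Longrightarrow> f z \<in> borel_measurable M"
    and bound: "\<And>K. compact K \<Longrightarrow> K \<subseteq> A \<Longrightarrow> \<exists>g. integrable M g \<and> (\<forall>z\<in>K. \<forall>x\<in>space M. norm (f z x) \<le> g x)"
  shows "(\<lambda>z. \<integral>x. f z x \<partial>M) holomorphic_on A"
  unfolding holomorphic_on_open[OF assms(1)]
proof
  fix w assume w: "w \<in> A"
  then obtain r where r: "r > 0" "cball w r \<subseteq> A" using assms(1) open_contains_cball by blast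
  obtain g where g: "integrable M g" "\<And>z x. z \<in> cball w r \<Longrightarrow> x \<in> space M \<Longrightarrow> norm (f z x) \<le> g x"
    using bound[OF _ r(2)] by auto
  define D where "D x = deriv (\<lambda>z. f z x) w" for x
  have fd: "((\<lambda>z. f z x) has_field_derivative deriv (\<lambda>z. f z x) z) (at z)" if "x \<in> space M" "z \<in> A" for x z
    by (rule holomorphic_derivI[OF hol[OF that(1)] assms(1) that(2)])
  have db: "norm (deriv (\<lambda>z. f z x) z) \<le> g x / (r / 2)" if "x \<in> space M" "z \<in> ball w (r / 2)" for x z
  proof -
    have sub: "cball z (r / 2) \<subseteq> cball w r"
    proof
      fix y assume "y \<in> cball z (r / 2)"
      hence "dist w y \<le> dist w z + dist z y" "dist z y \<le> r / 2" "dist w z < r / 2" 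
        using that dist_triangle[of w y z] by auto
      thus "y \<in> cball w r" by simp
    qed
    have "norm ((deriv ^^ 1) (\<lambda>z. f z x) z) \<le> fact 1 * g x / (r / 2) ^ 1"
    proof (rule Cauchy_inequality)
      show "(\<lambda>z. f z x) holomorphic_on ball z (r / 2)"
        by (rule holomorphic_on_subset[OF hol[OF that(1)]], rule order_trans[OF ball_subset_cball order_trans[OF sub r(2)]])
      show "continuous_on (cball z (r / 2)) (\<lambda>z. f z x)"
        by (rule holomorphic_on_imp_continuous_on[OF holomorphic_on_subset[OF hol[OF that(1)] order_trans[OF sub r(2)]]])
      fix y assume "norm (z - y) = r / 2"
      hence "y \<in> cball z (r / 2)" by (simp add: dist_norm)
      thus "norm (f y x) \<le> g x" using sub that(1) by (intro g) auto
    qed (use r in auto)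
    thus ?thesis by simp
  qed
  have lip: "norm ((f z x - f w x) / (z - w)) \<le> g x / (r / 2)" if "x \<in> space M" "z \<in> ball w (r / 2)" "z \<noteq> w" for x z
  proof -
    have "norm (f z x - f w x) \<le> g x / (r / 2) * norm (z - w)"
    proof (rule field_differentiable_bound[where S = "ball w (r/2)" and f' = "deriv (\<lambda>z. f z x)"])
      fix y assume y: "y \<in> ball w (r / 2)"
      hence "y \<in> A" using r by (auto simp: subset_iff)
      thus "((\<lambda>z. f z x) has_field_derivative deriv (\<lambda>z. f z x) y) (at y within ball w (r / 2))"
        using fd[OF that(1)] has_field_derivative_at_within by blast
      show "norm (deriv (\<lambda>z. f z x) y) \<le> g x / (r / 2)" by (rule db[OF that(1) y])
    qed (use r that in auto)
    thus ?thesis using that by (simp add: norm_divide pos_divide_le_eq)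
  qed
  have int: "integrable M (f z)" if "z \<in> cball w r" for z
  proof (rule Bochner_Integration.integrable_bound[OF g(1) meas])
    show "AE x in M. norm (f z x) \<le> norm (g x)"
      using g(2)[OF that] by (intro AE_I2) (auto intro: order_trans[OF _ abs_ge_self])
  qed (use that r in auto)
  have "((\<lambda>z. \<integral>x. f z x \<partial>M) has_field_derivative (\<integral>x. D x \<partial>M)) (at w)"
    unfolding has_field_derivative_iff tendsto_at_iff_sequentially
  proof (intro allI impI)
    fix X assume X: "\<forall>i. X i \<in> UNIV - {w}" "X \<longlonglongrightarrow> w"
    have "eventually (\<lambda>i. X i \<in> ball w (r / 2)) sequentially"
      using X(2) r by (intro topological_tendstoD) auto
    then obtain n0 where n0: "\<And>i. i \<ge> n0 \<Longrightarrow> X i \<in> ball w (r / 2)" by (auto simp: eventually_sequentially)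
    define Y where "Y i = X (i + n0)" for i
    have Y: "Y i \<in> ball w (r / 2)" "Y i \<noteq> w" for i using X(1) n0[of "i + n0"] by (auto simp: Y_def)
    have Ylim: "Y \<longlonglongrightarrow> w" unfolding Y_def by (rule LIMSEQ_ignore_initial_segment[OF X(2)])
    have YA: "Y i \<in> A" "Y i \<in> cball w r" for i using Y(1)[of i] r by (auto simp: subset_iff)
    have ptw: "(\<lambda>i. (f (Y i) x - f w x) / (Y i - w)) \<longlonglongrightarrow> D x" if "x \<in> space M" for x
      using fd[OF that w] Ylim Y(2) unfolding D_def has_field_derivative_iff tendsto_at_iff_sequentially by (auto simp: o_def)
    have mD: "D \<in> borel_measurable M"
      by (rule borel_measurable_LIMSEQ_metric[OF _ ptw]) 
        (auto intro!: borel_measurable_divide borel_measurable_diff meas YA w)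
    have "(\<lambda>i. \<integral>x. (f (Y i) x - f w x) / (Y i - w) \<partial>M) \<longlonglongrightarrow> (\<integral>x. D x \<partial>M)"
    proof (rule integral_dominated_convergence[where w = "\<lambda>x. g x / (r / 2)"])
      show "(\<lambda>x. (f (Y i) x - f w x) / (Y i - w)) \<in> borel_measurable M" for i
        by (auto intro!: borel_measurable_divide borel_measurable_diff meas YA w)
    qed (use mD g ptw lip Y in \<open>auto intro!: AE_I2\<close>)
    also have "(\<lambda>i. \<integral>x. (f (Y i) x - f w x) / (Y i - w) \<partial>M) = 
       (\<lambda>i. ((\<integral>x. f (Y i) x \<partial>M) - (\<integral>x. f w x \<partial>M)) / (Y i - w))"
      using int[OF YA(2)] int[of w] r by (simp add: integral_divide_zero)
    finally show "((\<lambda>z. ((\<integral>x. f z x \<partial>M) - (\<integral>x. f w x \<partial>M)) / (z - w)) \<circ> X) \<longlonglongrightarrow> (\<integral>x. D x \<partial>M)"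
      using LIMSEQ_offset[where k = n0 and a = "\<integral>x. D x \<partial>M" and f = "((\<lambda>z. ((\<integral>x. f z x \<partial>M) - (\<integral>x. f w x \<partial>M)) / (z - w)) \<circ> X)"]
      by (simp add: Y_def o_def)
  qed
  thus "\<exists>f'. ((\<lambda>z. \<integral>x. f z x \<partial>M) has_field_derivative f') (at w)" by blast
qed

section \<open>Euler's integral for the Gauss function\<close>

definition euler_weight :: "complex \<Rightarrow> complex \<Rightarrow> real \<Rightarrow> complex" where
  "euler_weight q r m = cpow m (r - q - 1) * cpow (1 + m) (- r)"

text \<open>Euler's integral \<open>\<integral>\<^sub>0\<^sup>1 t\<^bsup>q-1\<^esup> (1-t)\<^bsup>r-q-1\<^esup> (1-zt)\<^bsup>-p\<^esup> dt\<close> after the substitution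
  \<open>t = 1/(1+m)\<close>.\<close>

definition euler_2F1 :: "complex \<Rightarrow> complex \<Rightarrow> complex \<Rightarrow> complex \<Rightarrow> complex" where
  "euler_2F1 p q r z = Gamma r / (Gamma q * Gamma (r - q)) *
     (\<integral>m. euler_weight q r m * (1 - z / of_real (1 + m)) powr (- p) \<partial>lpos)"

lemma slit_not_nonpos:
  assumes "z \<notin> complex_of_real ` {1..}" "0 < t" "t \<le> 1"
  shows "1 - z * of_real t \<notin> \<real>\<^sub>\<le>\<^sub>0"
proof
  assume "1 - z * of_real t \<in> \<real>\<^sub>\<le>\<^sub>0"
  then obtain x where x: "1 - z * of_real t = of_real x" "x \<le> 0" by (auto elim: nonpos_Reals_cases)
  hence "z = of_real ((1 - x) / t)" using assms(2) by (simp add: field_simps)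
  moreover have "(1 - x) / t \<in> {1..}" using assms x(2) by (simp add: pos_le_divide_eq)
  ultimately show False using assms(1) by (metis imageI)
qed

lemma open_slit: "open (- (complex_of_real ` {1..}))"
  by (intro open_Compl closed_injective_linear_image) (auto simp: linear_of_real inj_def)

lemma euler_weight_measurable [measurable]: "euler_weight q r \<in> borel_measurable lpos"
  unfolding euler_weight_def by (rule lpos_measurable) measurable

lemma euler_weight_integrable:
  assumes "Re q > 0" "Re (r - q) > 0"
  shows "integrable lpos (euler_weight q r)"
  using lpos_Beta(1)[OF assms(2,1)] by (simp add: euler_weight_def[abs_def])

text \<open>Every power of 1/(1+m) raises the second Beta parameter \<open>q\<close> by one; these
  moments become the Pochhammer quotients of the series.\<close>

lemma euler_weight_moment:
  assumes "Re q > 0" "Re (r - q) > 0"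
  shows "(\<integral>m. euler_weight q r m * (1 / of_real (1 + m)) ^ n \<partial>lpos) 
    = Gamma (r - q) * Gamma (q + of_nat n) / Gamma (r + of_nat n)"
proof -
  have "(\<integral>m. euler_weight q r m * (1 / of_real (1 + m)) ^ n \<partial>lpos) = 
     (\<integral>m. cpow m ((r - q) - 1) * cpow (1 + m) (- ((r - q) + (q + of_nat n))) \<partial>lpos)"
  proof (rule Bochner_Integration.integral_cong)
    fix m assume "m \<in> space lpos"
    hence m: "1 + m > 0" by simp
    have "- (r + of_nat n) = - r - of_nat n" by simp
    hence "cpow (1 + m) (- (r + of_nat n)) = cpow (1 + m) (- r) * (1 / of_real (1 + m)) ^ n"
      using cpow_of_nat[OF m, of n] by (simp only: cpow_diff) (simp add: power_divide)
    thus "euler_weight q r m * (1 / of_real (1 + m)) ^ n = 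
       cpow m ((r - q) - 1) * cpow (1 + m) (- ((r - q) + (q + of_nat n)))"
      by (simp add: euler_weight_def)
  qed simp
  also have "\<dots> = Gamma (r - q) * Gamma (q + of_nat n) / Gamma ((r - q) + (q + of_nat n))"
    using assms by (intro lpos_Beta) auto
  finally show ?thesis by simp
qed

lemma euler_2F1_holomorphic:
  assumes q: "Re q > 0" and rq: "Re (r - q) > 0"
  shows "euler_2F1 p q r holomorphic_on - (complex_of_real ` {1..})"
proof -
  let ?A = "- (complex_of_real ` {1..})"
  have eq: "1 - z / of_real (1 + m) = 1 - z * of_real (1 / (1 + m))" for z :: complex and m :: real
    by simp
  have nn: "1 - z * of_real (1 / (1 + m)) \<notin> \<real>\<^sub>\<le>\<^sub>0" if "z \<in> ?A" "m > 0" for z m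
    using that by (intro slit_not_nonpos) auto
  have "(\<lambda>z. \<integral>m. euler_weight q r m * (1 - z / of_real (1 + m)) powr (- p) \<partial>lpos) holomorphic_on ?A"
  proof (rule holomorphic_on_integral[OF open_slit])
    fix m assume "m \<in> space lpos"
    thus "(\<lambda>z. euler_weight q r m * (1 - z / of_real (1 + m)) powr (- p)) holomorphic_on ?A"
      unfolding eq using nn by (intro holomorphic_intros) auto
  next
    fix z
    have "(\<lambda>m. (1 - z / of_real (1 + m)) powr (- p)) \<in> borel_measurable borel"
      unfolding powr_def by measurable
    from lpos_measurable[OF this] 
    show "(\<lambda>m. euler_weight q r m * (1 - z / of_real (1 + m)) powr (- p)) \<in> borel_measurable lpos"
      by measurable
  next
    fix K assume K: "compact K" "K \<subseteq> ?A"
    \<comment> \<open>With t = 1/(1+m) the unbounded variable becomes a point of (0,1]. Adding t =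
      0, where the base equals 1, produces a compact set on which the factor is continuous and so
      bounded.\<close>
    define \<phi> where "\<phi> = (\<lambda>(z, t). (1 - z * complex_of_real t) powr (- p))"
    have nn': "1 - fst y * complex_of_real (snd y) \<notin> \<real>\<^sub>\<le>\<^sub>0" if "y \<in> K \<times> {0..1}" for y
    proof -
      have "fst y \<notin> complex_of_real ` {1..}" "snd y = 0 \<or> 0 < snd y" "snd y \<le> 1" using that K by auto
      thus ?thesis using slit_not_nonpos by auto
    qed
    have "continuous_on (K \<times> {0..1}) (\<lambda>y. exp (- p * Ln (1 - fst y * complex_of_real (snd y))))"
      by (intro continuous_intros nn')
    moreover have "exp (- p * Ln (1 - fst y * complex_of_real (snd y))) = \<phi> y" if "y \<in> K \<times> {0..1}" for y
      using nn'[OF that] by (auto simp: \<phi>_def powr_def split_beta')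
    ultimately have "continuous_on (K \<times> {0..1}) \<phi>" by (simp cong: continuous_on_cong)
    hence "compact (\<phi> ` (K \<times> {0..1}))"
      by (intro compact_continuous_image compact_Times K) auto
    hence "bounded (\<phi> ` (K \<times> {0..1}))" by (rule compact_imp_bounded)
    then obtain B where B: "\<And>x. x \<in> K \<times> {0..1} \<Longrightarrow> norm (\<phi> x) \<le> B" unfolding bounded_iff by auto
    show "\<exists>g. integrable lpos g \<and> (\<forall>z\<in>K. \<forall>x\<in>space lpos. 
       norm (euler_weight q r x * (1 - z / of_real (1 + x)) powr (- p)) \<le> g x)"
    proof (intro exI[of _ "\<lambda>m. norm (euler_weight q r m) * B"] conjI ballI)
      show "integrable lpos (\<lambda>m. norm (euler_weight q r m) * B)"
        by (intro integrable_mult_left integrable_norm euler_weight_integrable q rq)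
      fix z m assume "z \<in> K" "m \<in> space lpos"
      hence "norm (\<phi> (z, 1 / (1 + m))) \<le> B" by (intro B) auto
      thus "norm (euler_weight q r m * (1 - z / of_real (1 + m)) powr (- p)) \<le> norm (euler_weight q r m) * B"
        unfolding eq norm_mult \<phi>_def by (intro mult_left_mono) auto
    qed
  qed
  thus ?thesis unfolding euler_2F1_def[abs_def] by (intro holomorphic_intros)
qed

lemma binomial_series_powr:
  assumes "norm (w :: complex) < 1"
  shows "(\<lambda>n. pochhammer p n / fact n * w ^ n) sums ((1 - w) powr (- p))"
proof -
  have "(\<lambda>n. (- p gchoose n) * (- w) ^ n) sums (1 + (- w)) powr (- p)"
    by (rule gen_binomial_complex) (use assms in simp)
  moreover have "(- p gchoose n) * (- w) ^ n = pochhammer p n / fact n * w ^ n" for n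
  proof -
    have "(- p gchoose n) * (- w) ^ n = ((-1) ^ n * (-1) ^ n) * (pochhammer p n / fact n * w ^ n)"
      unfolding gbinomial_pochhammer power_minus[of w n] by simp
    also have "(-1) ^ n * (-1) ^ n = (1 :: complex)" by (simp flip: power_mult_distrib)
    finally show ?thesis by simp
  qed
  ultimately show ?thesis by simp
qed

lemma euler_2F1_series:
  assumes q: "Re q > 0" and rq: "Re (r - q) > 0" and z: "norm z < 1"
  shows "(\<lambda>n. pochhammer p n * pochhammer q n / (pochhammer r n * fact n) * z ^ n) sums euler_2F1 p q r z"
proof -
  define c where "c n = pochhammer p n / fact n" for n
  define f where "f n m = euler_weight q r m * (c n * (z / of_real (1 + m)) ^ n)" for n and m :: real
  have le: "norm (z / of_real (1 + m)) \<le> norm z" if "m > 0" for m :: real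
  proof -
    have "norm z / (1 + m) \<le> norm z / 1" using that by (intro divide_left_mono) auto
    moreover have "norm (complex_of_real (1 + m)) = 1 + m" using that by (simp only: norm_of_real)
    ultimately show ?thesis by (simp only: norm_divide div_by_1)
  qed
  \<comment> \<open>Convergence of the binomial series at a point strictly between |z| and 1 gives
    absolute summability at \<open>z\<close>.\<close>
  define \<rho> where "\<rho> = (1 + norm z) / 2"
  have \<rho>: "norm z < \<rho>" "\<rho> < 1" using z by (auto simp: \<rho>_def)
  have "\<rho> > 0" using \<rho> norm_ge_zero[of z] by linarith
  hence "norm (complex_of_real \<rho>) < 1" using \<rho> by simp
  from sums_summable[OF binomial_series_powr[OF this]]
  have "summable (\<lambda>n. c n * complex_of_real \<rho> ^ n)" by (simp add: c_def)
  from powser_insidea[OF this, of z] \<rho> \<open>\<rho> > 0\<close> have cs: "summable (\<lambda>n. norm (c n * z ^ n))" by simp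
  have f_eq: "f n = (\<lambda>m. c n * z ^ n * (euler_weight q r m * (1 / of_real (1 + m)) ^ n))" for n
    by (simp add: f_def power_divide fun_eq_iff)
  have f_le: "norm (f n m) \<le> norm (c n * z ^ n) * norm (euler_weight q r m)" if "m > 0" for n m
    using power_mono[OF le[OF that] norm_ge_zero, of n]
    by (simp add: f_def norm_mult norm_power mult_left_mono mult.commute[of "norm (euler_weight q r m)"] mult_right_mono)
  have f_meas: "f n \<in> borel_measurable lpos" for n
  proof -
    have "(\<lambda>m. c n * (z / of_real (1 + m)) ^ n) \<in> borel_measurable lpos" by (rule lpos_measurable) measurable
    thus ?thesis unfolding f_def by measurable
  qed
  have gi: "integrable lpos (\<lambda>m. norm (c n * z ^ n) * norm (euler_weight q r m))" for n
    by (intro integrable_mult_right integrable_norm euler_weight_integrable q rq)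
  have f_int: "integrable lpos (f n)" for n
    by (rule Bochner_Integration.integrable_bound[OF gi[of n] f_meas]) (use f_le in auto)
  have f_sums: "(\<lambda>n. f n m) sums (euler_weight q r m * (1 - z / of_real (1 + m)) powr (- p))" if "m > 0" for m
    unfolding f_def c_def using le[OF that] z by (intro sums_mult binomial_series_powr) auto
  have "(\<lambda>n. \<integral>m. f n m \<partial>lpos) sums (\<integral>m. (\<Sum>n. f n m) \<partial>lpos)"
  proof (rule sums_integral)
    show "AE m in lpos. summable (\<lambda>n. norm (f n m))"
    proof (rule AE_I2)
      fix m assume "m \<in> space lpos"
      thus "summable (\<lambda>n. norm (f n m))" using f_le
        by (intro summable_comparison_test'[OF summable_mult2[OF cs], where N = 0]) auto
    qed
    show "summable (\<lambda>n. \<integral>m. norm (f n m) \<partial>lpos)"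
    proof (rule summable_comparison_test'[OF summable_mult2[OF cs], where N = 0])
      fix n
      have "(\<integral>m. norm (f n m) \<partial>lpos) \<le> (\<integral>m. norm (c n * z ^ n) * norm (euler_weight q r m) \<partial>lpos)"
        by (intro integral_mono integrable_norm f_int gi f_le) auto
      thus "norm (\<integral>m. norm (f n m) \<partial>lpos) \<le> norm (c n * z ^ n) * (\<integral>m. norm (euler_weight q r m) \<partial>lpos)"
        by simp
    qed
  qed (rule f_int)
  also have "(\<integral>m. (\<Sum>n. f n m) \<partial>lpos) = (\<integral>m. euler_weight q r m * (1 - z / of_real (1 + m)) powr (- p) \<partial>lpos)"
    using f_sums by (intro Bochner_Integration.integral_cong) (auto simp: sums_iff)
  finally have s: "(\<lambda>n. Gamma r / (Gamma q * Gamma (r - q)) * (\<integral>m. f n m \<partial>lpos)) sums euler_2F1 p q r z"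
    unfolding euler_2F1_def by (rule sums_mult)
  have nz: "q \<notin> \<int>\<^sub>\<le>\<^sub>0" "r \<notin> \<int>\<^sub>\<le>\<^sub>0" "r - q \<notin> \<int>\<^sub>\<le>\<^sub>0" using q rq by (auto intro!: not_nonpos_Int_Re_pos)
  have G: "Gamma q \<noteq> 0" "Gamma r \<noteq> 0" "Gamma (r - q) \<noteq> 0" using nz by (auto simp: Gamma_eq_zero_iff)
  have rn: "Gamma (r + of_nat n) \<noteq> 0" for n
    using q rq by (subst Gamma_eq_zero_iff) (auto intro!: not_nonpos_Int_Re_pos add_pos_nonneg)
  have "Gamma r / (Gamma q * Gamma (r - q)) * (\<integral>m. f n m \<partial>lpos) 
      = pochhammer p n * pochhammer q n / (pochhammer r n * fact n) * z ^ n" for n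
    unfolding f_eq integral_mult_right_zero euler_weight_moment[OF q rq] pochhammer_Gamma[OF nz(1)] pochhammer_Gamma[OF nz(2)]
    using G rn[of n] by (simp add: c_def field_simps)
  with s show ?thesis by simp
qed

lemma euler_2F1_is_hyp2F1:
  "Re q > 0 \<Longrightarrow> Re (r - q) > 0 \<Longrightarrow> is_hyp2F1 p q r (euler_2F1 p q r)"
  unfolding is_hyp2F1_def hyp2F1_series using euler_2F1_holomorphic euler_2F1_series by (auto simp: sums_iff)

text \<open>Euler's integral is a witness for the choice in the definition; by uniqueness of the
  continuation the chosen function can then be computed by that integral off the slit.\<close>

lemma hyp2F1_is_hyp2F1:
  "Re q > 0 \<Longrightarrow> Re (r - q) > 0 \<Longrightarrow> is_hyp2F1 p q r (hyp2F1 p q r)"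
  unfolding hyp2F1_def by (rule someI[of "is_hyp2F1 p q r", OF euler_2F1_is_hyp2F1])

text \<open>Reflecting a continuation in the real axis gives the continuation for the conjugate
  parameters, whose series is symmetric in the upper two. Interchanging these makes both sides the
  same function when p and q are conjugate and r is real, so the kernel is real.\<close>

lemma cnj_hyp2F1:
  assumes "Re p > 0" "Re q > 0" "Re (r - p) > 0" "Re (r - q) > 0" "z \<notin> complex_of_real ` {1..}"
  shows "cnj (hyp2F1 p q r (cnj z)) = hyp2F1 (cnj q) (cnj p) (cnj r) z"
proof -
  have slit: "cnj ` (- (complex_of_real ` {1..})) = - (complex_of_real ` {1..})"
  proof -
    have c: "cnj x \<in> complex_of_real ` {1..} \<longleftrightarrow> x \<in> complex_of_real ` {1..}" for x
      by (auto simp: image_iff complex_eq_iff)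
    show ?thesis
    proof (intro equalityI subsetI)
      fix x assume "x \<in> - (complex_of_real ` {1..})"
      hence "cnj x \<in> - (complex_of_real ` {1..})" by (simp only: Compl_iff c not_False_eq_True)
      hence "cnj (cnj x) \<in> cnj ` (- (complex_of_real ` {1..}))" by (rule imageI)
      thus "x \<in> cnj ` (- (complex_of_real ` {1..}))" by (simp only: complex_cnj_cnj)
    next
      fix x assume "x \<in> cnj ` (- (complex_of_real ` {1..}))"
      then obtain y where "x = cnj y" "y \<in> - (complex_of_real ` {1..})" by (rule imageE)
      thus "x \<in> - (complex_of_real ` {1..})" by (simp only: Compl_iff c not_False_eq_True)
    qed
  qed
  note F = hyp2F1_is_hyp2F1[OF assms(2,4), of p]
  have "is_hyp2F1 (cnj q) (cnj p) (cnj r) (cnj \<circ> hyp2F1 p q r \<circ> cnj)"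
    unfolding is_hyp2F1_def
  proof
    show "cnj \<circ> hyp2F1 p q r \<circ> cnj holomorphic_on - complex_of_real ` {1..}"
      by (rule holomorphic_on_compose_cnj_cnj[OF _ open_slit]) (use F slit in \<open>auto simp: is_hyp2F1_def\<close>)
    show "\<forall>z\<in>ball 0 1. (cnj \<circ> hyp2F1 p q r \<circ> cnj) z = eval_fps (fps_hypergeo [cnj q, cnj p] [cnj r] 1) z"
    proof
      fix z :: complex assume z: "z \<in> ball 0 1"
      have cp: "cnj (pochhammer x n) = pochhammer (cnj x) n" for x n
        by (simp add: pochhammer_prod)
      from z have "(cnj \<circ> hyp2F1 p q r \<circ> cnj) z = cnj (eval_fps (fps_hypergeo [p, q] [r] 1) (cnj z))"
        using F by (simp add: is_hyp2F1_def)
      also have "\<dots> = eval_fps (fps_hypergeo [cnj q, cnj p] [cnj r] 1) z"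
      proof -
        define f where "f n = pochhammer p n * pochhammer q n / (pochhammer r n * fact n) * cnj z ^ n" for n
        have "f sums euler_2F1 p q r (cnj z)"
          unfolding f_def using assms z by (intro euler_2F1_series) auto
        hence A: "(\<Sum>n. cnj (f n)) = cnj (suminf f)"
          using sums_cnj[of f "suminf f"] by (simp add: sums_iff)
        have B: "cnj (f n) = pochhammer (cnj q) n * pochhammer (cnj p) n / (pochhammer (cnj r) n * fact n) * z ^ n" for n
          by (simp add: f_def cp mult_ac)
        have "cnj (eval_fps (fps_hypergeo [p, q] [r] 1) (cnj z)) = cnj (suminf f)"
          unfolding hyp2F1_series f_def ..
        also have "\<dots> = eval_fps (fps_hypergeo [cnj q, cnj p] [cnj r] 1) z"
          unfolding A[symmetric] B hyp2F1_series ..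
        finally show ?thesis .
      qed
      finally show "(cnj \<circ> hyp2F1 p q r \<circ> cnj) z = eval_fps (fps_hypergeo [cnj q, cnj p] [cnj r] 1) z" .
    qed
  qed
  from is_hyp2F1_unique[OF this hyp2F1_is_hyp2F1 assms(5)] assms show ?thesis by simp
qed

text \<open>Euler's prefactor Gamma(r) / (Gamma(q) Gamma(r-q)) at q = b - is and r = b + c.\<close>

definition kernel_coeff :: "real \<Rightarrow> real \<Rightarrow> real \<Rightarrow> complex" where
  "kernel_coeff b c s = Gamma (of_real (b + c)) / (Gamma (of_real b - \<i> * of_real s) * Gamma (of_real c + \<i> * of_real s))"

definition kernel_integrand :: "real \<Rightarrow> real \<Rightarrow> real \<Rightarrow> real \<Rightarrow> real \<Rightarrow> complex" where
  "kernel_integrand b c s x m = cpow m (of_real c + \<i> * of_real s - 1) * cpow (1 + m) (- of_real (b + c)) 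
     * cpow (1 + x / (1 + m)) (- (of_real b + \<i> * of_real s))"

lemma index_kernel_eq:
  assumes "b > 0" "c > 0" "x \<ge> 0"
  shows "index_kernel b c s x = kernel_coeff b c s * (\<integral>m. kernel_integrand b c s x m \<partial>lpos)"
proof -
  let ?p = "of_real b + \<i> * of_real s" and ?q = "of_real b - \<i> * of_real s" and ?r = "complex_of_real (b + c)"
  have R: "Re ?q > 0" "Re (?r - ?q) > 0" using assms by auto
  have "of_real (- x) \<notin> complex_of_real ` {1..}" using assms(3) by (auto simp: image_iff)
  from is_hyp2F1_unique[OF hyp2F1_is_hyp2F1[OF R] euler_2F1_is_hyp2F1[OF R] this]
  have "index_kernel b c s x = euler_2F1 ?p ?q ?r (of_real (- x))" by (simp add: index_kernel_def)
  also have "\<dots> = kernel_coeff b c s * (\<integral>m. kernel_integrand b c s x m \<partial>lpos)"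
  proof -
    have "euler_weight ?q ?r m * (1 - of_real (- x) / of_real (1 + m)) powr (- ?p) = kernel_integrand b c s x m" 
      if "m > 0" for m
    proof -
      have pos: "1 + x / (1 + m) > 0" using that assms by (auto intro!: add_pos_nonneg)
      have "1 - of_real (- x) / of_real (1 + m) = complex_of_real (1 + x / (1 + m))" by simp
      moreover have "complex_of_real (1 + x / (1 + m)) powr (- ?p) = cpow (1 + x / (1 + m)) (- ?p)"
        by (rule of_real_powr_cpow[OF pos])
      ultimately show ?thesis by (simp add: kernel_integrand_def euler_weight_def)
    qed
    hence "(\<integral>m. euler_weight ?q ?r m * (1 - of_real (- x) / of_real (1 + m)) powr (- ?p) \<partial>lpos) = 
       (\<integral>m. kernel_integrand b c s x m \<partial>lpos)"
      by (intro Bochner_Integration.integral_cong) auto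
    thus ?thesis unfolding euler_2F1_def kernel_coeff_def by simp
  qed
  finally show ?thesis .
qed

lemma cnj_index_kernel:
  assumes "b > 0" "c > 0" "x \<ge> 0"
  shows "cnj (index_kernel b c s x) = index_kernel b c s x"
proof -
  have "of_real (- x) \<notin> complex_of_real ` {1..}" using assms(3) by (auto simp: image_iff)
  from cnj_hyp2F1[OF _ _ _ _ this, of "of_real b + \<i> * of_real s" "of_real b - \<i> * of_real s" "of_real (b + c)"] assms
  show ?thesis by (simp add: index_kernel_def)
qed

lemma kernel_integrand_norm_le:
  assumes "b > 0" "c > 0" "x \<ge> 0" "m > 0"
  shows "norm (kernel_integrand b c s x m) \<le> norm (cpow m (of_real c - 1) * cpow (1 + m) (- of_real (b + c)))"
proof -
  have pos: "1 + x / (1 + m) > 0" "1 + x / (1 + m) \<ge> 1" using assms by (auto intro!: add_pos_nonneg)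
  have "(1 + x / (1 + m)) powr (- b) \<le> (1 + x / (1 + m)) powr 0" 
    by (rule powr_mono) (use pos assms in auto)
  hence "(1 + x / (1 + m)) powr (- b) \<le> 1" using pos by simp
  hence "norm (cpow (1 + x / (1 + m)) (- (of_real b + \<i> * of_real s))) \<le> 1"
    by (subst norm_cpow[OF pos(1)]) simp
  hence "norm (cpow m (of_real c - 1) * cpow (1 + m) (- of_real (b + c))) * 
     norm (cpow (1 + x / (1 + m)) (- (of_real b + \<i> * of_real s))) 
     \<le> norm (cpow m (of_real c - 1) * cpow (1 + m) (- of_real (b + c))) * 1"
    by (rule mult_left_mono) simp
  moreover have "norm (cpow m (of_real c + \<i> * of_real s - 1)) = norm (cpow m (of_real c - 1))"
    by (simp add: norm_cpow[OF assms(4)])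
  ultimately show ?thesis by (simp only: kernel_integrand_def norm_mult mult_1_right)
qed

text \<open>In Euler's integral the factor containing \<open>x\<close> has modulus at most 1, its
  base being at least 1 and the real part of its exponent -b. What remains is a Beta integral, so
  the bound is uniform in \<open>x\<close>.\<close>

lemma index_kernel_bound:
  assumes "b > 0" "c > 0" "x \<ge> 0"
  shows "norm (index_kernel b c s x) \<le> norm (kernel_coeff b c s) * (Gamma b * Gamma c / Gamma (b + c))"
proof -
  let ?g = "\<lambda>m. cpow m (of_real c - 1) * cpow (1 + m) (- (of_real c + of_real b))"
  have B: "integrable lpos ?g" "(\<integral>m. ?g m \<partial>lpos) = Gamma (of_real c) * Gamma (of_real b) / Gamma (of_real c + of_real b)"
    using assms by (intro lpos_Beta; simp)+
  have nB: "complex_of_real (norm (?g m)) = ?g m" if "m > 0" for m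
    using that by (simp add: norm_mult of_real_norm_cpow)
  have "norm (\<integral>m. kernel_integrand b c s x m \<partial>lpos) \<le> (\<integral>m. norm (?g m) \<partial>lpos)"
  proof (cases "integrable lpos (kernel_integrand b c s x)")
    case True
    have "norm (\<integral>m. kernel_integrand b c s x m \<partial>lpos) \<le> (\<integral>m. norm (kernel_integrand b c s x m) \<partial>lpos)"
      by (rule integral_norm_bound)
    also have "\<dots> \<le> (\<integral>m. norm (?g m) \<partial>lpos)"
      by (intro integral_mono integrable_norm True B) 
         (use kernel_integrand_norm_le[OF assms] in \<open>auto simp: add.commute\<close>)
    finally show ?thesis .
  qed (auto simp: not_integrable_integral_eq)
  also have "complex_of_real (\<integral>m. norm (?g m) \<partial>lpos) = (\<integral>m. complex_of_real (norm (?g m)) \<partial>lpos)"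
    by (rule integral_complex_of_real[symmetric])
  hence "complex_of_real (\<integral>m. norm (?g m) \<partial>lpos) = (\<integral>m. ?g m \<partial>lpos)"
    by (subst (asm) Bochner_Integration.integral_cong[OF refl nB]) auto
  hence "(\<integral>m. norm (?g m) \<partial>lpos) = Gamma b * Gamma c / Gamma (b + c)"
    unfolding B(2) by (simp add: Gamma_complex_of_real mult_ac add_ac flip: of_real_add of_real_mult of_real_divide)
  finally show ?thesis unfolding index_kernel_eq[OF assms] norm_mult by (intro mult_left_mono) auto
qed

section \<open>Transforms of powers\<close>

lemma lpos_Beta_affine:
  assumes \<alpha>: "Re \<alpha> > 0" and \<sigma>: "Re (\<sigma> - \<alpha>) > 0" and y: "y > 0"
  shows "integrable lpos (\<lambda>m. cpow m (\<alpha> - 1) * cpow (1 + y + y * m) (- \<sigma>))" (is ?A)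
    "(\<integral>m. cpow m (\<alpha> - 1) * cpow (1 + y + y * m) (- \<sigma>) \<partial>lpos) 
     = cpow y (- \<alpha>) * cpow (1 + y) (\<alpha> - \<sigma>) * (Gamma \<alpha> * Gamma (\<sigma> - \<alpha>) / Gamma \<sigma>)" (is ?B)
proof -
  \<comment> \<open>Under m = c n the factor 1 + y + y m becomes (1+y)(1+n), which leaves a standard
    Beta integral.\<close>
  define c where "c = (1 + y) / y"
  have c: "c > 0" using y by (auto simp: c_def intro!: divide_pos_pos)
  define f where "f m = cpow m (\<alpha> - 1) * cpow (1 + y + y * m) (- \<sigma>)" for m
  define g where "g n = cpow n (\<alpha> - 1) * cpow (1 + n) (- (\<alpha> + (\<sigma> - \<alpha>)))" for n
  have f: "f (c * n) = (cpow c (\<alpha> - 1) * cpow (1 + y) (- \<sigma>)) * g n" if "n \<in> space lpos" for n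
  proof -
    have "1 + y + y * (c * n) = (1 + y) * (1 + n)" using y by (simp add: c_def field_simps)
    thus ?thesis using that c y by (simp add: f_def g_def cpow_mult)
  qed
  have g: "integrable lpos g" "(\<integral>n. g n \<partial>lpos) = Gamma \<alpha> * Gamma (\<sigma> - \<alpha>) / Gamma (\<alpha> + (\<sigma> - \<alpha>))"
    unfolding g_def[abs_def] by (rule lpos_Beta[OF \<alpha> \<sigma>])+
  have "integrable lpos (\<lambda>n. f (c * n))"
    by (subst Bochner_Integration.integrable_cong[OF refl f]) (auto intro: integrable_mult_right g)
  thus ?A unfolding lpos_scale_integrable[OF c] by (simp add: f_def[abs_def])
  have "(\<integral>m. f m \<partial>lpos) = c *\<^sub>R (\<integral>n. f (c * n) \<partial>lpos)" by (rule lpos_scale_integral[OF c])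
  also have "(\<integral>n. f (c * n) \<partial>lpos) = (\<integral>n. (cpow c (\<alpha> - 1) * cpow (1 + y) (- \<sigma>)) * g n \<partial>lpos)"
    by (rule Bochner_Integration.integral_cong[OF refl f])
  also have "\<dots> = cpow c (\<alpha> - 1) * cpow (1 + y) (- \<sigma>) * (Gamma \<alpha> * Gamma (\<sigma> - \<alpha>) / Gamma \<sigma>)"
    using g(2) by simp
  also have "c *\<^sub>R \<dots> = (of_real c * cpow c (\<alpha> - 1)) * cpow (1 + y) (- \<sigma>) * (Gamma \<alpha> * Gamma (\<sigma> - \<alpha>) / Gamma \<sigma>)"
    by (simp add: scaleR_conv_of_real mult.assoc)
  also have "of_real c * cpow c (\<alpha> - 1) = cpow c \<alpha>" using c by (simp add: cpow_diff)
  also have "cpow c \<alpha> = cpow (1 + y) \<alpha> * cpow y (- \<alpha>)" 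
    unfolding c_def cpow_minus using y by (subst cpow_divide) (auto simp: divide_inverse)
  also have "cpow (1 + y) \<alpha> * cpow y (- \<alpha>) * cpow (1 + y) (- \<sigma>) = cpow y (- \<alpha>) * (cpow (1 + y) \<alpha> * cpow (1 + y) (- \<sigma>))"
    by (simp only: mult_ac)
  also have "cpow (1 + y) \<alpha> * cpow (1 + y) (- \<sigma>) = cpow (1 + y) (\<alpha> - \<sigma>)" by (simp flip: cpow_add)
  finally show ?B by (simp add: f_def)
qed

lemma integrable_lpos_product:
  fixes f g :: "real \<Rightarrow> complex"
  assumes "integrable lpos f" "integrable lpos g"
  shows "integrable (lpos \<Otimes>\<^sub>M lpos) (\<lambda>(x, m). f x * g m)"
proof (rule lpos2.Fubini_integrable)
  note [measurable] = borel_measurable_integrable[OF assms(1)] borel_measurable_integrable[OF assms(2)]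
  show "(\<lambda>(x, m). f x * g m) \<in> borel_measurable (lpos \<Otimes>\<^sub>M lpos)" by measurable
  have "integrable lpos (\<lambda>x. norm (f x) * (\<integral>m. norm (g m) \<partial>lpos))"
    by (intro integrable_mult_left integrable_norm assms)
  thus "integrable lpos (\<lambda>x. \<integral>y. norm (case (x, y) of (x, m) \<Rightarrow> f x * g m) \<partial>lpos)" 
    by (simp add: norm_mult)
  show "AE x in lpos. integrable lpos (\<lambda>y. case (x, y) of (x, m) \<Rightarrow> f x * g m)"
    by (intro AE_I2) (simp add: integrable_mult_right assms)
qed

text \<open>After \<open>x = y (1+m)\<close> the double integral becomes an iterated Beta integral.\<close>

lemma euler_beta_integral:
  assumes p: "Re p \<ge> 0" and q: "Re q > 0" and rq: "Re (r - q) > 0" and \<sigma>: "Re \<sigma> > Re r"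
  shows "(\<integral>x. cpow x (r - 1) * cpow (1 + x) (- \<sigma>) * (\<integral>m. euler_weight q r m * cpow (1 + x / (1 + m)) (- p) \<partial>lpos) \<partial>lpos) = 
    Gamma (r - q) * Gamma (\<sigma> - r + q) / Gamma \<sigma> * (Gamma q * Gamma (\<sigma> + p - r) / Gamma (\<sigma> + p + q - r))"
proof -
  have [measurable]: "fst \<in> borel_measurable (lpos \<Otimes>\<^sub>M lpos)" "snd \<in> borel_measurable (lpos \<Otimes>\<^sub>M lpos)"
    using measurable_compose[OF measurable_fst lpos_measurable[of "\<lambda>x. x"]]
      measurable_compose[OF measurable_snd lpos_measurable[of "\<lambda>x. x"]] by auto
  define u where "u x = cpow x (r - 1) * cpow (1 + x) (- (r + (\<sigma> - r)))" for x
  define F where "F x m = u x * euler_weight q r m * cpow (1 + x / (1 + m)) (- p)" for x m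
  have u_int: "integrable lpos u" unfolding u_def[abs_def] 
    using q rq \<sigma> by (intro lpos_Beta) auto
  have F_int: "integrable (lpos \<Otimes>\<^sub>M lpos) (case_prod F)"
  proof (rule Bochner_Integration.integrable_bound[OF integrable_lpos_product[OF u_int euler_weight_integrable[OF q rq]]])
    show "case_prod F \<in> borel_measurable (lpos \<Otimes>\<^sub>M lpos)"
      unfolding F_def u_def euler_weight_def split_beta' by measurable
    show "AE z in lpos \<Otimes>\<^sub>M lpos. norm (case_prod F z) \<le> norm (case z of (x, m) \<Rightarrow> u x * euler_weight q r m)"
    proof (rule AE_I2)
      fix z assume "z \<in> space (lpos \<Otimes>\<^sub>M lpos)"
      then obtain x m where z: "z = (x, m)" "x > 0" "m > 0" by (auto simp: space_pair_measure)
      have pos: "1 + x / (1 + m) > 0" "1 + x / (1 + m) \<ge> 1" using z by (auto intro!: add_pos_nonneg)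
      have "(1 + x / (1 + m)) powr (- Re p) \<le> (1 + x / (1 + m)) powr 0" 
        by (rule powr_mono) (use pos p in auto)
      hence "norm (cpow (1 + x / (1 + m)) (- p)) \<le> 1" using pos by (subst norm_cpow[OF pos(1)]) simp
      thus "norm (case_prod F z) \<le> norm (case z of (x, m) \<Rightarrow> u x * euler_weight q r m)"
        using z by (simp add: F_def norm_mult mult_left_le)
    qed
  qed
  define \<Psi> where "\<Psi> p q r \<sigma> y m = cpow y (r - 1) * cpow (1 + y) (- p) * (cpow m (r - q - 1) * cpow (1 + y + y * m) (- \<sigma>))" 
    for p q r \<sigma> :: complex and y m :: real
  \<comment> \<open>The substitution x = (1+m) y is made at fixed \<open>m\<close>. Fubini is
    therefore needed twice, for (x,m) before it and for (y,m) after it.\<close>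
  have Fscale: "(\<integral>x. F x m \<partial>lpos) = (\<integral>y. \<Psi> p q r \<sigma> y m \<partial>lpos)" if "m > 0" for m
  proof -
    have c: "1 + m > 0" using that by simp
    have "(\<integral>x. F x m \<partial>lpos) = (1 + m) *\<^sub>R (\<integral>y. F ((1 + m) * y) m \<partial>lpos)" by (rule lpos_scale_integral[OF c])
    also have "\<dots> = (\<integral>y. (1 + m) *\<^sub>R F ((1 + m) * y) m \<partial>lpos)" by simp
    also have "\<dots> = (\<integral>y. \<Psi> p q r \<sigma> y m \<partial>lpos)"
    proof (rule Bochner_Integration.integral_cong[OF refl])
      fix y assume y: "y \<in> space lpos"
      have e: "(1 + m) * y / (1 + m) = y" "1 + (1 + m) * y = 1 + y + y * m" using c by (simp, simp add: algebra_simps)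
      have "of_real (1 + m) * cpow (1 + m) (r - 1) * cpow (1 + m) (- r) = 1"
      proof -
        have "complex_of_real (1 + m) \<noteq> 0" using c by (simp only: of_real_eq_0_iff)
        thus ?thesis using c by (simp add: cpow_diff cpow_minus del: of_real_add)
      qed
      note one = this
      have "of_real (1 + m) * (cpow (1 + m) (r - 1) * cpow y (r - 1) * C * (A * cpow (1 + m) (- r)) * B) = cpow y (r - 1) * B * (A * C)" for A B C
      proof -
        have "of_real (1 + m) * (cpow (1 + m) (r - 1) * cpow y (r - 1) * C * (A * cpow (1 + m) (- r)) * B)
           = (of_real (1 + m) * cpow (1 + m) (r - 1) * cpow (1 + m) (- r)) * (cpow y (r - 1) * B * (A * C))"
          by (simp only: mult_ac)
        thus ?thesis unfolding one by simp
      qed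
      note ABC = this
      have "r + (\<sigma> - r) = \<sigma>" by simp
      moreover have "cpow ((1 + m) * y) (r - 1) = cpow (1 + m) (r - 1) * cpow y (r - 1)"
        using c y by (intro cpow_mult) auto
      ultimately show "(1 + m) *\<^sub>R F ((1 + m) * y) m = \<Psi> p q r \<sigma> y m"
        unfolding F_def u_def euler_weight_def \<Psi>_def e scaleR_conv_of_real by (simp only: ABC)
    qed
    finally show ?thesis .
  qed
  have \<Psi>_m: "integrable lpos (\<Psi> p q r \<sigma> y)" 
     "(\<integral>m. \<Psi> p q r \<sigma> y m \<partial>lpos) = Gamma (r - q) * Gamma (\<sigma> - r + q) / Gamma \<sigma> * (cpow y (q - 1) * cpow (1 + y) (- (q + (\<sigma> + p - r))))"
    if "Re q > 0" "Re (r - q) > 0" "Re \<sigma> > Re r" "y > 0" for p q r \<sigma> y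
  proof -
    have R: "Re (r - q) > 0" "Re (\<sigma> - (r - q)) > 0" using that by auto
    note B = lpos_Beta_affine[OF R that(4)]
    show "integrable lpos (\<Psi> p q r \<sigma> y)" unfolding \<Psi>_def[abs_def] by (intro integrable_mult_right B)
    have e1: "cpow y (r - 1) * cpow y (- (r - q)) = cpow y (q - 1)" by (simp flip: cpow_add)
    have e2: "cpow (1 + y) (- p) * cpow (1 + y) (r - q - \<sigma>) = cpow (1 + y) (- (q + (\<sigma> + p - r)))" 
      by (simp add: algebra_simps flip: cpow_add)
    have e3: "\<sigma> - (r - q) = \<sigma> - r + q" by simp
    have "(\<integral>m. \<Psi> p q r \<sigma> y m \<partial>lpos) = (cpow y (r - 1) * cpow y (- (r - q))) * (cpow (1 + y) (- p) * cpow (1 + y) (r - q - \<sigma>)) 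
       * (Gamma (r - q) * Gamma (\<sigma> - (r - q)) / Gamma \<sigma>)"
      unfolding \<Psi>_def integral_mult_right_zero B(2) by (simp only: mult_ac)
    thus "(\<integral>m. \<Psi> p q r \<sigma> y m \<partial>lpos) = Gamma (r - q) * Gamma (\<sigma> - r + q) / Gamma \<sigma> * (cpow y (q - 1) * cpow (1 + y) (- (q + (\<sigma> + p - r))))"
      unfolding e1 e2 e3 by (simp only: mult_ac)
  qed
  have \<Psi>_int: "integrable (lpos \<Otimes>\<^sub>M lpos) (case_prod (\<Psi> p q r \<sigma>))"
  proof (rule lpos2.Fubini_integrable)
    show "case_prod (\<Psi> p q r \<sigma>) \<in> borel_measurable (lpos \<Otimes>\<^sub>M lpos)"
      unfolding \<Psi>_def split_beta' by measurable
    show "AE x in lpos. integrable lpos (\<lambda>y. case_prod (\<Psi> p q r \<sigma>) (x, y))"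
      using \<Psi>_m(1)[OF q rq \<sigma>] by (intro AE_I2) simp
    \<comment> \<open>The inner formula was proved for arbitrary parameters so that it can be used
      again at the real parts, where it evaluates the integral of the norms.\<close>
    let ?p = "complex_of_real (Re p)" and ?q = "complex_of_real (Re q)" and ?r = "complex_of_real (Re r)" and ?s = "complex_of_real (Re \<sigma>)"
    have "complex_of_real (\<integral>m. norm (\<Psi> p q r \<sigma> y m) \<partial>lpos) = 
       Gamma (?r - ?q) * Gamma (?s - ?r + ?q) / Gamma ?s * (cpow y (?q - 1) * cpow (1 + y) (- (?q + (?s + ?p - ?r))))" if "y > 0" for y
    proof -
      have n: "complex_of_real (norm (\<Psi> p q r \<sigma> y m)) = \<Psi> ?p ?q ?r ?s y m" if "m \<in> space lpos" for m
      proof -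
        have "1 + y > 0" "1 + y + y * m > 0" using that \<open>y > 0\<close> by (auto intro!: add_pos_nonneg)
        thus ?thesis using that \<open>y > 0\<close> by (simp add: \<Psi>_def norm_mult of_real_norm_cpow)
      qed
      have "complex_of_real (\<integral>m. norm (\<Psi> p q r \<sigma> y m) \<partial>lpos) = (\<integral>m. complex_of_real (norm (\<Psi> p q r \<sigma> y m)) \<partial>lpos)"
        by (rule integral_complex_of_real[symmetric])
      also have "\<dots> = (\<integral>m. \<Psi> ?p ?q ?r ?s y m \<partial>lpos)"
        by (rule Bochner_Integration.integral_cong[OF refl n])
      finally show ?thesis using \<Psi>_m(2)[of ?q ?r ?s y ?p] q rq \<sigma> that by simp
    qed
    hence "integrable lpos (\<lambda>y. complex_of_real (\<integral>m. norm (\<Psi> p q r \<sigma> y m) \<partial>lpos)) \<longleftrightarrow> integrable lpos (\<lambda>y. 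
       Gamma (?r - ?q) * Gamma (?s - ?r + ?q) / Gamma ?s * (cpow y (?q - 1) * cpow (1 + y) (- (?q + (?s + ?p - ?r)))))"
      by (intro Bochner_Integration.integrable_cong) auto
    moreover have "integrable lpos (\<lambda>y. 
       Gamma (?r - ?q) * Gamma (?s - ?r + ?q) / Gamma ?s * (cpow y (?q - 1) * cpow (1 + y) (- (?q + (?s + ?p - ?r)))))"
      using p q rq \<sigma> by (intro integrable_mult_right lpos_Beta) auto
    ultimately show "integrable lpos (\<lambda>x. \<integral>y. norm (case_prod (\<Psi> p q r \<sigma>) (x, y)) \<partial>lpos)"
      by (simp only: integrable_of_real_iff case_prod_conv)
  qed
  have "(\<integral>x. cpow x (r - 1) * cpow (1 + x) (- \<sigma>) * (\<integral>m. euler_weight q r m * cpow (1 + x / (1 + m)) (- p) \<partial>lpos) \<partial>lpos)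
     = (\<integral>x. \<integral>m. F x m \<partial>lpos \<partial>lpos)"
    by (simp add: F_def u_def mult.assoc)
  also have "\<dots> = (\<integral>m. \<integral>x. F x m \<partial>lpos \<partial>lpos)" by (rule lpos2.Fubini_integral[OF F_int, symmetric])
  also have "\<dots> = (\<integral>m. \<integral>y. \<Psi> p q r \<sigma> y m \<partial>lpos \<partial>lpos)" 
    by (rule Bochner_Integration.integral_cong[OF refl]) (simp add: Fscale)
  also have "\<dots> = (\<integral>y. \<integral>m. \<Psi> p q r \<sigma> y m \<partial>lpos \<partial>lpos)" by (rule lpos2.Fubini_integral[OF \<Psi>_int])
  also have "\<dots> = (\<integral>y. Gamma (r - q) * Gamma (\<sigma> - r + q) / Gamma \<sigma> * (cpow y (q - 1) * cpow (1 + y) (- (q + (\<sigma> + p - r)))) \<partial>lpos)"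
    by (rule Bochner_Integration.integral_cong[OF refl]) (simp add: \<Psi>_m(2)[OF q rq \<sigma>])
  also have "\<dots> = Gamma (r - q) * Gamma (\<sigma> - r + q) / Gamma \<sigma> * (Gamma q * Gamma (\<sigma> + p - r) / Gamma (q + (\<sigma> + p - r)))"
    unfolding integral_mult_right_zero using p q \<sigma> by (subst lpos_Beta(2)) auto
  also have "q + (\<sigma> + p - r) = \<sigma> + p + q - r" by simp
  finally show ?thesis .
qed

section \<open>Weighted half-lines and the Gamma integrals of both measures\<close>

definition halfline :: "(real \<Rightarrow> real) \<Rightarrow> real measure" where
  "halfline W = density (restrict_space lborel {0..}) (\<lambda>x. ennreal (W x))"

lemma space_halfline [simp]: "space (halfline W) = {0..}"
  by (simp add: halfline_def space_restrict_space)

lemma sets_halfline [measurable_cong]: "sets (halfline W) = sets (restrict_space borel {0..})"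
  by (simp add: halfline_def sets_restrict_space)

lemma halfline_measurable_iff:
  "f \<in> borel_measurable (halfline W) \<longleftrightarrow> (\<lambda>x. indicator {0..} x *\<^sub>R f x) \<in> borel_measurable (borel :: real measure)" 
  for f :: "real \<Rightarrow> 'a :: real_normed_vector"
  using borel_measurable_restrict_space_iff[of "{0..}" borel f] sets_halfline[of W]
  by (simp add: measurable_cong_sets[OF sets_halfline refl])

lemma halfline_measurable: "f \<in> borel_measurable borel \<Longrightarrow> f \<in> borel_measurable (halfline W)"
  by (simp add: measurable_cong_sets[OF sets_halfline refl] measurable_restrict_space1)

text \<open>The density becomes a factor and the endpoint 0 is a null set. This links the
  definitions, which use the closed half-line, with the Beta and Wilson integrals, which are
  available on the open one.\<close>

lemma halfline_integral:
  fixes f :: "real \<Rightarrow> complex"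
  assumes W: "W \<in> borel_measurable borel" "\<And>x. x \<ge> 0 \<Longrightarrow> W x \<ge> 0" and f: "f \<in> borel_measurable (halfline W)"
  shows "integrable (halfline W) f \<longleftrightarrow> set_integrable lborel {0..} (\<lambda>x. f x * of_real (W x))"
    and "(\<integral>x. f x \<partial>halfline W) = (LBINT x:{0..}. f x * of_real (W x))"
    and "set_integrable lborel {0..} (\<lambda>x. f x * of_real (W x)) \<longleftrightarrow> integrable lpos (\<lambda>x. f x * of_real (W x))"
    and "(LBINT x:{0..}. f x * of_real (W x)) = (\<integral>x. f x * of_real (W x) \<partial>lpos)"
proof -
  have sc: "W x *\<^sub>R f x = f x * of_real (W x)" for x by (simp add: scaleR_conv_of_real mult.commute)
  have fm: "f \<in> borel_measurable (restrict_space lborel {0..})"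
    using f by (simp add: halfline_def measurable_def)
  have Wm: "W \<in> borel_measurable (restrict_space lborel {0..})" 
    using W(1) by (intro measurable_restrict_space1) simp
  have Wn: "AE x in restrict_space lborel {0..}. 0 \<le> W x" 
    using W(2) by (intro AE_I2) (simp add: space_restrict_space)
  show "integrable (halfline W) f \<longleftrightarrow> set_integrable lborel {0..} (\<lambda>x. f x * of_real (W x))"
    unfolding halfline_def integrable_density[OF fm Wm Wn] set_integrable_def sc
    by (simp add: integrable_restrict_space)
  show "(\<integral>x. f x \<partial>halfline W) = (LBINT x:{0..}. f x * of_real (W x))"
    unfolding halfline_def integral_density[OF fm Wm Wn] set_lebesgue_integral_def sc
    by (simp add: integral_restrict_space)
  have m: "(\<lambda>x. indicator {0..} x *\<^sub>R (f x * of_real (W x))) \<in> borel_measurable lborel"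
  proof -
    have "(\<lambda>x. (indicator {0..} x *\<^sub>R f x) * of_real (W x)) \<in> borel_measurable borel"
      using f W(1) unfolding halfline_measurable_iff by measurable
    thus ?thesis by simp
  qed
  have m': "(\<lambda>x. indicator {0<..} x *\<^sub>R (f x * of_real (W x))) \<in> borel_measurable lborel"
  proof -
    have "(\<lambda>x. indicator {0<..} x *\<^sub>R (indicator {0..} x *\<^sub>R (f x * of_real (W x)))) \<in> borel_measurable lborel"
      using m by measurable
    also have "(\<lambda>x. indicator {0<..} x *\<^sub>R (indicator {0..} x *\<^sub>R (f x * of_real (W x)))) 
      = (\<lambda>x. indicator {0<..} x *\<^sub>R (f x * of_real (W x)))"
      by (auto simp: indicator_def)
    finally show ?thesis .
  qed
  have ae: "AE x in lborel. indicator {0..} x *\<^sub>R (f x * of_real (W x)) = indicator {0<..} x *\<^sub>R (f x * of_real (W x))"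
    using AE_lborel_singleton[of "0::real"] by eventually_elim (auto simp: indicator_def)
  show "set_integrable lborel {0..} (\<lambda>x. f x * of_real (W x)) \<longleftrightarrow> integrable lpos (\<lambda>x. f x * of_real (W x))"
    unfolding set_integrable_def using integrable_cong_AE[OF m m' ae] by (simp add: integrable_restrict_space)
  show "(LBINT x:{0..}. f x * of_real (W x)) = (\<integral>x. f x * of_real (W x) \<partial>lpos)"
    unfolding set_lebesgue_integral_def using integral_cong_AE[OF m m' ae] by (simp add: integral_restrict_space)
qed

lemma halfline_sigma_finite: 
  assumes "W \<in> borel_measurable borel"
  shows "sigma_finite_measure (halfline W)"
proof -
  interpret R: sigma_finite_measure "restrict_space lborel {0::real..}"
    by (rule sigma_finite_measure_restrict_space) (auto intro: sigma_finite_lborel)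
  have "(\<lambda>x. ennreal (W x)) \<in> borel_measurable (restrict_space lborel {0..})"
    using assms by (intro measurable_restrict_space1) simp
  from R.sigma_finite_iff_density_finite[OF this] show ?thesis unfolding halfline_def by simp
qed

lemma source_measure_halfline: "source_measure b c = halfline (source_weight b c)"
  by (simp add: source_measure_def halfline_def)

lemma spectral_measure_halfline: "spectral_measure b c = halfline (spectral_weight b c)"
  by (simp add: spectral_measure_def halfline_def)

lemma source_weight_measurable [measurable]: "source_weight b c \<in> borel_measurable borel"
  unfolding source_weight_def by measurable

lemma source_weight_nonneg: "source_weight b c x \<ge> 0"
  by (simp add: source_weight_def)

lemma source_weight_cpow:
  "x > 0 \<Longrightarrow> of_real (source_weight b c x) = cpow x (of_real (b + c) - 1) * cpow (1 + x) (of_real (b - c))"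
  using cpow_of_real[of x "b + c - 1"] cpow_of_real[of "1 + x" "b - c"] by (simp add: source_weight_def)

text \<open>The denominator is evaluated by |Gamma(1+2is)|^2 sinh(2 pi s) = 2 pi s and Gamma(1+2is)
  = 2is Gamma(2is).\<close>

lemma spectral_weight_eq:
  assumes "b > 0" "c > 0"
  shows "spectral_weight b c s = 2 / pi * (s * sinh (2 * pi * s)) * ((cmod (gam b s))\<^sup>2 * (cmod (gam c s))\<^sup>2)"
proof (cases "s = 0")
  case False
  have G: "gam 1 (2 * s) = (2 * \<i> * of_real s) * Gamma (2 * \<i> * of_real s)"
  proof -
    have "2 * \<i> * of_real s \<notin> \<int>\<^sub>\<le>\<^sub>0" using False by (auto simp: complex_eq_iff elim!: nonpos_Ints_cases)
    from Gamma_plus1[OF this] show ?thesis by (simp add: algebra_simps)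
  qed
  have nz: "sinh (2 * pi * s) \<noteq> 0" using False by simp
  have "(cmod (gam 1 (2 * s)))\<^sup>2 * sinh (2 * pi * s) = 2 * pi * s"
    using cmod_gam_1[of "2 * s"] by (simp add: mult_ac)
  moreover have "(cmod (gam 1 (2 * s)))\<^sup>2 = 4 * s\<^sup>2 * (cmod (Gamma (2 * \<i> * of_real s)))\<^sup>2"
    unfolding G by (simp add: norm_mult power_mult_distrib)
  ultimately have "2 * s * (cmod (Gamma (2 * \<i> * of_real s)))\<^sup>2 * sinh (2 * pi * s) = pi"
    using False by (simp add: power2_eq_square mult_ac)
  hence "(cmod (Gamma (2 * \<i> * of_real s)))\<^sup>2 = pi / (2 * s * sinh (2 * pi * s))"
    using nz False by (simp add: field_simps)
  thus ?thesis unfolding spectral_weight_def 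
    by (simp add: norm_divide norm_mult power_divide power_mult_distrib)
\<comment> \<open>At s = 0 the conventions Gamma 0 = 0 and z / 0 = 0 make the left side zero, in
  agreement with the right side.\<close>
qed (simp add: spectral_weight_def)

lemma spectral_weight_measurable: 
  assumes "b > 0" "c > 0" shows "spectral_weight b c \<in> borel_measurable borel"
proof -
  have "(\<lambda>s. 2 / pi * (s * sinh (2 * pi * s)) * ((cmod (gam b s))\<^sup>2 * (cmod (gam c s))\<^sup>2)) \<in> borel_measurable borel"
    using gam_measurable[OF assms(1)] gam_measurable[OF assms(2)] unfolding sinh_field_def by measurable
  thus ?thesis by (simp add: spectral_weight_eq[OF assms] cong: measurable_cong)
qed

lemma spectral_weight_nonneg: "spectral_weight b c x \<ge> 0"
  by (simp add: spectral_weight_def)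

lemma integral_even:
  fixes f :: "real \<Rightarrow> real"
  assumes "integrable lborel f" "\<And>x. f (- x) = f x"
  shows "integrable lpos f" "(\<integral>x. f x \<partial>lborel) = 2 * (\<integral>x. f x \<partial>lpos)"
proof -
  define g where "g x = indicator {0<..} x *\<^sub>R f x" for x
  have g: "integrable lborel g" unfolding g_def[abs_def] by (rule integrable_mult_indicator[OF _ assms(1)]) simp
  thus "integrable lpos f" unfolding g_def[abs_def] by (simp add: integrable_restrict_space)
  have g': "integrable lborel (\<lambda>x. g (- x))" "(\<integral>x. g (- x) \<partial>lborel) = (\<integral>x. g x \<partial>lborel)"
    using lborel_integrable_real_affine_iff[of "-1" g 0] lborel_integral_real_affine[of "-1" g 0] g by simp_all
  have "(\<integral>x. f x \<partial>lborel) = (\<integral>x. g x + g (- x) \<partial>lborel)"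
  proof (rule integral_cong_AE)
    show "AE x in lborel. f x = g x + g (- x)"
      using AE_lborel_singleton[of "0::real"] by eventually_elim (auto simp: g_def indicator_def assms(2))
  qed (use assms(1) g g' in auto)
  also have "\<dots> = 2 * (\<integral>x. g x \<partial>lborel)" using g g' by simp
  finally show "(\<integral>x. f x \<partial>lborel) = 2 * (\<integral>x. f x \<partial>lpos)" by (simp add: g_def integral_restrict_space)
qed

text \<open>Wilson's formula for the spectral measure: the factor 2/pi of the weight and the 1/2
  from evenness reduce 2 pi^2 to 2 pi.\<close>

lemma spectral_gamma_integral:
  assumes "a > 0" "d > 0" "b > 0" "c > 0"
  shows "integrable (spectral_measure b c) (\<lambda>s. complex_of_real ((cmod (gam a s))\<^sup>2 * (cmod (gam d s))\<^sup>2))"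
    "(\<integral>s. complex_of_real ((cmod (gam a s))\<^sup>2 * (cmod (gam d s))\<^sup>2) \<partial>spectral_measure b c) = of_real (2 * pi * wilson_prod a d b c)"
proof -
  let ?f = "\<lambda>s. complex_of_real ((cmod (gam a s))\<^sup>2 * (cmod (gam d s))\<^sup>2)"
  have fm: "?f \<in> borel_measurable (halfline (spectral_weight b c))"
    by (rule halfline_measurable) (use gam_measurable[OF assms(1)] gam_measurable[OF assms(2)] in measurable)
  note H = halfline_integral[OF spectral_weight_measurable[OF assms(3,4)] spectral_weight_nonneg fm]
  have eq: "?f s * of_real (spectral_weight b c s) = complex_of_real (2 / pi * wilson_weight a d b c s)" for s
    by (simp add: spectral_weight_eq[OF assms(3,4)] wilson_weight_def mult_ac)
  have ev: "wilson_weight a d b c (- s) = wilson_weight a d b c s" for s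
  proof -
    have "cmod (gam x (- s)) = cmod (gam x s)" for x
      using complex_mod_cnj[of "gam x s"] unfolding cnj_gam by simp
    thus ?thesis by (simp add: wilson_weight_def)
  qed
  note W = integral_even[OF wilson_weight_integrable[OF assms] ev]
  show "integrable (spectral_measure b c) ?f"
  proof -
    have "integrable lpos (\<lambda>s. ?f s * of_real (spectral_weight b c s))"
      unfolding eq integrable_of_real_iff using W(1) by (rule integrable_mult_right)
    thus ?thesis unfolding spectral_measure_halfline using H(1) H(3) by blast
  qed
  have "(\<integral>x. wilson_weight a d b c x \<partial>lpos) = pi\<^sup>2 * wilson_prod a d b c"
    using W(2) wilson_integral[OF assms] by (simp add: wilson_int_def)
  hence v: "(\<integral>x. 2 / pi * wilson_weight a d b c x \<partial>lpos) = 2 * pi * wilson_prod a d b c"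
    by (simp add: power2_eq_square)
  have "(\<integral>s. ?f s \<partial>spectral_measure b c) = (\<integral>s. ?f s * of_real (spectral_weight b c s) \<partial>lpos)"
    unfolding spectral_measure_halfline using H(2) H(4) by (rule trans)
  also have "\<dots> = of_real (2 * pi * wilson_prod a d b c)" unfolding eq v[symmetric] by (rule integral_complex_of_real)
  finally show "(\<integral>s. ?f s \<partial>spectral_measure b c) = of_real (2 * pi * wilson_prod a d b c)" .
qed

text \<open>The factor (1+x)^(b-c) of the weight changes the exponent into -(b+c+a), which gives a
  Beta integral with parameters b + c and a. The form \<open>2 * b + a\<close> is the one in which
  products of two powers (1+x)^(-a'-b) occur.\<close>

lemma source_power_integral:
  assumes "b > 0" "c > 0" "a > 0"
  shows "integrable (source_measure b c) (\<lambda>x. cpow (1 + x) (- of_real (2 * b + a)))"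
    "(\<integral>x. cpow (1 + x) (- of_real (2 * b + a)) \<partial>source_measure b c) = of_real (Gamma (b + c) * Gamma a / Gamma (a + b + c))"
proof -
  let ?f = "\<lambda>x. cpow (1 + x) (- of_real (2 * b + a))"
  have fm: "?f \<in> borel_measurable (halfline (source_weight b c))"
    by (rule halfline_measurable) measurable
  note H = halfline_integral[OF source_weight_measurable source_weight_nonneg fm]
  have eq: "?f x * of_real (source_weight b c x) = cpow x (of_real (b + c) - 1) * cpow (1 + x) (- (of_real (b + c) + of_real a))" if "x \<in> space lpos" for x
  proof -
    have "cpow (1 + x) (- of_real (2 * b + a)) * cpow (1 + x) (of_real (b - c)) = cpow (1 + x) (- (of_real (b + c) + of_real a))"
      by (simp add: algebra_simps flip: cpow_add)
    thus ?thesis using that source_weight_cpow[of x b c] by (simp add: mult_ac)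
  qed
  have B: "integrable lpos (\<lambda>x. cpow x (of_real (b + c) - 1) * cpow (1 + x) (- (of_real (b + c) + of_real a)))"
    "(\<integral>x. cpow x (of_real (b + c) - 1) * cpow (1 + x) (- (of_real (b + c) + of_real a)) \<partial>lpos) 
      = Gamma (of_real (b + c)) * Gamma (of_real a) / Gamma (of_real (b + c) + of_real a)"
    using assms by (intro lpos_Beta; simp)+
  show "integrable (source_measure b c) ?f"
    unfolding source_measure_halfline H(1) H(3) by (subst Bochner_Integration.integrable_cong[OF refl eq]) (assumption, rule B(1))
  have "(\<integral>x. ?f x \<partial>source_measure b c) = Gamma (of_real (b + c)) * Gamma (of_real a) / Gamma (of_real (b + c) + of_real a)"
    unfolding source_measure_halfline H(2) H(4) B(2)[symmetric] by (rule Bochner_Integration.integral_cong[OF refl eq])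
  also have "\<dots> = of_real (Gamma (b + c) * Gamma a / Gamma (b + c + a))"
    unfolding of_real_add[symmetric] Gamma_complex_of_real by simp
  finally show "(\<integral>x. ?f x \<partial>source_measure b c) = of_real (Gamma (b + c) * Gamma a / Gamma (a + b + c))"
    by (simp add: add_ac)
qed

text \<open>A function chosen separately for each \<open>s\<close> says nothing about joint
  dependence on \<open>s\<close> and \<open>x\<close>. Euler's formula does, as a parameter integral
  of a jointly measurable function.\<close>

lemma index_kernel_measurable_pair:
  assumes bc: "b > 0" "c > 0" and M: "sets M = sets (restrict_space borel {0::real..})" and N: "sets N = sets (restrict_space borel {0::real..})"
  shows "(\<lambda>(s, x). index_kernel b c s x) \<in> borel_measurable (N \<Otimes>\<^sub>M M)"
proof -
  have [measurable]: "(\<lambda>x. x) \<in> borel_measurable M" "(\<lambda>x. x) \<in> borel_measurable N"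
    using M N measurable_restrict_space1[of "\<lambda>x. x" borel borel "{0::real..}"] 
    by (simp_all add: measurable_cong_sets[OF M refl] measurable_cong_sets[OF N refl])
  have [measurable]: "fst \<in> borel_measurable (N \<Otimes>\<^sub>M M)" "snd \<in> borel_measurable (N \<Otimes>\<^sub>M M)"
    using measurable_compose[OF measurable_fst, of "\<lambda>x. x" N borel M] measurable_compose[OF measurable_snd, of "\<lambda>x. x" M borel N] by auto
  have k: "kernel_coeff b c \<in> borel_measurable borel"
  proof -
    have "isCont (kernel_coeff b c) s" for s
      unfolding kernel_coeff_def using bc gam_nonzero[OF bc(2), of s] gam_nonzero[OF bc(1), of "-s"]
      by (intro continuous_intros not_nonpos_Int_Re_pos) auto
    thus ?thesis by (intro borel_measurable_continuous_onI continuous_at_imp_continuous_on ballI)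
  qed
  have l [measurable]: "(\<lambda>z. fst (fst z)) \<in> borel_measurable ((N \<Otimes>\<^sub>M M) \<Otimes>\<^sub>M lpos)"
     "(\<lambda>z. snd (fst z)) \<in> borel_measurable ((N \<Otimes>\<^sub>M M) \<Otimes>\<^sub>M lpos)" "snd \<in> borel_measurable ((N \<Otimes>\<^sub>M M) \<Otimes>\<^sub>M lpos)"
    using measurable_compose[OF measurable_snd lpos_measurable[of "\<lambda>x. x"], of "N \<Otimes>\<^sub>M M"] by measurable
  have "(\<lambda>(z, m). kernel_integrand b c (fst z) (snd z) m) \<in> borel_measurable ((N \<Otimes>\<^sub>M M) \<Otimes>\<^sub>M lpos)"
    unfolding kernel_integrand_def split_beta' by measurable
  hence "(\<lambda>z. \<integral>m. kernel_integrand b c (fst z) (snd z) m \<partial>lpos) \<in> borel_measurable (N \<Otimes>\<^sub>M M)"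
    by (rule lpos.borel_measurable_lebesgue_integral)
  hence "(\<lambda>z. kernel_coeff b c (fst z) * (\<integral>m. kernel_integrand b c (fst z) (snd z) m \<partial>lpos)) \<in> borel_measurable (N \<Otimes>\<^sub>M M)"
    using k by measurable
  moreover have "space M = {0..}" using sets_eq_imp_space_eq[OF M] by (simp add: space_restrict_space)
  hence "(case z of (s, x) \<Rightarrow> index_kernel b c s x) = kernel_coeff b c (fst z) * (\<integral>m. kernel_integrand b c (fst z) (snd z) m \<partial>lpos)"
    if "z \<in> space (N \<Otimes>\<^sub>M M)" for z
    using that index_kernel_eq[OF bc] by (auto simp: space_pair_measure)
  ultimately show ?thesis by (subst measurable_cong)
qed

lemma index_kernel_measurable1:
  assumes bc: "b > 0" "c > 0"
  shows "index_kernel b c s \<in> borel_measurable (halfline W)"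
proof -
  have [measurable]: "fst \<in> borel_measurable (borel \<Otimes>\<^sub>M lpos)" "snd \<in> borel_measurable (borel \<Otimes>\<^sub>M lpos)"
    using measurable_compose[OF measurable_snd lpos_measurable[of "\<lambda>x. x"], of "borel"] by measurable
  have "(\<lambda>(x, m). kernel_integrand b c s x m) \<in> borel_measurable (borel \<Otimes>\<^sub>M lpos)"
    unfolding kernel_integrand_def split_beta' by measurable
  from lpos.borel_measurable_lebesgue_integral[OF this] 
  have "(\<lambda>x. kernel_coeff b c s * (\<integral>m. kernel_integrand b c s x m \<partial>lpos)) \<in> borel_measurable borel" by measurable
  from halfline_measurable[OF this, of W] show ?thesis
    by (subst measurable_cong) (auto simp: index_kernel_eq[OF bc])
qed

text \<open>The double integral with r = b + c and \<sigma> = a + c has four Gamma factors above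
  that depend on \<open>s\<close>. Two of them, Gamma(c+is) and Gamma(b-is), cancel against the
  kernel coefficient; the others are conjugate and form the square. The hypothesis
  \<open>a > b\<close> is the condition \<sigma> > r.\<close>

lemma index_transform_power:
  assumes bc: "b > 0" "c > 0" and a: "a > b"
  shows "index_integral b c (\<lambda>x. cpow (1 + x) (- of_real (a + b))) s = of_real ((cmod (gam a s))\<^sup>2 / (Gamma (a + b) * Gamma (a + c)))"
proof -
  let ?p = "of_real b + \<i> * of_real s" and ?q = "of_real b - \<i> * of_real s" and ?r = "complex_of_real (b + c)" and ?s = "complex_of_real (a + c)"
  let ?f = "\<lambda>x. cpow (1 + x) (- of_real (a + b)) * index_kernel b c s x"
  have fm: "?f \<in> borel_measurable (halfline (source_weight b c))"
    by (intro borel_measurable_times index_kernel_measurable1[OF bc] halfline_measurable) measurable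
  note H = halfline_integral[OF source_weight_measurable source_weight_nonneg fm]
  have eq: "?f x * of_real (source_weight b c x) = kernel_coeff b c s * 
      (cpow x (?r - 1) * cpow (1 + x) (- ?s) * (\<integral>m. euler_weight ?q ?r m * cpow (1 + x / (1 + m)) (- ?p) \<partial>lpos))" if "x \<in> space lpos" for x
  proof -
    have w: "cpow (1 + x) (- of_real (a + b)) * of_real (source_weight b c x) = cpow x (?r - 1) * cpow (1 + x) (- ?s)"
    proof -
      have "cpow (1 + x) (- of_real (a + b)) * cpow (1 + x) (of_real (b - c)) = cpow (1 + x) (- ?s)"
        by (simp add: algebra_simps flip: cpow_add)
      thus ?thesis using that source_weight_cpow[of x b c] by (simp add: mult_ac)
    qed
    have k: "index_kernel b c s x = kernel_coeff b c s * (\<integral>m. euler_weight ?q ?r m * cpow (1 + x / (1 + m)) (- ?p) \<partial>lpos)"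
      using that by (simp add: index_kernel_eq[OF bc] kernel_integrand_def[abs_def] euler_weight_def)
    have "?f x * of_real (source_weight b c x) = (cpow (1 + x) (- of_real (a + b)) * of_real (source_weight b c x)) * index_kernel b c s x"
      by (simp only: mult_ac)
    thus ?thesis unfolding w k by (simp only: mult_ac)
  qed
  have "(LBINT x:{0..}. ?f x * of_real (source_weight b c x)) = (\<integral>x. kernel_coeff b c s * 
      (cpow x (?r - 1) * cpow (1 + x) (- ?s) * (\<integral>m. euler_weight ?q ?r m * cpow (1 + x / (1 + m)) (- ?p) \<partial>lpos)) \<partial>lpos)"
    unfolding H(4) by (rule Bochner_Integration.integral_cong[OF refl eq])
  also have "\<dots> = kernel_coeff b c s * 
    (Gamma (?r - ?q) * Gamma (?s - ?r + ?q) / Gamma ?s * (Gamma ?q * Gamma (?s + ?p - ?r) / Gamma (?s + ?p + ?q - ?r)))"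
    unfolding integral_mult_right_zero
    using bc a by (subst euler_beta_integral) auto
  also have "?r - ?q = of_real c + \<i> * of_real s" by simp
  also have "?s - ?r + ?q = of_real a - \<i> * of_real s" by simp
  also have "?s + ?p - ?r = of_real a + \<i> * of_real s" by simp
  also have "?s + ?p + ?q - ?r = of_real (a + b)" by simp
  also have "kernel_coeff b c s * (gam c s * Gamma (of_real a - \<i> * of_real s) / Gamma ?s * (Gamma ?q * gam a s / Gamma (of_real (a + b))))
     = Gamma (of_real (b + c)) * of_real ((cmod (gam a s))\<^sup>2) / (Gamma ?s * Gamma (of_real (a + b)))"
    unfolding kernel_coeff_def cmod_gam_squared using gam_nonzero[OF bc(2), of s] gam_nonzero[OF bc(1), of "-s"] by simp
  also have "\<dots> = of_real (Gamma (b + c) * ((cmod (gam a s))\<^sup>2 / (Gamma (a + b) * Gamma (a + c))))"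
    unfolding Gamma_complex_of_real by (simp add: mult_ac)
  finally have I: "(LBINT x:{0..}. ?f x * of_real (source_weight b c x)) = of_real (Gamma (b + c) * ((cmod (gam a s))\<^sup>2 / (Gamma (a + b) * Gamma (a + c))))" .
  have "Gamma (b + c) > 0" using bc by simp
  hence e: "1 / Gamma (b + c) * (Gamma (b + c) * X) = X" for X by simp
  show ?thesis unfolding index_integral_def I of_real_mult[symmetric] e ..
qed

section \<open>The transform on a weighted space\<close>

lemma L2_norm_sum_expand:
  assumes h: "\<And>i. i \<in> I \<Longrightarrow> h i \<in> L2 K"
  shows "of_real ((L2_norm K (\<lambda>x. \<Sum>i\<in>I. a i * h i x))\<^sup>2) = (\<Sum>i\<in>I. \<Sum>j\<in>I. a i * cnj (a j) * (\<integral>x. h i x * cnj (h j x) \<partial>K))"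
proof -
  have int: "integrable K (\<lambda>x. h i x * cnj (h j x))" if "i \<in> I" "j \<in> I" for i j
    by (intro L2_integrable_mult L2_cnj h that)
  have "of_real ((L2_norm K (\<lambda>x. \<Sum>i\<in>I. a i * h i x))\<^sup>2) = (\<integral>x. (\<Sum>i\<in>I. a i * h i x) * cnj (\<Sum>i\<in>I. a i * h i x) \<partial>K)"
    unfolding L2_norm_squared complex_norm_square[symmetric] by (rule integral_complex_of_real[symmetric])
  also have "\<dots> = (\<integral>x. (\<Sum>i\<in>I. \<Sum>j\<in>I. a i * cnj (a j) * (h i x * cnj (h j x))) \<partial>K)"
    unfolding cnj_sum sum_product by (simp add: mult_ac)
  also have "\<dots> = (\<Sum>i\<in>I. \<Sum>j\<in>I. a i * cnj (a j) * (\<integral>x. h i x * cnj (h j x) \<partial>K))"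
    using int by simp
  finally show ?thesis .
qed

text \<open>Proportional Gram matrices give proportional norms of all combinations with equal
  coefficients. This stands in for an orthogonal basis.\<close>

lemma L2_norm_gram:
  assumes f: "\<And>i. i \<in> I \<Longrightarrow> f i \<in> L2 M" and g: "\<And>i. i \<in> I \<Longrightarrow> g i \<in> L2 N"
    and gram: "\<And>i j. i \<in> I \<Longrightarrow> j \<in> I \<Longrightarrow> (\<integral>y. g i y * cnj (g j y) \<partial>N) = of_real C * (\<integral>x. f i x * cnj (f j x) \<partial>M)"
  shows "(L2_norm N (\<lambda>y. \<Sum>i\<in>I. a i * g i y))\<^sup>2 = C * (L2_norm M (\<lambda>x. \<Sum>i\<in>I. a i * f i x))\<^sup>2"
proof -
  have "complex_of_real ((L2_norm N (\<lambda>y. \<Sum>i\<in>I. a i * g i y))\<^sup>2) = (\<Sum>i\<in>I. \<Sum>j\<in>I. of_real C * (a i * cnj (a j) * (\<integral>x. f i x * cnj (f j x) \<partial>M)))"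
  proof -
    have "complex_of_real ((L2_norm N (\<lambda>y. \<Sum>i\<in>I. a i * g i y))\<^sup>2) = (\<Sum>i\<in>I. \<Sum>j\<in>I. a i * cnj (a j) * (\<integral>x. g i x * cnj (g j x) \<partial>N))"
      by (rule L2_norm_sum_expand) (rule g)
    also have "\<dots> = (\<Sum>i\<in>I. \<Sum>j\<in>I. of_real C * (a i * cnj (a j) * (\<integral>x. f i x * cnj (f j x) \<partial>M)))"
      by (intro sum.cong refl) (simp add: gram mult_ac)
    finally show ?thesis .
  qed
  also have "\<dots> = of_real C * (\<Sum>i\<in>I. \<Sum>j\<in>I. a i * cnj (a j) * (\<integral>x. f i x * cnj (f j x) \<partial>M))"
    by (simp add: sum_distrib_left)
  also have "(\<Sum>i\<in>I. \<Sum>j\<in>I. a i * cnj (a j) * (\<integral>x. f i x * cnj (f j x) \<partial>M)) = of_real ((L2_norm M (\<lambda>x. \<Sum>i\<in>I. a i * f i x))\<^sup>2)"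
    by (rule L2_norm_sum_expand[symmetric]) (rule f)
  also have "of_real C * \<dots> = of_real (C * (L2_norm M (\<lambda>x. \<Sum>i\<in>I. a i * f i x))\<^sup>2)" by (rule of_real_mult[symmetric])
  finally show ?thesis by (simp only: of_real_eq_iff)
qed

text \<open>Multiplication by \<open>v\<close> identifies L2 of the finite measure with density v^2
  with L2 of the weighted half-line, and since \<iota> inverts \<open>u\<close>, every function is a
  function of \<open>u\<close>. The lemma serves both sides of the transform, with different
  \<open>v\<close> and \<open>u\<close>.\<close>

lemma halfline_weighted_dense:
  fixes f :: "real \<Rightarrow> complex" and v u \<iota> :: "real \<Rightarrow> real"
  assumes [measurable]: "v \<in> borel_measurable borel" "u \<in> borel_measurable borel" "\<iota> \<in> borel_measurable borel"
    and v: "\<And>x. x \<ge> 0 \<Longrightarrow> v x > 0" "(\<lambda>x. complex_of_real (v x)) \<in> L2 (halfline W)"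
    and u: "\<And>x. x \<ge> 0 \<Longrightarrow> u x \<in> {0..1}" "\<And>x. x \<ge> 0 \<Longrightarrow> \<iota> (u x) = x"
    and f: "f \<in> L2 (halfline W)"
  shows "\<exists>P :: nat \<Rightarrow> complex poly. \<forall>n. L2_norm (halfline W) (\<lambda>x. f x - of_real (v x) * poly (P n) (of_real (u x))) \<le> inverse (real (Suc n))"
proof -
  let ?H = "halfline W"
  have [measurable]: "v \<in> borel_measurable ?H" "u \<in> borel_measurable ?H" by (intro halfline_measurable; measurable)+
  have [measurable]: "f \<in> borel_measurable ?H" using f by (rule L2_measurable)
  define L where "L = density ?H (\<lambda>x. ennreal ((v x)\<^sup>2))"
  have L_sets [measurable_cong]: "sets L = sets ?H" and L_space: "space L = {0..}" by (simp_all add: L_def)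
  have vi: "integrable ?H (\<lambda>x. (v x)\<^sup>2)" using L2_integrable[OF v(2)] by simp
  have sq: "(v x)\<^sup>2 *\<^sub>R (cmod (h x))\<^sup>2 = (cmod (of_real (v x) * h x))\<^sup>2" for h x
    by (simp add: norm_mult power_mult_distrib)
  have L_L2: "h \<in> L2 L \<longleftrightarrow> (\<lambda>x. of_real (v x) * h x) \<in> L2 ?H" if [measurable]: "h \<in> borel_measurable ?H" for h
  proof -
    have "integrable L (\<lambda>x. (cmod (h x))\<^sup>2) \<longleftrightarrow> integrable ?H (\<lambda>x. (v x)\<^sup>2 *\<^sub>R (cmod (h x))\<^sup>2)"
      unfolding L_def by (rule integrable_density) auto
    moreover have "h \<in> borel_measurable L" using that by (simp add: measurable_cong_sets[OF L_sets refl])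
    ultimately show ?thesis unfolding sq L2_def by simp
  qed
  have L_L2_norm: "L2_norm L h = L2_norm ?H (\<lambda>x. of_real (v x) * h x)" if [measurable]: "h \<in> borel_measurable ?H" for h
  proof -
    have "(\<integral>x. (cmod (h x))\<^sup>2 \<partial>L) = (\<integral>x. (v x)\<^sup>2 *\<^sub>R (cmod (h x))\<^sup>2 \<partial>?H)"
      unfolding L_def by (rule integral_density) auto
    thus ?thesis unfolding sq L2_norm_def by simp
  qed
  have fin: "finite_measure L"
  proof (rule finite_measureI)
    have "emeasure L (space L) = (\<integral>\<^sup>+x. ennreal ((v x)\<^sup>2) \<partial>?H)"
    proof -
      have "space L \<in> sets ?H" using sets.top[of ?H] by (simp add: L_space)
      moreover have "(\<lambda>x. ennreal ((v x)\<^sup>2)) \<in> borel_measurable ?H" by measurable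
      ultimately have "emeasure L (space L) = (\<integral>\<^sup>+x. ennreal ((v x)\<^sup>2) * indicator (space L) x \<partial>?H)"
        using emeasure_density[of "\<lambda>x. ennreal ((v x)\<^sup>2)" ?H "space L"] by (simp only: L_def)
      thus ?thesis by (auto intro!: nn_integral_cong simp: L_space)
    qed
    also have "\<dots> < \<infinity>" using vi by (subst nn_integral_eq_integral) auto
    finally show "emeasure L (space L) \<noteq> \<infinity>" by simp
  qed
  have um: "u \<in> borel_measurable L" by measurable
  interpret bounded_generator L u
    by (intro bounded_generator.intro fin bounded_generator_axioms.intro um) (use u(1) in \<open>simp add: L_space\<close>)
  \<comment> \<open>Extension by zero makes \<open>f\<close> a Borel function on the line; \<iota>
    then presents f / v as a function of \<open>u\<close>.\<close>
  define F where "F x = indicator {0..} x *\<^sub>R f x" for x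
  have [measurable]: "F \<in> borel_measurable borel"
    using L2_measurable[OF f] unfolding halfline_measurable_iff F_def[abs_def] .
  define g where "g y = F (\<iota> y) / of_real (v (\<iota> y))" for y
  have g_meas: "g \<in> borel_measurable borel" unfolding g_def by measurable
  have gu: "g (u x) = f x / of_real (v x)" if "x \<ge> 0" for x using that u by (simp add: g_def F_def)
  have gm [measurable]: "(\<lambda>x. g (u x)) \<in> borel_measurable ?H" using g_meas by measurable
  have "(\<lambda>x. g (u x)) \<in> L2 L"
    unfolding L_L2[OF gm]
  proof (rule L2_dominated[OF f, where C = 1])
    show "AE x in ?H. cmod (of_real (v x) * g (u x)) \<le> 1 * cmod (f x)"
      using v by (intro AE_I2) (simp add: gu norm_mult norm_divide)
  qed measurable
  hence ap: "approx g" by (intro approx_L2 g_meas)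
  have "\<exists>P. L2_norm ?H (\<lambda>x. f x - of_real (v x) * poly P (of_real (u x))) \<le> inverse (real (Suc n))" for n
  proof -
    have "inverse (real (Suc n)) > 0" by simp
    with ap obtain P where P: "L2_norm L (\<lambda>x. g (u x) - poly P (of_real (u x))) < inverse (real (Suc n))"
      unfolding approx_def by blast
    have pm [measurable]: "(\<lambda>x. poly P (of_real (u x))) \<in> borel_measurable ?H"
      using L2_measurable[OF poly_L2[of P]] unfolding measurable_cong_sets[OF L_sets refl] .
    have "L2_norm L (\<lambda>x. g (u x) - poly P (of_real (u x))) = L2_norm ?H (\<lambda>x. of_real (v x) * (g (u x) - poly P (of_real (u x))))"
      by (intro L_L2_norm) measurable
    also have "\<dots> = L2_norm ?H (\<lambda>x. f x - of_real (v x) * poly P (of_real (u x)))"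
    proof (rule L2_norm_cong)
      fix x assume "x \<in> space ?H"
      hence "x \<ge> 0" by simp
      with v(1)[OF this] show "of_real (v x) * (g (u x) - poly P (of_real (u x))) = f x - of_real (v x) * poly P (of_real (u x))"
        by (simp add: gu right_diff_distrib)
    qed
    finally show ?thesis using P by (intro exI[of _ P]) simp
  qed
  thus ?thesis by metis
qed

lemma halfline_truncation:
  assumes f: "f \<in> L2 (halfline W)"
  shows "(\<lambda>x. indicator {0..real n} x * f x) \<in> L2_compact_support (halfline W)"
    "L2_tendsto (halfline W) (\<lambda>n x. indicator {0..real n} x * f x) f"
proof -
  have [measurable]: "f \<in> borel_measurable (halfline W)" using f by (rule L2_measurable)
  have [measurable]: "(\<lambda>x. indicator {0..real n} x :: complex) \<in> borel_measurable (halfline W)" for n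
    by (rule halfline_measurable) measurable
  have m: "(\<lambda>x. indicator {0..real n} x * f x) \<in> borel_measurable (halfline W)" for n by measurable
  have "(\<lambda>x. indicator {0..real n} x * f x) \<in> L2 (halfline W)"
    by (rule L2_dominated[OF f m, where C = 1]) (auto simp: indicator_def)
  thus "(\<lambda>x. indicator {0..real n} x * f x) \<in> L2_compact_support (halfline W)"
    unfolding L2_compact_support_def by (auto intro!: exI[of _ "{0..real n}"])
  show "L2_tendsto (halfline W) (\<lambda>n x. indicator {0..real n} x * f x) f"
  proof (rule L2_tendsto_dominated[where G = "\<lambda>x. cmod (f x)"])
    show "(\<lambda>n. indicator {0..real n} x * f x) \<longlonglongrightarrow> f x" if "x \<in> space (halfline W)" for x
    proof (rule tendsto_eventually)
      obtain N :: nat where "x \<le> real N" using real_arch_simple by blast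
      hence "\<forall>n\<ge>N. indicator {0..real n} x * f x = f x" using that by (auto simp: indicator_def)
      thus "eventually (\<lambda>n. indicator {0..real n} x * f x = f x) sequentially" 
        unfolding eventually_sequentially by blast
    qed
    show "integrable (halfline W) (\<lambda>x. (cmod (f x))\<^sup>2)" by (rule L2_integrable[OF f])
    show "cmod (indicator {0..real n} x * f x) \<le> cmod (f x)" for n x by (simp add: indicator_def)
  qed (use m in simp_all)
qed

section \<open>Kernel estimates and the weighted space\<close>

locale index_hypergeometric =
  fixes b c :: real
  assumes b: "b > 0" and c: "c > 0"
begin

abbreviation "M \<equiv> source_measure b c"
abbreviation "N \<equiv> spectral_measure b c"
abbreviation "T \<equiv> index_integral b c"
abbreviation "T' \<equiv> inverse_index_integral b c"
abbreviation "\<phi> \<equiv> index_kernel b c"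

lemma space_M [simp]: "space M = {0..}" and space_N [simp]: "space N = {0..}"
  by (simp_all add: source_measure_halfline spectral_measure_halfline)

lemma sets_M [measurable_cong]: "sets M = sets (restrict_space borel {0..})"
  and sets_N [measurable_cong]: "sets N = sets (restrict_space borel {0..})"
  by (simp_all add: source_measure_halfline spectral_measure_halfline sets_halfline)

lemma measurable_M: "f \<in> borel_measurable borel \<Longrightarrow> f \<in> borel_measurable M"
  and measurable_N: "f \<in> borel_measurable borel \<Longrightarrow> f \<in> borel_measurable N"
  by (simp_all add: source_measure_halfline spectral_measure_halfline halfline_measurable)

sublocale NM: pair_sigma_finite N M
  unfolding source_measure_halfline spectral_measure_halfline pair_sigma_finite_def
  by (intro conjI halfline_sigma_finite source_weight_measurable spectral_weight_measurable[OF b c])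

lemma \<phi>_pair [measurable]: "(\<lambda>(s, x). \<phi> s x) \<in> borel_measurable (N \<Otimes>\<^sub>M M)"
  by (rule index_kernel_measurable_pair[OF b c sets_M sets_N])

lemma \<phi>_measurable1: "(\<lambda>x. \<phi> s x) \<in> borel_measurable M"
  unfolding source_measure_halfline by (rule index_kernel_measurable1[OF b c])

lemma \<phi>_measurable2: "x \<ge> 0 \<Longrightarrow> (\<lambda>s. \<phi> s x) \<in> borel_measurable N"
  using measurable_compose[OF measurable_Pair2' \<phi>_pair, of x] by simp

definition kernel_bound :: "real \<Rightarrow> real" where
  "kernel_bound s = norm (kernel_coeff b c s) * (Gamma b * Gamma c / Gamma (b + c))"

lemma \<phi>_bound: "x \<ge> 0 \<Longrightarrow> norm (\<phi> s x) \<le> kernel_bound s"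
  unfolding kernel_bound_def by (rule index_kernel_bound[OF b c])

lemma kernel_bound_nonneg: "kernel_bound s \<ge> 0"
  using \<phi>_bound[of 0 s] norm_ge_zero order_trans by blast

text \<open>The bound contains reciprocal Gamma values, which grow with |s| but are continuous.
  Local boundedness suffices for the inverse integral, which starts from functions with compact
  support in \<open>s\<close>.\<close>

lemma kernel_bound_bounded: "compact K \<Longrightarrow> \<exists>B\<ge>0. \<forall>s\<in>K. kernel_bound s \<le> B"
proof -
  assume K: "compact K"
  have "isCont (kernel_coeff b c) s" for s
    unfolding kernel_coeff_def using b c gam_nonzero[OF c, of s] gam_nonzero[OF b, of "-s"]
    by (intro continuous_intros not_nonpos_Int_Re_pos) auto
  hence "isCont kernel_bound s" for s unfolding kernel_bound_def[abs_def] by (intro continuous_intros)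
  hence "compact (kernel_bound ` K)" by (intro compact_continuous_image K continuous_at_imp_continuous_on ballI)
  hence "bounded (kernel_bound ` K)" by (rule compact_imp_bounded)
  then obtain B where "B > 0" "\<forall>y\<in>kernel_bound ` K. norm y \<le> B" unfolding bounded_pos by blast
  thus ?thesis by (intro exI[of _ B]) auto
qed

lemma T_eq:
  assumes "f \<in> borel_measurable M"
  shows "T f s = of_real (1 / Gamma (b + c)) * (\<integral>x. f x * \<phi> s x \<partial>M)"
proof -
  have "(\<lambda>x. f x * \<phi> s x) \<in> borel_measurable (halfline (source_weight b c))"
    using assms \<phi>_measurable1 unfolding source_measure_halfline by measurable
  from halfline_integral(2)[OF source_weight_measurable source_weight_nonneg this]
  show ?thesis by (simp add: index_integral_def source_measure_halfline)
qed

lemma T'_eq: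
  assumes "g \<in> borel_measurable N" "x \<ge> 0"
  shows "T' g x = of_real (1 / (2 * pi)) * of_real (1 / Gamma (b + c)) * (\<integral>s. g s * \<phi> s x \<partial>N)"
    and "integrable N (\<lambda>s. g s * \<phi> s x) \<longleftrightarrow> set_integrable lborel {0..} (\<lambda>s. g s * \<phi> s x * of_real (spectral_weight b c s))"
proof -
  have "(\<lambda>s. g s * \<phi> s x) \<in> borel_measurable (halfline (spectral_weight b c))"
    using assms(1) \<phi>_measurable2[OF assms(2)] unfolding spectral_measure_halfline by measurable
  from halfline_integral(1,2)[OF spectral_weight_measurable[OF b c] spectral_weight_nonneg this]
  show "T' g x = of_real (1 / (2 * pi)) * of_real (1 / Gamma (b + c)) * (\<integral>s. g s * \<phi> s x \<partial>N)"
   "integrable N (\<lambda>s. g s * \<phi> s x) \<longleftrightarrow> set_integrable lborel {0..} (\<lambda>s. g s * \<phi> s x * of_real (spectral_weight b c s))"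
    by (simp_all add: inverse_index_integral_def spectral_measure_halfline)
qed

lemma integrable_mult_\<phi>1: "integrable M f \<Longrightarrow> integrable M (\<lambda>x. f x * \<phi> s x)"
proof (rule Bochner_Integration.integrable_bound[of M "\<lambda>x. kernel_bound s *\<^sub>R f x"])
  assume "integrable M f"
  thus "(\<lambda>x. f x * \<phi> s x) \<in> borel_measurable M" "integrable M (\<lambda>x. kernel_bound s *\<^sub>R f x)" 
    using \<phi>_measurable1[of s] by auto
  show "AE x in M. norm (f x * \<phi> s x) \<le> norm (kernel_bound s *\<^sub>R f x)"
    using \<phi>_bound kernel_bound_nonneg by (intro AE_I2) (auto simp: norm_mult mult.commute[of "cmod (f _)"] intro!: mult_right_mono)
qed

text \<open>The weight \<open>wt\<^sup>2 = (1+x)\<^bsup>2b+1\<^esup>\<close> is large enough for the functions in the weighted space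
  \<open>D2\<close> to be integrable, so that on \<open>D2\<close> the transform is an absolutely convergent integral, and its value
  at a point is continuous in the weighted norm.\<close>

definition v :: "real \<Rightarrow> real" where "v x = (1 + x) powr (- (b + 1/2))"
definition wt :: "real \<Rightarrow> real" where "wt x = (1 + x) powr (b + 1/2)"
definition u :: "real \<Rightarrow> real" where "u x = 1 / (1 + x)"

lemma v_meas [measurable]: "v \<in> borel_measurable borel" and wt_meas [measurable]: "wt \<in> borel_measurable borel" 
  and u_meas [measurable]: "u \<in> borel_measurable borel"
  unfolding v_def wt_def u_def by measurable

lemma v_pos: "x \<ge> 0 \<Longrightarrow> v x > 0" and wt_ge_1: "x \<ge> 0 \<Longrightarrow> wt x \<ge> 1" 
  and wt_v: "x \<ge> 0 \<Longrightarrow> wt x * v x = 1" and u_01: "x \<ge> 0 \<Longrightarrow> u x \<in> {0..1}"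
proof -
  assume x: "x \<ge> 0"
  show "v x > 0" "wt x \<ge> 1" "u x \<in> {0..1}"
    using x b by (auto simp: v_def wt_def u_def ge_one_powr_ge_zero)
  show "wt x * v x = 1" using x unfolding v_def wt_def powr_add[symmetric] by simp
qed

lemma v_L2: "(\<lambda>x. complex_of_real (v x)) \<in> L2 M"
proof -
  have "complex_of_real ((v x)\<^sup>2) = cpow (1 + x) (- of_real (2 * b + 1))" if "x \<in> space M" for x
  proof -
    have "(v x)\<^sup>2 = (1 + x) powr (- (2 * b + 1))"
      using that by (simp add: v_def power2_eq_square flip: powr_add)
    thus ?thesis using that cpow_of_real[of "1 + x" "- (2 * b + 1)"] by simp
  qed
  hence "integrable M (\<lambda>x. complex_of_real ((v x)\<^sup>2)) \<longleftrightarrow> integrable M (\<lambda>x. cpow (1 + x) (- of_real (2 * b + 1)))"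
    by (intro Bochner_Integration.integrable_cong) auto
  hence "integrable M (\<lambda>x. (v x)\<^sup>2)" 
    unfolding integrable_of_real_iff using source_power_integral(1)[OF b c, of 1] by simp
  moreover have "(\<lambda>x. complex_of_real (v x)) \<in> borel_measurable M" by (rule measurable_M) measurable
  ultimately show ?thesis by (simp add: L2_def)
qed

definition D2 :: "(real \<Rightarrow> complex) set" where
  "D2 = {f. (\<lambda>x. of_real (wt x) * f x) \<in> L2 M}"

lemma D2_measurable: assumes "f \<in> D2" shows "f \<in> borel_measurable M"
proof -
  have "(\<lambda>x. of_real (wt x) * f x) \<in> borel_measurable M" using assms by (auto simp: D2_def intro: L2_measurable)
  moreover have "(\<lambda>x. complex_of_real (v x)) \<in> borel_measurable M" by (rule measurable_M) measurable
  ultimately have "(\<lambda>x. of_real (v x) * (of_real (wt x) * f x)) \<in> borel_measurable M" by measurable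
  moreover have "of_real (v x) * (of_real (wt x) * f x) = f x" if "x \<in> space M" for x
  proof -
    have e: "complex_of_real (v x) * (of_real (wt x) * f x) = of_real (wt x * v x) * f x" by simp
    show ?thesis unfolding e using that by (subst wt_v) auto
  qed
  ultimately show ?thesis by (subst (asm) measurable_cong) auto
qed

lemma cmod_le_wt: "x \<in> space M \<Longrightarrow> cmod z \<le> cmod (of_real (wt x) * z)"
  using mult_right_mono[OF wt_ge_1[of x], of "cmod z"] wt_ge_1[of x] by (simp add: norm_mult)

lemma D2_L2: "f \<in> D2 \<Longrightarrow> f \<in> L2 M"
  by (rule L2_dominated[of "\<lambda>x. of_real (wt x) * f x" M, where C = 1])
     (use cmod_le_wt D2_measurable in \<open>auto simp: D2_def intro!: AE_I2\<close>)

lemma D2_L2_norm_le: "f \<in> D2 \<Longrightarrow> L2_norm M f \<le> L2_norm M (\<lambda>x. of_real (wt x) * f x)"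
  unfolding L2_norm_def
proof (rule real_sqrt_le_mono, rule integral_mono)
  assume f: "f \<in> D2"
  show "integrable M (\<lambda>x. (cmod (f x))\<^sup>2)" by (rule L2_integrable[OF D2_L2[OF f]])
  show "integrable M (\<lambda>x. (cmod (of_real (wt x) * f x))\<^sup>2)" using f by (intro L2_integrable) (simp add: D2_def)
  show "(cmod (f x))\<^sup>2 \<le> (cmod (of_real (wt x) * f x))\<^sup>2" if "x \<in> space M" for x
    using cmod_le_wt[OF that, of "f x"] by (rule power_mono) simp
qed

lemma D2_lincomb:
  assumes "f \<in> D2" "g \<in> D2" shows "(\<lambda>x. \<alpha> * f x + \<beta> * g x) \<in> D2"
proof -
  have "(\<lambda>x. \<alpha> * (of_real (wt x) * f x) + \<beta> * (of_real (wt x) * g x)) \<in> L2 M"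
    using assms by (intro L2_lincomb) (auto simp: D2_def)
  thus ?thesis by (simp add: D2_def algebra_simps)
qed

lemma D2_split: 
  assumes "x \<in> space M" shows "f x = (of_real (wt x) * f x) * complex_of_real (v x)"
proof -
  have e: "(of_real (wt x) * f x) * complex_of_real (v x) = of_real (wt x * v x) * f x" by simp
  show ?thesis unfolding e using assms by (subst wt_v) auto
qed

text \<open>Cauchy-Schwarz for f = (wt f) v with \<open>v\<close> square-integrable.\<close>

lemma D2_L1: assumes "f \<in> D2" 
  shows "integrable M f" "(\<integral>x. norm (f x) \<partial>M) \<le> L2_norm M (\<lambda>x. of_real (wt x) * f x) * L2_norm M (\<lambda>x. of_real (v x))"
proof -
  have "integrable M (\<lambda>x. (of_real (wt x) * f x) * of_real (v x))"
    using assms by (intro L2_integrable_mult v_L2) (simp add: D2_def)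
  moreover have "integrable M f \<longleftrightarrow> integrable M (\<lambda>x. (of_real (wt x) * f x) * of_real (v x))"
    by (rule Bochner_Integration.integrable_cong[OF refl D2_split])
  ultimately show "integrable M f" by simp
  have "(\<integral>x. norm (f x) \<partial>M) = (\<integral>x. norm (of_real (wt x) * f x) * norm (complex_of_real (v x)) \<partial>M)"
    unfolding norm_mult[symmetric] by (rule Bochner_Integration.integral_cong[OF refl]) (simp only: D2_split[symmetric])
  also have "\<dots> \<le> L2_norm M (\<lambda>x. of_real (wt x) * f x) * L2_norm M (\<lambda>x. of_real (v x))"
    using assms by (intro L2_cauchy_schwarz v_L2) (simp add: D2_def)
  finally show "(\<integral>x. norm (f x) \<partial>M) \<le> L2_norm M (\<lambda>x. of_real (wt x) * f x) * L2_norm M (\<lambda>x. of_real (v x))" .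
qed

lemma T_measurable: "f \<in> borel_measurable M \<Longrightarrow> T f \<in> borel_measurable N"
proof -
  assume [measurable]: "f \<in> borel_measurable M"
  have "(\<lambda>(s, x). f x * \<phi> s x) \<in> borel_measurable (N \<Otimes>\<^sub>M M)" using \<phi>_pair by measurable
  from NM.M2.borel_measurable_lebesgue_integral[OF this]
  have "(\<lambda>s. of_real (1 / Gamma (b + c)) * (\<integral>x. f x * \<phi> s x \<partial>M)) \<in> borel_measurable N" by measurable
  thus ?thesis by (subst measurable_cong) (auto simp: T_eq)
qed

lemma T_cong: "(\<And>x. x \<ge> 0 \<Longrightarrow> f x = g x) \<Longrightarrow> T f s = T g s"
  unfolding index_integral_def by (auto intro!: set_lebesgue_integral_cong arg_cong[where f = "\<lambda>x. _ * x"])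

end

context index_hypergeometric
begin

lemma T_lincomb:
  assumes "integrable M f" "integrable M g"
  shows "T (\<lambda>x. \<alpha> * f x + \<beta> * g x) s = \<alpha> * T f s + \<beta> * T g s"
proof -
  have i: "integrable M (\<lambda>x. f x * \<phi> s x)" "integrable M (\<lambda>x. g x * \<phi> s x)"
    by (intro integrable_mult_\<phi>1 assms)+
  have [measurable]: "f \<in> borel_measurable M" "g \<in> borel_measurable M" using assms by auto
  have "T (\<lambda>x. \<alpha> * f x + \<beta> * g x) s = of_real (1 / Gamma (b + c)) * (\<integral>x. \<alpha> * (f x * \<phi> s x) + \<beta> * (g x * \<phi> s x) \<partial>M)"
    by (subst T_eq) (auto simp: algebra_simps)
  also have "(\<integral>x. \<alpha> * (f x * \<phi> s x) + \<beta> * (g x * \<phi> s x) \<partial>M) = \<alpha> * (\<integral>x. f x * \<phi> s x \<partial>M) + \<beta> * (\<integral>x. g x * \<phi> s x \<partial>M)"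
    using i by simp
  finally show ?thesis by (simp add: T_eq algebra_simps)
qed

lemma T_sum:
  assumes "\<And>i. i \<in> I \<Longrightarrow> integrable M (f i)"
  shows "T (\<lambda>x. \<Sum>i\<in>I. a i * f i x) s = (\<Sum>i\<in>I. a i * T (f i) s)"
  using assms
proof (induction I rule: infinite_finite_induct)
  case (insert i I)
  have "T (\<lambda>x. \<Sum>i\<in>insert i I. a i * f i x) s = T (\<lambda>x. a i * f i x + 1 * (\<Sum>i\<in>I. a i * f i x)) s"
    using insert.hyps by simp
  also have "\<dots> = a i * T (f i) s + 1 * T (\<lambda>x. \<Sum>i\<in>I. a i * f i x) s"
    by (rule T_lincomb) (use insert.prems in auto)
  finally show ?case using insert by simp
qed (auto simp: index_integral_def)

lemma T_norm_le:
  assumes "integrable M f"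
  shows "norm (T f s) \<le> (1 / Gamma (b + c)) * (kernel_bound s * (\<integral>x. norm (f x) \<partial>M))"
proof -
  have Gpos: "Gamma (b + c) > 0" using b c by simp
  have [measurable]: "f \<in> borel_measurable M" using assms by auto
  have "norm (\<integral>x. f x * \<phi> s x \<partial>M) \<le> (\<integral>x. norm (f x * \<phi> s x) \<partial>M)" by (rule integral_norm_bound)
  also have "\<dots> \<le> (\<integral>x. kernel_bound s * norm (f x) \<partial>M)"
  proof (rule integral_mono)
    show "norm (f x * \<phi> s x) \<le> kernel_bound s * norm (f x)" if "x \<in> space M" for x
      using \<phi>_bound[of x s] that by (simp add: norm_mult mult.commute[of "cmod (f x)"] mult_right_mono)
  qed (use assms integrable_mult_\<phi>1 in auto)
  finally have "norm (\<integral>x. f x * \<phi> s x \<partial>M) \<le> kernel_bound s * (\<integral>x. norm (f x) \<partial>M)" by simp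
  moreover have "norm (complex_of_real (1 / Gamma (b + c))) = 1 / Gamma (b + c)" using Gpos by (simp only: norm_of_real) simp
  ultimately show ?thesis unfolding T_eq[OF \<open>f \<in> borel_measurable M\<close>] norm_mult using Gpos
    by (simp only:) (intro mult_left_mono, auto)
qed

text \<open>The parameter is a = b + 1 + n, so a > b holds from n = 0 on. In terms of the weight the
  function is v^2 u^n.\<close>

definition shifted_power :: "nat \<Rightarrow> real \<Rightarrow> complex" where
  "shifted_power n x = cpow (1 + x) (- of_real ((b + 1 + real n) + b))"

definition gam_sq :: "nat \<Rightarrow> real \<Rightarrow> real" where
  "gam_sq n s = (cmod (gam (b + 1 + real n) s))\<^sup>2"

definition gam_denom :: "nat \<Rightarrow> real" where
  "gam_denom n = Gamma (b + 1 + real n + b) * Gamma (b + 1 + real n + c)"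

lemma gam_denom_pos: "gam_denom n > 0" unfolding gam_denom_def using b c by (intro mult_pos_pos Gamma_real_pos) auto

lemma b1n_pos: "b + 1 + real n > 0" using b by linarith

lemma gam_sq_pos: "gam_sq n s > 0" unfolding gam_sq_def using gam_nonzero[OF b1n_pos, of n s] by simp

lemma gam_sq_meas [measurable]: "gam_sq n \<in> borel_measurable borel"
  unfolding gam_sq_def using gam_measurable[OF b1n_pos, of n] by measurable

lemma T_shifted_power: "T (shifted_power n) s = of_real (gam_sq n s / gam_denom n)"
  unfolding shifted_power_def[abs_def] gam_sq_def gam_denom_def by (rule index_transform_power[OF b c]) simp

lemma shifted_power_eq: "x \<ge> 0 \<Longrightarrow> shifted_power n x = of_real ((v x)\<^sup>2 * u x ^ n)"
proof -
  assume x: "x \<ge> 0"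
  have "(v x)\<^sup>2 * u x ^ n = (1 + x) powr (- (b + 1/2)) * (1 + x) powr (- (b + 1/2)) * (1 + x) powr (- real n)"
    using x by (simp add: v_def u_def power2_eq_square powr_minus powr_realpow power_one_over inverse_eq_divide)
  also have "\<dots> = (1 + x) powr (- ((b + 1 + real n) + b))" unfolding powr_add[symmetric] 
    by (rule arg_cong[where f = "\<lambda>t. (1 + x) powr t"]) simp
  finally show ?thesis using x cpow_of_real[of "1 + x" "- ((b + 1 + real n) + b)"] by (simp add: shifted_power_def)
qed

lemma shifted_power_D2: "shifted_power n \<in> D2"
proof -
  have "(\<lambda>x. of_real (wt x) * shifted_power n x) \<in> L2 M"
  proof (rule L2_dominated[OF v_L2, where C = 1])
    have "shifted_power n \<in> borel_measurable borel" unfolding shifted_power_def[abs_def] by measurable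
    thus "(\<lambda>x. of_real (wt x) * shifted_power n x) \<in> borel_measurable M" by (intro measurable_M) measurable
    show "AE x in M. cmod (of_real (wt x) * shifted_power n x) \<le> 1 * cmod (of_real (v x))"
    proof (rule AE_I2)
      fix x assume "x \<in> space M"
      hence x: "x \<ge> 0" by simp
      have "wt x * ((v x)\<^sup>2 * u x ^ n) = (wt x * v x) * v x * u x ^ n" by (simp add: power2_eq_square)
      also have "\<dots> = v x * u x ^ n" using wt_v[OF x] by simp
      finally have e: "wt x * ((v x)\<^sup>2 * u x ^ n) = v x * u x ^ n" .
      have "of_real (wt x) * shifted_power n x = complex_of_real (v x * u x ^ n)"
        unfolding shifted_power_eq[OF x] of_real_mult[symmetric] e ..
      moreover have "v x * u x ^ n \<le> v x" "0 \<le> v x * u x ^ n"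
        using v_pos[OF x] u_01[OF x] by (auto intro!: mult_left_le power_le_one)
      ultimately show "cmod (of_real (wt x) * shifted_power n x) \<le> 1 * cmod (of_real (v x))"
        by (simp only: norm_of_real)
    qed
  qed
  thus ?thesis by (simp add: D2_def)
qed

definition power_poly :: "complex poly \<Rightarrow> real \<Rightarrow> complex" where
  "power_poly P x = (\<Sum>n\<le>degree P. coeff P n * shifted_power n x)"

lemma power_poly_eq: "x \<ge> 0 \<Longrightarrow> power_poly P x = of_real ((v x)\<^sup>2) * poly P (of_real (u x))"
  by (simp add: power_poly_def poly_altdef shifted_power_eq sum_distrib_left mult_ac)

lemma D2_zero: "(\<lambda>_. 0) \<in> D2" by (simp add: D2_def L2_zero)

lemma D2_sum: "(\<And>i. i \<in> I \<Longrightarrow> f i \<in> D2) \<Longrightarrow> (\<lambda>x. \<Sum>i\<in>I. a i * f i x) \<in> D2"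
proof (induction I rule: infinite_finite_induct)
  case (insert i I)
  thus ?case using D2_lincomb[of "f i" "\<lambda>x. \<Sum>i\<in>I. a i * f i x" "a i" 1] by simp
qed (auto simp: D2_zero)

lemma power_poly_D2: "power_poly P \<in> D2" unfolding power_poly_def[abs_def] by (intro D2_sum shifted_power_D2)

lemma T_power_poly: "T (power_poly P) s = (\<Sum>n\<le>degree P. coeff P n * of_real (gam_sq n s / gam_denom n))"
  unfolding power_poly_def[abs_def] by (subst T_sum) (auto simp: T_shifted_power intro: D2_L1 shifted_power_D2)

lemma gam_sq_mult_integral:
  "integrable N (\<lambda>s. complex_of_real (gam_sq m s * gam_sq n s))"
  "(\<integral>s. complex_of_real (gam_sq m s * gam_sq n s) \<partial>N) = of_real (2 * pi * wilson_prod (b + 1 + real m) (b + 1 + real n) b c)"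
  unfolding gam_sq_def using b c by (intro spectral_gamma_integral; simp)+

lemma gam_sq_L2: "(\<lambda>s. complex_of_real (gam_sq n s)) \<in> L2 N"
proof -
  have "integrable N (\<lambda>s. gam_sq n s * gam_sq n s)"
    using gam_sq_mult_integral(1)[of n n] unfolding integrable_of_real_iff .
  moreover have "(\<lambda>s. complex_of_real (gam_sq n s)) \<in> borel_measurable N" by (rule measurable_N) measurable
  ultimately show ?thesis by (simp add: L2_def power2_eq_square)
qed

lemma T_shifted_power_L2: "T (shifted_power n) \<in> L2 N"
proof -
  have "(\<lambda>s. of_real (1 / gam_denom n) * complex_of_real (gam_sq n s)) \<in> L2 N" by (rule L2_cmult[OF gam_sq_L2])
  moreover have "of_real (1 / gam_denom n) * complex_of_real (gam_sq n s) = T (shifted_power n) s" for s by (simp add: T_shifted_power)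
  ultimately show ?thesis by simp
qed

text \<open>The two normalising denominators cancel the four mixed Gamma values of Wilson's product
  and leave Gamma(b+c) Gamma(a+d) / Gamma(a+b+c+d), the Beta integral of the product of the two
  powers. The 2 pi is that of the spectral integral.\<close>

lemma gram_shifted_power: "(\<integral>s. T (shifted_power m) s * cnj (T (shifted_power n) s) \<partial>N) = of_real (2 * pi) * (\<integral>x. shifted_power m x * cnj (shifted_power n x) \<partial>M)"
proof -
  define a d where "a = b + 1 + real m" and "d = b + 1 + real n"
  have ad: "a > 0" "d > 0" using b by (auto simp: a_def d_def)
  have "shifted_power m x * cnj (shifted_power n x) = cpow (1 + x) (- of_real (2 * b + (a + d)))" for x
  proof -
    have e: "- complex_of_real (b + 1 + real m + b) + cnj (- of_real (b + 1 + real n + b)) = - of_real (2 * b + (a + d))"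
      by (simp add: a_def d_def)
    show ?thesis unfolding shifted_power_def cnj_cpow cpow_add[symmetric] e ..
  qed
  hence 1: "(\<integral>x. shifted_power m x * cnj (shifted_power n x) \<partial>M) = of_real (Gamma (b + c) * Gamma (a + d) / Gamma (a + d + b + c))"
    using source_power_integral(2)[OF b c, of "a + d"] ad by simp
  have "T (shifted_power m) s * cnj (T (shifted_power n) s) = of_real (1 / (gam_denom m * gam_denom n)) * complex_of_real (gam_sq m s * gam_sq n s)" for s
    by (simp add: T_shifted_power)
  hence "(\<integral>s. T (shifted_power m) s * cnj (T (shifted_power n) s) \<partial>N) = of_real (1 / (gam_denom m * gam_denom n)) * of_real (2 * pi * wilson_prod a d b c)"
    using gam_sq_mult_integral(2)[of m n] by (simp only: integral_mult_right_zero a_def d_def)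
  also have "\<dots> = of_real (2 * pi * (wilson_prod a d b c / (gam_denom m * gam_denom n)))" by simp
  also have "wilson_prod a d b c / (gam_denom m * gam_denom n) = Gamma (b + c) * Gamma (a + d) / Gamma (a + d + b + c)"
  proof -
    have "wilson_prod a d b c = (gam_denom m * gam_denom n) * (Gamma (b + c) * Gamma (a + d) / Gamma (a + d + b + c))"
      by (simp add: wilson_prod_def gam_denom_def a_def d_def mult_ac)
    thus ?thesis using gam_denom_pos[of m] gam_denom_pos[of n] by simp
  qed
  finally show ?thesis unfolding 1 by simp
qed

lemma T_power_poly_norm: "T (power_poly P) \<in> L2 N" "L2_norm N (T (power_poly P)) = sqrt (2 * pi) * L2_norm M (power_poly P)"
proof -
  have T: "T (power_poly P) = (\<lambda>s. \<Sum>n\<le>degree P. coeff P n * T (shifted_power n) s)" by (simp add: T_power_poly T_shifted_power fun_eq_iff)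
  show "T (power_poly P) \<in> L2 N" unfolding T by (intro L2_sum L2_cmult T_shifted_power_L2)
  have "(L2_norm N (T (power_poly P)))\<^sup>2 = 2 * pi * (L2_norm M (power_poly P))\<^sup>2"
  proof -
    have power_poly: "power_poly P = (\<lambda>x. \<Sum>n\<le>degree P. coeff P n * shifted_power n x)" by (simp add: power_poly_def fun_eq_iff)
    have "(L2_norm N (T (power_poly P)))\<^sup>2 = (L2_norm N (\<lambda>s. \<Sum>n\<le>degree P. coeff P n * T (shifted_power n) s))\<^sup>2" by (simp only: T)
    also have "\<dots> = 2 * pi * (L2_norm M (\<lambda>x. \<Sum>n\<le>degree P. coeff P n * shifted_power n x))\<^sup>2"
      by (rule L2_norm_gram) (use D2_L2[OF shifted_power_D2] T_shifted_power_L2 gram_shifted_power in blast)+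
    finally show ?thesis unfolding power_poly .
  qed
  also have "\<dots> = (sqrt (2 * pi) * L2_norm M (power_poly P))\<^sup>2" by (simp add: power_mult_distrib)
  finally show "L2_norm N (T (power_poly P)) = sqrt (2 * pi) * L2_norm M (power_poly P)" by (simp add: power2_eq_iff_nonneg)
qed

lemma power_poly_diff: "x \<ge> 0 \<Longrightarrow> power_poly (P - Q) x = power_poly P x - power_poly Q x"
  by (simp add: power_poly_eq algebra_simps)

lemma T_power_poly_diff: "T (power_poly (P - Q)) s = T (power_poly P) s - T (power_poly Q) s"
proof -
  have "T (power_poly (P - Q)) s = T (\<lambda>x. 1 * power_poly P x + (-1) * power_poly Q x) s" by (rule T_cong) (simp add: power_poly_diff)
  also have "\<dots> = 1 * T (power_poly P) s + (-1) * T (power_poly Q) s" by (intro T_lincomb D2_L1 power_poly_D2)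
  finally show ?thesis by simp
qed

text \<open>As wt v = 1, multiplying v^2 P(u) by the weight gives v P(u), and such products are
  dense in L2. The approximation thus holds in the weighted norm, which is stronger than the L2
  norm.\<close>

lemma D2_dense: 
  assumes "f \<in> D2" 
  shows "\<exists>P. \<forall>n. L2_norm M (\<lambda>x. of_real (wt x) * (f x - power_poly (P n) x)) \<le> inverse (real (Suc n))"
proof -
  have inv: "1 / u x - 1 = x" if "x \<ge> 0" for x using that by (simp add: u_def)
  have "(\<lambda>y. 1 / y - 1 :: real) \<in> borel_measurable borel" by measurable
  moreover have "(\<lambda>x. of_real (wt x) * f x) \<in> L2 (halfline (source_weight b c))"
    using assms by (simp add: D2_def source_measure_halfline)
  moreover have "(\<lambda>x. complex_of_real (v x)) \<in> L2 (halfline (source_weight b c))"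
    using v_L2 by (simp add: source_measure_halfline)
  ultimately obtain P where P: "\<And>n. L2_norm M (\<lambda>x. of_real (wt x) * f x - of_real (v x) * poly (P n) (of_real (u x))) \<le> inverse (real (Suc n))"
    using halfline_weighted_dense[OF v_meas u_meas _ v_pos _ u_01 inv, of "source_weight b c" "\<lambda>x. of_real (wt x) * f x"] 
    unfolding source_measure_halfline by blast
  have "L2_norm M (\<lambda>x. of_real (wt x) * (f x - power_poly (P n) x)) = L2_norm M (\<lambda>x. of_real (wt x) * f x - of_real (v x) * poly (P n) (of_real (u x)))" for n
  proof (rule L2_norm_cong)
    fix x assume "x \<in> space M"
    hence x: "x \<ge> 0" by simp
    have "complex_of_real (wt x) * power_poly (P n) x = of_real ((wt x * v x) * v x) * poly (P n) (of_real (u x))"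
      unfolding power_poly_eq[OF x] by (simp add: power2_eq_square)
    thus "of_real (wt x) * (f x - power_poly (P n) x) = of_real (wt x) * f x - of_real (v x) * poly (P n) (of_real (u x))"
      unfolding wt_v[OF x] by (simp add: right_diff_distrib)
  qed
  thus ?thesis using P by (intro exI[of _ P] allI) (simp only:)
qed

text \<open>Closeness in the weighted norm is closeness in L1, so the transforms of the approximants
  converge to \<open>T f\<close> at every \<open>s\<close>. Their mutual distances are controlled by
  the Gram identity, and Fatou's lemma turns pointwise convergence into convergence in L2.\<close>

lemma T_D2_isometry:
  assumes f: "f \<in> D2" shows "T f \<in> L2 N" "L2_norm N (T f) = sqrt (2 * pi) * L2_norm M f"
proof -
  from D2_dense[OF f] obtain P where P: "\<And>n. L2_norm M (\<lambda>x. of_real (wt x) * (f x - power_poly (P n) x)) \<le> inverse (real (Suc n))" by blast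
  let ?e = "\<lambda>n. inverse (real (Suc n))"
  have D: "(\<lambda>x. f x - power_poly (P n) x) \<in> D2" for n using D2_lincomb[OF f power_poly_D2, of 1 "-1" "P n"] by simp
  have close: "L2_norm M (\<lambda>x. f x - power_poly (P n) x) \<le> ?e n" for n
    using D2_L2_norm_le[OF D[of n]] P[of n] by linarith
  have e0: "?e \<longlonglongrightarrow> 0" by (rule LIMSEQ_inverse_real_of_nat)
  have lim_M: "L2_tendsto M (\<lambda>n. power_poly (P n)) f"
    by (rule L2_tendstoI_le[OF D2_L2[OF power_poly_D2] D2_L2[OF f] _ e0]) (use close in \<open>simp add: L2_norm_minus_commute[of M "power_poly _"]\<close>)
  have ptw: "(\<lambda>n. T (power_poly (P n)) s) \<longlonglongrightarrow> T f s" for s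
  proof -
    let ?C = "(1 / Gamma (b + c)) * (kernel_bound s * L2_norm M (\<lambda>x. of_real (v x)))"
    have Gp: "1 / Gamma (b + c) \<ge> 0" using b c by (simp add: less_imp_le)
    have "norm (T (power_poly (P n)) s - T f s) \<le> ?C * ?e n" for n
    proof -
      have "T (\<lambda>x. 1 * f x + (-1) * power_poly (P n) x) s = 1 * T f s + (-1) * T (power_poly (P n)) s"
        by (intro T_lincomb D2_L1 f power_poly_D2)
      hence "norm (T (power_poly (P n)) s - T f s) = norm (T (\<lambda>x. f x - power_poly (P n) x) s)"
        by (simp add: norm_minus_commute)
      also have "\<dots> \<le> (1 / Gamma (b + c)) * (kernel_bound s * (\<integral>x. norm (f x - power_poly (P n) x) \<partial>M))"
        by (rule T_norm_le[OF D2_L1(1)[OF D]])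
      also have "\<dots> \<le> (1 / Gamma (b + c)) * (kernel_bound s * (?e n * L2_norm M (\<lambda>x. of_real (v x))))"
      proof (intro mult_left_mono kernel_bound_nonneg Gp)
        show "(\<integral>x. norm (f x - power_poly (P n) x) \<partial>M) \<le> ?e n * L2_norm M (\<lambda>x. of_real (v x))"
          using D2_L1(2)[OF D[of n]] mult_right_mono[OF P[of n] L2_norm_nonneg[of M "\<lambda>x. of_real (v x)"]] by linarith
      qed
      finally show ?thesis by (simp add: mult_ac)
    qed
    hence "\<forall>\<^sub>F n in sequentially. norm (T (power_poly (P n)) s - T f s) \<le> ?C * ?e n" by (intro always_eventually allI)
    moreover have "(\<lambda>n. ?C * ?e n) \<longlonglongrightarrow> 0" by (rule tendsto_mult_right_zero[OF e0])
    ultimately have "(\<lambda>n. T (power_poly (P n)) s - T f s) \<longlonglongrightarrow> 0"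
      by (rule Lim_null_comparison)
    thus ?thesis by (simp add: LIM_zero_iff)
  qed
  have Tm: "T f \<in> borel_measurable N" by (rule T_measurable[OF D2_measurable[OF f]])
  have TP: "L2_norm N (\<lambda>s. T (power_poly (P m)) s - T (power_poly (P n)) s) \<le> sqrt (2 * pi) * (?e m + ?e n)" for m n
  proof -
    have "L2_norm N (\<lambda>s. T (power_poly (P m)) s - T (power_poly (P n)) s) = sqrt (2 * pi) * L2_norm M (power_poly (P m - P n))"
      unfolding T_power_poly_diff[symmetric] by (rule T_power_poly_norm(2))
    also have "L2_norm M (power_poly (P m - P n)) = L2_norm M (\<lambda>x. power_poly (P m) x - power_poly (P n) x)"
      by (rule L2_norm_cong) (simp add: power_poly_diff)
    also have "\<dots> \<le> L2_norm M (\<lambda>x. power_poly (P m) x - f x) + L2_norm M (\<lambda>x. f x - power_poly (P n) x)"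
      by (intro L2_norm_triangle D2_L2 power_poly_D2 f)
    also have "\<dots> \<le> ?e m + ?e n"
      using close[of m] close[of n] by (simp add: L2_norm_minus_commute[of M "power_poly (P m)"])
    finally show ?thesis by simp
  qed
  \<comment> \<open>With one index fixed, the bound on differences of approximants passes to the
    pointwise limit. This yields membership of \<open>T f\<close> in L2 together with a
    rate.\<close>
  have fat: "(\<lambda>s. T f s - T (power_poly (P n)) s) \<in> L2 N \<and> L2_norm N (\<lambda>s. T f s - T (power_poly (P n)) s) \<le> sqrt (2 * pi) * (2 * ?e n)" for n
  proof -
    have "(\<lambda>s. T (power_poly (P (m + n))) s - T (power_poly (P n)) s) \<in> L2 N" for m by (intro L2_diff T_power_poly_norm)
    moreover have "(\<lambda>s. T f s - T (power_poly (P n)) s) \<in> borel_measurable N" 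
      using Tm L2_measurable[OF T_power_poly_norm(1)] by (intro borel_measurable_diff)
    moreover have "AE s in N. (\<lambda>m. T (power_poly (P (m + n))) s - T (power_poly (P n)) s) \<longlonglongrightarrow> T f s - T (power_poly (P n)) s"
      by (intro AE_I2 tendsto_diff tendsto_const LIMSEQ_ignore_initial_segment ptw)
    moreover have "L2_norm N (\<lambda>s. T (power_poly (P (m + n))) s - T (power_poly (P n)) s) \<le> sqrt (2 * pi) * (2 * ?e n)" for m
    proof (rule order_trans[OF TP])
      have "?e (m + n) \<le> ?e n" by (intro le_imp_inverse_le) auto
      thus "sqrt (2 * pi) * (?e (m + n) + ?e n) \<le> sqrt (2 * pi) * (2 * ?e n)" by (intro mult_left_mono) auto
    qed
    ultimately show ?thesis using L2_fatou[of "\<lambda>m s. T (power_poly (P (m + n))) s - T (power_poly (P n)) s" N] by blast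
  qed
  have "(\<lambda>s. (T f s - T (power_poly (P 0)) s) + T (power_poly (P 0)) s) \<in> L2 N"
    using fat[of 0] by (intro L2_add T_power_poly_norm) auto
  thus TL: "T f \<in> L2 N" by simp
  have "L2_tendsto N (\<lambda>n. T (power_poly (P n))) (T f)"
  proof (rule L2_tendstoI_le[OF T_power_poly_norm(1) TL])
    show "L2_norm N (\<lambda>s. T (power_poly (P n)) s - T f s) \<le> sqrt (2 * pi) * (2 * ?e n)" for n
      using fat[of n] by (simp add: L2_norm_minus_commute[of N "T (power_poly (P n))"])
    show "(\<lambda>n. sqrt (2 * pi) * (2 * ?e n)) \<longlonglongrightarrow> 0"
      by (rule tendsto_mult_right_zero[OF tendsto_mult_right_zero[OF e0]])
  qed
  from L2_tendsto_norm[OF this] have "(\<lambda>n. sqrt (2 * pi) * L2_norm M (power_poly (P n))) \<longlonglongrightarrow> L2_norm N (T f)"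
    by (simp add: T_power_poly_norm(2))
  moreover have "(\<lambda>n. sqrt (2 * pi) * L2_norm M (power_poly (P n))) \<longlonglongrightarrow> sqrt (2 * pi) * L2_norm M f"
    by (intro tendsto_intros L2_tendsto_norm lim_M)
  ultimately show "L2_norm N (T f) = sqrt (2 * pi) * L2_norm M f" by (rule LIMSEQ_unique)
qed

text \<open>The weight \<open>wt\<close> is bounded on bounded sets. Hence the isometry on
  \<open>D2\<close> covers the functions from which the transform is extended.\<close>

lemma compact_support_D2: "f \<in> L2_compact_support M \<Longrightarrow> f \<in> D2"
proof -
  assume f: "f \<in> L2_compact_support M"
  then obtain K where K: "compact K" "\<And>x. x \<in> space M - K \<Longrightarrow> f x = 0" and L: "f \<in> L2 M"
    unfolding L2_compact_support_def by blast
  from compact_imp_bounded[OF K(1)] obtain R where R: "\<And>x. x \<in> K \<Longrightarrow> norm x \<le> R" unfolding bounded_iff by blast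
  have "(\<lambda>x. of_real (wt x) * f x) \<in> L2 M"
  proof (rule L2_dominated[OF L, where C = "wt R"])
    have "(\<lambda>x. complex_of_real (wt x)) \<in> borel_measurable M" by (rule measurable_M) measurable
    thus "(\<lambda>x. of_real (wt x) * f x) \<in> borel_measurable M" using L2_measurable[OF L] by measurable
    show "AE x in M. cmod (of_real (wt x) * f x) \<le> wt R * cmod (f x)"
    proof (rule AE_I2)
      fix x assume x: "x \<in> space M"
      show "cmod (of_real (wt x) * f x) \<le> wt R * cmod (f x)"
      proof (cases "x \<in> K")
        case True
        hence "wt x \<le> wt R" unfolding wt_def using x R[of x] b by (intro powr_mono2) auto
        thus ?thesis using wt_ge_1[of x] x by (simp add: norm_mult mult_right_mono)
      qed (use K(2) x in simp)
    qed
  qed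
  thus "f \<in> D2" by (simp add: D2_def)
qed

sublocale J: L2_isometry M N T "sqrt (2 * pi)"
proof
  show "\<exists>h. (\<forall>n. h n \<in> L2_compact_support M) \<and> L2_tendsto M h f" if "f \<in> L2 M" for f
  proof -
    have "f \<in> L2 (halfline (source_weight b c))" using that by (simp only: source_measure_halfline)
    from halfline_truncation[OF this] show ?thesis unfolding source_measure_halfline
      by (intro exI[of _ "\<lambda>n x. indicator {0..real n} x * f x"] conjI allI)
  qed
  show "T (\<lambda>x. \<alpha> * f x + \<beta> * g x) y = \<alpha> * T f y + \<beta> * T g y" 
    if "f \<in> L2_compact_support M" "g \<in> L2_compact_support M" for f g \<alpha> \<beta> y
    using that by (intro T_lincomb D2_L1 compact_support_D2)
qed (use T_D2_isometry compact_support_D2 in auto)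

end

section \<open>Surjectivity and the inverse transform\<close>

context index_hypergeometric
begin

text \<open>Powers of 1/(1+x) do not have compact support, so their image under the extension is not
  the integral by definition. Truncations converge in norm, and the isometry of \<open>T\<close> on
  \<open>D2\<close> carries this over to the transforms.\<close>

lemma U_eq_T_D2:
  assumes p: "p \<in> D2" shows "AE s in N. J.U p s = T p s"
proof -
  have pL: "p \<in> L2 (halfline (source_weight b c))" using D2_L2[OF p] by (simp only: source_measure_halfline)
  define t where "t n x = indicator {0..real n} x * p x" for n x
  have t: "t n \<in> L2_compact_support M" "L2_tendsto M t p" for n
    using halfline_truncation[OF pL] unfolding source_measure_halfline t_def[abs_def] by blast+
  have "L2_tendsto N (\<lambda>n. T (t n)) (T p)"
  proof (rule L2_tendstoI_le[where e = "\<lambda>n. sqrt (2 * pi) * L2_norm M (\<lambda>x. t n x - p x)"])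
    fix n
    have D: "t n \<in> D2" by (rule compact_support_D2[OF t(1)])
    have "T (\<lambda>x. 1 * t n x + (-1) * p x) s = 1 * T (t n) s + (-1) * T p s" for s
      by (intro T_lincomb D2_L1 D p)
    hence "L2_norm N (\<lambda>s. T (t n) s - T p s) = L2_norm N (T (\<lambda>x. 1 * t n x + (-1) * p x))"
      by (intro L2_norm_cong) simp
    also have "\<dots> = sqrt (2 * pi) * L2_norm M (\<lambda>x. 1 * t n x + (-1) * p x)"
      by (intro T_D2_isometry D2_lincomb D p)
    finally show "L2_norm N (\<lambda>s. T (t n) s - T p s) \<le> sqrt (2 * pi) * L2_norm M (\<lambda>x. t n x - p x)" by simp
    show "T (t n) \<in> L2 N" "T p \<in> L2 N" by (intro T_D2_isometry D p)+
  next
    show "(\<lambda>n. sqrt (2 * pi) * L2_norm M (\<lambda>x. t n x - p x)) \<longlonglongrightarrow> 0"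
      by (rule tendsto_mult_right_zero[OF L2_tendstoD(3)[OF t(2)]])
  qed
  thus ?thesis by (rule J.U_unique[OF t])
qed

section \<open>The range of the transform\<close>

definition in_range :: "(real \<Rightarrow> complex) \<Rightarrow> bool" where
  "in_range g \<longleftrightarrow> g \<in> L2 N \<and> (\<exists>f\<in>L2 M. AE s in N. J.U f s = g s)"

lemma in_range_AE: "in_range g \<Longrightarrow> h \<in> L2 N \<Longrightarrow> AE s in N. g s = h s \<Longrightarrow> in_range h"
  unfolding in_range_def by (auto elim!: eventually_elim2 bexI[rotated])

lemma in_range_lincomb:
  assumes "in_range g" "in_range h" shows "in_range (\<lambda>s. \<alpha> * g s + \<beta> * h s)"
proof -
  from assms obtain f k where f: "f \<in> L2 M" "AE s in N. J.U f s = g s" and k: "k \<in> L2 M" "AE s in N. J.U k s = h s"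
    and gh: "g \<in> L2 N" "h \<in> L2 N" unfolding in_range_def by blast
  have "AE s in N. J.U (\<lambda>x. \<alpha> * f x + \<beta> * k x) s = \<alpha> * g s + \<beta> * h s"
    using J.U_lin[OF f(1) k(1), of \<alpha> \<beta>] f(2) k(2) by eventually_elim simp
  thus ?thesis unfolding in_range_def using L2_lincomb[OF f(1) k(1)] L2_lincomb[OF gh] by blast
qed

lemma in_range_cmult: "in_range g \<Longrightarrow> in_range (\<lambda>s. \<alpha> * g s)"
  using in_range_lincomb[of g g \<alpha> 0] by simp

lemma in_range_T: assumes "p \<in> D2" shows "in_range (T p)"
  unfolding in_range_def using U_eq_T_D2[OF assms] T_D2_isometry(1)[OF assms] D2_L2[OF assms] by blast

lemma in_range_zero: "in_range (\<lambda>_. 0)"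
  using in_range_cmult[OF in_range_T[OF D2_zero], of 0] by simp

lemma in_range_sum: "(\<And>i. i \<in> I \<Longrightarrow> in_range (g i)) \<Longrightarrow> in_range (\<lambda>s. \<Sum>i\<in>I. a i * g i s)"
proof (induction I rule: infinite_finite_induct)
  case (insert i I)
  thus ?case using in_range_lincomb[of "g i" "\<lambda>s. \<Sum>i\<in>I. a i * g i s" "a i" 1] by simp
qed (auto simp: in_range_zero)

lemma in_range_lim: "L2_tendsto N F g \<Longrightarrow> (\<And>n. in_range (F n)) \<Longrightarrow> in_range g"
  unfolding in_range_def using J.range_closed[of F g] L2_tendstoD(2)[of N F g] by blast

lemma in_range_gam_sq: "in_range (\<lambda>s. of_real (gam_sq n s))"
proof -
  have "in_range (\<lambda>s. of_real (gam_denom n) * T (shifted_power n) s)" by (intro in_range_cmult in_range_T shifted_power_D2)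
  thus ?thesis using gam_denom_pos[of n] by (simp add: T_shifted_power)
qed

text \<open>Multiplication by this function is a resolvent of multiplication by s^2. The constant
  matches the lowest power: the functional equation gives
  \<open>resolvent s * gam_sq (Suc 0) s = gam_sq 0 s\<close>.\<close>

definition resolvent :: "real \<Rightarrow> real" where "resolvent s = 1 / (s\<^sup>2 + (b + 1)\<^sup>2)"

lemma resolvent_meas [measurable]: "resolvent \<in> borel_measurable borel" unfolding resolvent_def by measurable

lemma resolvent_denom: "s\<^sup>2 + (b + 1)\<^sup>2 \<ge> 1"
proof -
  have "(b + 1)\<^sup>2 \<ge> 1\<^sup>2" using b by (intro power_mono) auto
  thus ?thesis by (simp add: add_increasing)
qed

lemma resolvent_01: "resolvent s \<in> {0..1}"
  using resolvent_denom[of s] by (auto simp: resolvent_def)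

lemma resolvent_mult: "resolvent s * (s\<^sup>2 + (b + 1)\<^sup>2) = 1"
proof -
  have "s\<^sup>2 + (b + 1)\<^sup>2 \<noteq> 0" using resolvent_denom[of s] by linarith
  thus ?thesis by (simp add: resolvent_def)
qed

lemma gam_sq_Suc: "gam_sq (Suc n) s = ((b + 1 + real n)\<^sup>2 + s\<^sup>2) * gam_sq n s"
proof -
  have "b + 1 + real (Suc n) = (b + 1 + real n) + 1" by simp
  thus ?thesis unfolding gam_sq_def using cmod_gam_plus1[OF b1n_pos, of n s] by (simp only:)
qed

text \<open>The factor raising the index splits as (s^2 + (b+1)^2) + d with a constant d. The
  resolvent cancels the first summand, and the second leads back to the preceding index.\<close>

lemma in_range_resolvent_gam_sq: "in_range (\<lambda>s. of_real (resolvent s * gam_sq (Suc n) s))"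
proof (induction n)
  case 0
  have "resolvent s * gam_sq (Suc 0) s = gam_sq 0 s" for s
  proof -
    have "resolvent s * gam_sq (Suc 0) s = (resolvent s * (s\<^sup>2 + (b + 1)\<^sup>2)) * gam_sq 0 s" unfolding gam_sq_Suc by (simp add: algebra_simps)
    thus ?thesis unfolding resolvent_mult by simp
  qed
  thus ?case using in_range_gam_sq[of 0] by simp
next
  case (Suc n)
  define d where "d = (b + 1 + real (Suc n))\<^sup>2 - (b + 1)\<^sup>2"
  have "resolvent s * gam_sq (Suc (Suc n)) s = gam_sq (Suc n) s + d * (resolvent s * gam_sq (Suc n) s)" for s
  proof -
    have "resolvent s * gam_sq (Suc (Suc n)) s = resolvent s * ((s\<^sup>2 + (b + 1)\<^sup>2) + d) * gam_sq (Suc n) s" 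
      unfolding gam_sq_Suc[of "Suc n"] by (simp add: d_def add_ac)
    also have "\<dots> = (resolvent s * (s\<^sup>2 + (b + 1)\<^sup>2)) * gam_sq (Suc n) s + d * (resolvent s * gam_sq (Suc n) s)" by (simp add: algebra_simps)
    finally show ?thesis unfolding resolvent_mult by simp
  qed
  thus ?case using in_range_lincomb[OF in_range_gam_sq[of "Suc n"] Suc, of 1 "of_real d"] by simp
qed

lemma resolvent_L2: "g \<in> L2 N \<Longrightarrow> (\<lambda>s. of_real (resolvent s) * g s) \<in> L2 N" 
  and resolvent_l2n: "g \<in> L2 N \<Longrightarrow> L2_norm N (\<lambda>s. of_real (resolvent s) * g s) \<le> L2_norm N g"
proof -
  assume g: "g \<in> L2 N"
  have le: "cmod (of_real (resolvent s) * g s) \<le> cmod (g s)" for s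
    using mult_right_mono[of "resolvent s" 1 "cmod (g s)"] resolvent_01[of s] by (simp add: norm_mult)
  have "(\<lambda>s. complex_of_real (resolvent s)) \<in> borel_measurable N" by (rule measurable_N) measurable
  hence "(\<lambda>s. of_real (resolvent s) * g s) \<in> borel_measurable N" using L2_measurable[OF g] by measurable
  thus L: "(\<lambda>s. of_real (resolvent s) * g s) \<in> L2 N"
    by (rule L2_dominated[OF g, where C = 1]) (use le in simp)
  show "L2_norm N (\<lambda>s. of_real (resolvent s) * g s) \<le> L2_norm N g"
    unfolding L2_norm_def by (rule real_sqrt_le_mono, rule integral_mono) 
      (use L2_integrable[OF L] L2_integrable[OF g] le in \<open>auto intro: power_mono\<close>)
qed

text \<open>Invariance is checked on a dense set of preimages. It passes to limits because the
  resolvent is bounded by 1 and the range is closed.\<close>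

lemma in_range_mult_resolvent: assumes "in_range g" shows "in_range (\<lambda>s. of_real (resolvent s) * g s)"
proof -
  from assms obtain f where f: "f \<in> L2 M" "AE s in N. J.U f s = g s" and gL: "g \<in> L2 N" unfolding in_range_def by blast
  \<comment> \<open>The weight v^2 u starts with the power n = 1, the lowest one whose transform is
    known to stay in the range when multiplied by the resolvent.\<close>
  define w where "w x = (v x)\<^sup>2 * u x" for x
  have w_meas: "w \<in> borel_measurable borel" unfolding w_def by measurable
  have w_pos: "w x > 0" if "x \<ge> 0" for x using that v_pos[OF that] by (simp add: w_def u_def)
  have fam1: "shifted_power (Suc n) x = of_real (w x) * of_real (u x) ^ n" if "x \<ge> 0" for n x
    using that by (simp add: shifted_power_eq w_def)
  have wL: "(\<lambda>x. complex_of_real (w x)) \<in> L2 (halfline (source_weight b c))"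
    using D2_L2[OF shifted_power_D2, of "Suc 0"] fam1[of _ 0] L2_cong[of M "shifted_power (Suc 0)" "\<lambda>x. complex_of_real (w x)"]
    by (simp add: source_measure_halfline)
  have fL: "f \<in> L2 (halfline (source_weight b c))" using f(1) by (simp only: source_measure_halfline)
  have inv: "1 / u x - 1 = x" if "x \<ge> 0" for x using that by (simp add: u_def)
  have "(\<lambda>y. 1 / y - 1 :: real) \<in> borel_measurable borel" by measurable
  from halfline_weighted_dense[OF w_meas u_meas this w_pos wL u_01 inv fL]
  obtain P where P: "\<And>n. L2_norm M (\<lambda>x. f x - of_real (w x) * poly (P n) (of_real (u x))) \<le> inverse (real (Suc n))"
    unfolding source_measure_halfline by blast
  define q where "q n x = (\<Sum>k\<le>degree (P n). coeff (P n) k * shifted_power (Suc k) x)" for n x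
  have q_D2: "q n \<in> D2" for n unfolding q_def[abs_def] by (intro D2_sum shifted_power_D2)
  have q_eq: "q n x = of_real (w x) * poly (P n) (of_real (u x))" if "x \<in> space M" for n x
    using that by (simp add: q_def fam1 poly_altdef sum_distrib_left mult_ac)
  have q_lim: "L2_tendsto M q f"
  proof (rule L2_tendstoI_le[OF D2_L2[OF q_D2] f(1) _ LIMSEQ_inverse_real_of_nat])
    fix n
    have "L2_norm M (\<lambda>x. q n x - f x) = L2_norm M (\<lambda>x. f x - of_real (w x) * poly (P n) (of_real (u x)))"
      unfolding L2_norm_minus_commute[of M "q n"] by (rule L2_norm_cong) (simp add: q_eq)
    thus "L2_norm M (\<lambda>x. q n x - f x) \<le> inverse (real (Suc n))" using P[of n] by simp
  qed
  have T_q: "T (q n) s = (\<Sum>k\<le>degree (P n). coeff (P n) k * of_real (gam_sq (Suc k) s / gam_denom (Suc k)))" for n s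
    unfolding q_def[abs_def] by (subst T_sum) (auto simp: T_shifted_power intro: D2_L1 shifted_power_D2)
  have "in_range (\<lambda>s. of_real (resolvent s) * J.U (q n) s)" for n
  proof (rule in_range_AE)
    have "in_range (\<lambda>s. \<Sum>k\<le>degree (P n). (coeff (P n) k / of_real (gam_denom (Suc k))) * of_real (resolvent s * gam_sq (Suc k) s))"
      by (intro in_range_sum in_range_resolvent_gam_sq)
    moreover have "(\<Sum>k\<le>degree (P n). (coeff (P n) k / of_real (gam_denom (Suc k))) * of_real (resolvent s * gam_sq (Suc k) s)) = of_real (resolvent s) * T (q n) s" for s
      unfolding T_q sum_distrib_left by (intro sum.cong refl) simp
    ultimately show "in_range (\<lambda>s. of_real (resolvent s) * T (q n) s)" by simp
    show "(\<lambda>s. of_real (resolvent s) * J.U (q n) s) \<in> L2 N" by (intro resolvent_L2 J.U_L2 D2_L2 q_D2)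
    show "AE s in N. of_real (resolvent s) * T (q n) s = of_real (resolvent s) * J.U (q n) s"
      using U_eq_T_D2[OF q_D2[of n]] by eventually_elim simp
  qed
  moreover have "L2_tendsto N (\<lambda>n s. of_real (resolvent s) * J.U (q n) s) (\<lambda>s. of_real (resolvent s) * J.U f s)"
  proof (rule L2_tendstoI_le)
    note L = J.U_tendsto[OF q_lim]
    show "(\<lambda>s. of_real (resolvent s) * J.U (q n) s) \<in> L2 N" "(\<lambda>s. of_real (resolvent s) * J.U f s) \<in> L2 N" for n
      by (intro resolvent_L2 J.U_L2 D2_L2 q_D2 f(1))+
    show "(\<lambda>n. L2_norm N (\<lambda>s. J.U (q n) s - J.U f s)) \<longlonglongrightarrow> 0" by (rule L2_tendstoD(3)[OF L])
    show "L2_norm N (\<lambda>s. of_real (resolvent s) * J.U (q n) s - of_real (resolvent s) * J.U f s) \<le> L2_norm N (\<lambda>s. J.U (q n) s - J.U f s)" for n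
      using resolvent_l2n[OF L2_diff[OF L2_tendstoD(1,2)[OF L], of n]] by (simp add: right_diff_distrib)
  qed
  ultimately have "in_range (\<lambda>s. of_real (resolvent s) * J.U f s)" by (rule in_range_lim[rotated])
  thus ?thesis
    by (rule in_range_AE) (use f(2) resolvent_L2[OF gL] in \<open>auto elim: eventually_mono\<close>)
qed

text \<open>The density argument of the source side applies on the spectral side with the positive
  square-integrable weight \<open>gam_sq 0\<close> and the generator \<open>resolvent\<close>, which
  is inverted on s \<ge> 0 by \<open>sqrt (1 / y - (b + 1)\<^sup>2)\<close>.\<close>

lemma in_range_all: assumes g: "g \<in> L2 N" shows "in_range g"
proof -
  have in_range_pow: "in_range (\<lambda>s. of_real (resolvent s) ^ k * of_real (gam_sq 0 s))" for k
  proof (induction k)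
    case (Suc k)
    from in_range_mult_resolvent[OF this] show ?case by (simp add: mult.assoc)
  qed (use in_range_gam_sq[of 0] in simp)
  have inv: "sqrt (1 / resolvent s - (b + 1)\<^sup>2) = s" if "s \<ge> 0" for s
    using that by (simp add: resolvent_def)
  have m: "(\<lambda>y. sqrt (1 / y - (b + 1)\<^sup>2)) \<in> borel_measurable borel" by measurable
  have GL: "(\<lambda>s. complex_of_real (gam_sq 0 s)) \<in> L2 (halfline (spectral_weight b c))"
    and gL: "g \<in> L2 (halfline (spectral_weight b c))" using gam_sq_L2[of 0] g by (simp_all only: spectral_measure_halfline)
  from halfline_weighted_dense[OF gam_sq_meas resolvent_meas m gam_sq_pos GL resolvent_01 inv gL]
  obtain P where P: "\<And>n. L2_norm N (\<lambda>s. g s - of_real (gam_sq 0 s) * poly (P n) (of_real (resolvent s))) \<le> inverse (real (Suc n))"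
    unfolding spectral_measure_halfline by blast
  have VP: "in_range (\<lambda>s. of_real (gam_sq 0 s) * poly (P n) (of_real (resolvent s)))" for n
  proof -
    have "in_range (\<lambda>s. \<Sum>k\<le>degree (P n). coeff (P n) k * (of_real (resolvent s) ^ k * of_real (gam_sq 0 s)))" by (intro in_range_sum in_range_pow)
    thus ?thesis by (simp add: poly_altdef sum_distrib_left mult_ac)
  qed
  show ?thesis
  proof (rule in_range_lim[OF _ VP])
    show "L2_tendsto N (\<lambda>n s. of_real (gam_sq 0 s) * poly (P n) (of_real (resolvent s))) g"
    proof (rule L2_tendstoI_le[OF _ g _ LIMSEQ_inverse_real_of_nat])
      show "(\<lambda>s. of_real (gam_sq 0 s) * poly (P n) (of_real (resolvent s))) \<in> L2 N" for n using VP by (simp add: in_range_def)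
      show "L2_norm N (\<lambda>s. of_real (gam_sq 0 s) * poly (P n) (of_real (resolvent s)) - g s) \<le> inverse (real (Suc n))" for n
        using P[of n] by (subst L2_norm_minus_commute)
    qed
  qed
qed

lemma U_surj: "g \<in> L2 N \<Longrightarrow> \<exists>f\<in>L2 M. AE s in N. J.U f s = g s"
  using in_range_all unfolding in_range_def by blast

section \<open>The inverse integral as an adjoint\<close>

lemma compact_support_N:
  assumes g: "g \<in> L2_compact_support N"
  shows "integrable N g" "\<exists>B\<ge>0. \<forall>s\<in>space N. g s \<noteq> 0 \<longrightarrow> kernel_bound s \<le> B"
proof -
  from g obtain K where K: "compact K" "\<And>s. s \<in> space N - K \<Longrightarrow> g s = 0" and L: "g \<in> L2 N"
    unfolding L2_compact_support_def by blast
  from kernel_bound_bounded[OF K(1)] K(2) show "\<exists>B\<ge>0. \<forall>s\<in>space N. g s \<noteq> 0 \<longrightarrow> kernel_bound s \<le> B" by blast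
  have KM: "K \<in> sets borel" using K(1) by (simp add: borel_closed compact_imp_closed)
  \<comment> \<open>On a compact set the indicator is at most a multiple of the positive continuous
    function \<open>gam_sq 0\<close>, which is square-integrable. So the indicator is in L2, and
    Cauchy-Schwarz makes \<open>g\<close> integrable.\<close>
  have "isCont (gam_sq 0) s" for s unfolding gam_sq_def using b1n_pos[of 0] by (intro continuous_intros continuous_gam)
  hence "isCont (\<lambda>s. 1 / gam_sq 0 s) s" for s using gam_sq_pos[of 0 s] by (intro continuous_intros) auto
  hence "compact ((\<lambda>s. 1 / gam_sq 0 s) ` K)" by (intro compact_continuous_image K(1) continuous_at_imp_continuous_on ballI)
  hence "bounded ((\<lambda>s. 1 / gam_sq 0 s) ` K)" by (rule compact_imp_bounded)
  then obtain B where B: "B > 0" "\<And>s. s \<in> K \<Longrightarrow> norm (1 / gam_sq 0 s) \<le> B" unfolding bounded_pos by blast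
  have "(\<lambda>s. indicator K s :: complex) \<in> L2 N"
  proof (rule L2_dominated[OF gam_sq_L2, where C = B])
    show "(\<lambda>s. indicator K s :: complex) \<in> borel_measurable N" by (rule measurable_N) (use KM in measurable)
    show "AE s in N. cmod (indicator K s) \<le> B * cmod (complex_of_real (gam_sq 0 s))"
    proof (rule AE_I2)
      fix s
      show "cmod (indicator K s) \<le> B * cmod (complex_of_real (gam_sq 0 s))"
        using B(1) B(2)[of s] gam_sq_pos[of 0 s] by (cases "s \<in> K") (simp_all add: field_simps)
    qed
  qed
  hence "integrable N (\<lambda>s. g s * indicator K s)" by (rule L2_integrable_mult[OF L])
  moreover have "integrable N (\<lambda>s. g s * indicator K s) \<longleftrightarrow> integrable N g"
    by (rule Bochner_Integration.integrable_cong) (use K(2) in \<open>auto simp: indicator_def\<close>)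
  ultimately show "integrable N g" by simp
qed

lemma T'_measurable: "g \<in> borel_measurable N \<Longrightarrow> T' g \<in> borel_measurable M"
proof -
  assume [measurable]: "g \<in> borel_measurable N"
  have [measurable]: "(\<lambda>(x, s). \<phi> s x) \<in> borel_measurable (M \<Otimes>\<^sub>M N)"
    using measurable_pair_swap[OF \<phi>_pair] by simp
  have "(\<lambda>(x, s). g s * \<phi> s x) \<in> borel_measurable (M \<Otimes>\<^sub>M N)" by measurable
  from NM.M1.borel_measurable_lebesgue_integral[OF this]
  have "(\<lambda>x. of_real (1 / (2 * pi)) * of_real (1 / Gamma (b + c)) * (\<integral>s. g s * \<phi> s x \<partial>N)) \<in> borel_measurable M" by measurable
  thus ?thesis by (subst measurable_cong) (auto simp: T'_eq(1)[OF \<open>g \<in> borel_measurable N\<close>])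
qed

lemma integrable_g_\<phi>:
  assumes g: "g \<in> L2_compact_support N" and x: "x \<ge> 0"
  shows "integrable N (\<lambda>s. g s * \<phi> s x)"
proof -
  obtain B where B: "B \<ge> 0" "\<And>s. s \<in> space N \<Longrightarrow> g s \<noteq> 0 \<Longrightarrow> kernel_bound s \<le> B" using compact_support_N(2)[OF g] by blast
  note gi = compact_support_N(1)[OF g]
  show ?thesis
  proof (rule Bochner_Integration.integrable_bound[of N "\<lambda>s. B *\<^sub>R g s"])
    show "integrable N (\<lambda>s. B *\<^sub>R g s)" using gi by simp
    show "(\<lambda>s. g s * \<phi> s x) \<in> borel_measurable N" using gi \<phi>_measurable2[OF x] by (intro borel_measurable_times) auto
    show "AE s in N. norm (g s * \<phi> s x) \<le> norm (B *\<^sub>R g s)"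
    proof (rule AE_I2)
      fix s assume s: "s \<in> space N"
      show "norm (g s * \<phi> s x) \<le> norm (B *\<^sub>R g s)"
      proof (cases "g s = 0")
        case False
        have "norm (\<phi> s x) \<le> B" using \<phi>_bound[OF x, of s] B(2)[OF s False] by linarith
        thus ?thesis using B(1) by (simp add: norm_mult mult.commute[of "cmod (g s)"] mult_right_mono)
      qed simp
    qed
  qed
qed

lemma T'_lincomb:
  assumes "f \<in> L2_compact_support N" "g \<in> L2_compact_support N" "x \<ge> 0"
  shows "T' (\<lambda>s. \<alpha> * f s + \<beta> * g s) x = \<alpha> * T' f x + \<beta> * T' g x"
proof -
  have [measurable]: "f \<in> borel_measurable N" "g \<in> borel_measurable N" 
    using compact_support_N(1)[OF assms(1)] compact_support_N(1)[OF assms(2)] by auto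
  note i = integrable_g_\<phi>[OF assms(1,3)] integrable_g_\<phi>[OF assms(2,3)]
  have "(\<integral>s. (\<alpha> * f s + \<beta> * g s) * \<phi> s x \<partial>N) = (\<integral>s. \<alpha> * (f s * \<phi> s x) + \<beta> * (g s * \<phi> s x) \<partial>N)"
    by (simp add: algebra_simps)
  also have "\<dots> = \<alpha> * (\<integral>s. f s * \<phi> s x \<partial>N) + \<beta> * (\<integral>s. g s * \<phi> s x \<partial>N)" using i by simp
  finally have e: "(\<integral>s. (\<alpha> * f s + \<beta> * g s) * \<phi> s x \<partial>N) = \<alpha> * (\<integral>s. f s * \<phi> s x \<partial>N) + \<beta> * (\<integral>s. g s * \<phi> s x \<partial>N)" .
  have m: "(\<lambda>s. \<alpha> * f s + \<beta> * g s) \<in> borel_measurable N" by measurable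
  show ?thesis unfolding T'_eq(1)[OF m assms(3)] e
    by (simp add: T'_eq(1)[OF _ assms(3)] algebra_simps)
qed

lemma T'_bounded:
  assumes g: "g \<in> L2_compact_support N"
  shows "\<exists>Q. \<forall>x\<ge>0. norm (T' g x) \<le> Q"
proof -
  obtain B where B: "B \<ge> 0" "\<And>s. s \<in> space N \<Longrightarrow> g s \<noteq> 0 \<Longrightarrow> kernel_bound s \<le> B" using compact_support_N(2)[OF g] by blast
  note gi = compact_support_N(1)[OF g]
  have gm: "g \<in> borel_measurable N" using gi by auto
  let ?a = "complex_of_real (1 / (2 * pi)) * of_real (1 / Gamma (b + c))"
  have "norm (T' g x) \<le> norm ?a * (\<integral>s. B * norm (g s) \<partial>N)" if x: "x \<ge> 0" for x
  proof -
    have "norm (\<integral>s. g s * \<phi> s x \<partial>N) \<le> (\<integral>s. norm (g s * \<phi> s x) \<partial>N)" by (rule integral_norm_bound)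
    also have "\<dots> \<le> (\<integral>s. B * norm (g s) \<partial>N)"
    proof (rule integral_mono)
      show "integrable N (\<lambda>s. norm (g s * \<phi> s x))" by (rule integrable_norm[OF integrable_g_\<phi>[OF g x]])
      show "integrable N (\<lambda>s. B * norm (g s))" using gi by simp
      fix s assume s: "s \<in> space N"
      show "norm (g s * \<phi> s x) \<le> B * norm (g s)"
      proof (cases "g s = 0")
        case False
        have "norm (\<phi> s x) \<le> B" using \<phi>_bound[OF x, of s] B(2)[OF s False] by linarith
        thus ?thesis by (simp add: norm_mult mult.commute[of "cmod (g s)"] mult_right_mono)
      qed simp
    qed
    finally show ?thesis unfolding T'_eq(1)[OF gm x] norm_mult[of ?a] by (intro mult_left_mono) auto
  qed
  thus ?thesis by blast
qed

text \<open>The kernel is bounded on the support of \<open>g\<close>, so a multiple of g(s) h(x)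
  dominates the double integrand and Fubini applies. Reality of the kernel turns
  \<open>cnj (T h s)\<close> into an integral against the same kernel.\<close>

lemma T_T'_adjoint:
  assumes g: "g \<in> L2_compact_support N" and h: "integrable M h"
  shows "(\<integral>x. T' g x * cnj (h x) \<partial>M) = of_real (1 / (2 * pi)) * (\<integral>s. g s * cnj (T h s) \<partial>N)"
proof -
  obtain B where B: "B \<ge> 0" "\<And>s. s \<in> space N \<Longrightarrow> g s \<noteq> 0 \<Longrightarrow> kernel_bound s \<le> B" using compact_support_N(2)[OF g] by blast
  note gi = compact_support_N(1)[OF g]
  have [measurable]: "g \<in> borel_measurable N" "h \<in> borel_measurable M" using gi h by auto
  define F where "F s x = g s * \<phi> s x * cnj (h x)" for s x
  have prod: "integrable (N \<Otimes>\<^sub>M M) (\<lambda>(s, x). g s * h x)"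
  proof (rule NM.Fubini_integrable)
    show "(\<lambda>(s, x). g s * h x) \<in> borel_measurable (N \<Otimes>\<^sub>M M)" by measurable
    have "integrable N (\<lambda>s. norm (g s) * (\<integral>x. norm (h x) \<partial>M))"
      by (intro integrable_mult_left integrable_norm gi)
    thus "integrable N (\<lambda>s. \<integral>x. norm (case (s, x) of (s, x) \<Rightarrow> g s * h x) \<partial>M)" 
      by (simp add: norm_mult)
    show "AE s in N. integrable M (\<lambda>x. case (s, x) of (s, x) \<Rightarrow> g s * h x)"
      by (intro AE_I2) (simp add: integrable_mult_right h)
  qed
  have F_int: "integrable (N \<Otimes>\<^sub>M M) (case_prod F)"
  proof (rule Bochner_Integration.integrable_bound[of _ "\<lambda>z. B *\<^sub>R (case z of (s, x) \<Rightarrow> g s * h x)"])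
    show "integrable (N \<Otimes>\<^sub>M M) (\<lambda>z. B *\<^sub>R (case z of (s, x) \<Rightarrow> g s * h x))" using prod by simp
    have "(\<lambda>z. g (fst z) * (case z of (s, x) \<Rightarrow> \<phi> s x) * cnj (h (snd z))) \<in> borel_measurable (N \<Otimes>\<^sub>M M)"
      by measurable
    thus "case_prod F \<in> borel_measurable (N \<Otimes>\<^sub>M M)" by (simp add: F_def[abs_def] split_beta')
    show "AE z in N \<Otimes>\<^sub>M M. norm (case_prod F z) \<le> norm (B *\<^sub>R (case z of (s, x) \<Rightarrow> g s * h x))"
    proof (rule AE_I2)
      fix z assume "z \<in> space (N \<Otimes>\<^sub>M M)"
      then obtain s x where z: "z = (s, x)" "s \<in> space N" "x \<ge> 0" by (auto simp: space_pair_measure)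
      have "norm (F s x) \<le> B * norm (g s * h x)"
      proof (cases "g s = 0")
        case False
        have "norm (\<phi> s x) \<le> B" using \<phi>_bound[OF z(3), of s] B(2)[OF z(2) False] by linarith
        hence "norm (\<phi> s x) * norm (g s * h x) \<le> B * norm (g s * h x)" by (rule mult_right_mono) simp
        thus ?thesis by (simp add: F_def norm_mult mult_ac)
      qed (simp add: F_def)
      thus "norm (case_prod F z) \<le> norm (B *\<^sub>R (case z of (s, x) \<Rightarrow> g s * h x))" using z(1) B(1) by simp
    qed
  qed
  let ?a = "complex_of_real (1 / (2 * pi))" and ?A = "complex_of_real (1 / Gamma (b + c))"
  have 1: "T' g x * cnj (h x) = ?a * ?A * (\<integral>s. F s x \<partial>N)" if "x \<in> space M" for x
  proof -
    have "(\<integral>s. F s x \<partial>N) = (\<integral>s. g s * \<phi> s x \<partial>N) * cnj (h x)" unfolding F_def by (rule integral_mult_left_zero)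
    thus ?thesis using that by (subst T'_eq(1)) (auto simp: mult.assoc)
  qed
  have 2: "g s * cnj (T h s) = ?A * (\<integral>x. F s x \<partial>M)" for s
  proof -
    have "cnj (T h s) = ?A * cnj (\<integral>x. h x * \<phi> s x \<partial>M)"
      by (subst T_eq) auto
    also have "cnj (\<integral>x. h x * \<phi> s x \<partial>M) = (\<integral>x. cnj (h x * \<phi> s x) \<partial>M)"
      by (rule Bochner_Integration.integral_cnj[symmetric])
    also have "(\<integral>x. cnj (h x * \<phi> s x) \<partial>M) = (\<integral>x. \<phi> s x * cnj (h x) \<partial>M)"
      by (rule Bochner_Integration.integral_cong[OF refl]) (simp add: cnj_index_kernel[OF b c])
    finally show ?thesis unfolding F_def mult.assoc by simp
  qed
  have "(\<integral>x. T' g x * cnj (h x) \<partial>M) = (\<integral>x. ?a * ?A * (\<integral>s. F s x \<partial>N) \<partial>M)"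
    by (rule Bochner_Integration.integral_cong[OF refl 1])
  also have "\<dots> = ?a * ?A * (\<integral>x. \<integral>s. F s x \<partial>N \<partial>M)" by (rule integral_mult_right_zero)
  also have "(\<integral>x. \<integral>s. F s x \<partial>N \<partial>M) = (\<integral>s. \<integral>x. F s x \<partial>M \<partial>N)" by (rule NM.Fubini_integral[OF F_int])
  also have "?a * ?A * \<dots> = ?a * (\<integral>s. g s * cnj (T h s) \<partial>N)" unfolding 2 by simp
  finally show ?thesis .
qed

text \<open>For a test function h of compact support, adjointness gives <T'g, h> = <g, Th>/(2 pi),
  and the inner product law gives <Uf, Uh> = 2 pi <f, h>; as Uf = g, both T'g and f have the same
  product with h. Testing with the truncated difference of the two makes its norm vanish.\<close>

lemma T'_inverse:
  assumes g: "g \<in> L2_compact_support N" and f: "f \<in> L2 M" "AE s in N. J.U f s = g s"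
  shows "T' g \<in> L2 M" "AE x in M. T' g x = f x"
proof -
  have gL: "g \<in> L2 N" using g by (simp add: L2_compact_support_def)
  obtain Q where Q: "\<And>x. x \<ge> 0 \<Longrightarrow> norm (T' g x) \<le> Q" using T'_bounded[OF g] by blast
  have m: "T' g \<in> borel_measurable M" by (rule T'_measurable[OF L2_measurable[OF gL]])
  \<comment> \<open>At this point \<open>T' g\<close> is only known to be bounded, so the difference
    is cut off to obtain a square-integrable test function.\<close>
  define h where "h n x = indicator {0..real n} x * (T' g x - f x)" for n x
  have [measurable]: "(\<lambda>x. indicator {0..real n} x :: complex) \<in> borel_measurable M" for n
    by (rule measurable_M) measurable
  have h_cs: "h n \<in> L2_compact_support M" for n
  proof -
    have "(\<lambda>x. indicator {0..real n} x * T' g x) \<in> L2 M"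
    \<comment> \<open>On [0,n] one has 1 = wt x v x \<le> wt n v x, which turns the constant bound
      \<open>Q\<close> into a multiple of the square-integrable \<open>v\<close>.\<close>
    proof (rule L2_dominated[OF v_L2, where C = "Q * wt (real n)"])
      show "(\<lambda>x. indicator {0..real n} x * T' g x) \<in> borel_measurable M" using m by measurable
      show "AE x in M. cmod (indicator {0..real n} x * T' g x) \<le> Q * wt (real n) * cmod (of_real (v x))"
      proof (rule AE_I2)
        fix x assume "x \<in> space M"
        hence x: "x \<ge> 0" by simp
        have Q0: "Q \<ge> 0" using Q[OF x] norm_ge_zero order_trans by blast
        show "cmod (indicator {0..real n} x * T' g x) \<le> Q * wt (real n) * cmod (of_real (v x))"
        proof (cases "x \<le> real n")
          case True
          have "wt x \<le> wt (real n)" unfolding wt_def using x True b by (intro powr_mono2) auto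
          hence "wt x * v x \<le> wt (real n) * v x" using v_pos[OF x] by (intro mult_right_mono) auto
          hence "1 \<le> wt (real n) * v x" by (simp add: wt_v[OF x])
          hence "Q * 1 \<le> Q * (wt (real n) * v x)" using Q0 by (rule mult_left_mono)
          thus ?thesis using Q[OF x] True x v_pos[OF x] by (simp add: mult.assoc)
        next
          case False
          have "wt (real n) \<ge> 1" by (rule wt_ge_1) simp
          thus ?thesis using False Q0 by simp
        qed
      qed
    qed
    moreover have "(\<lambda>x. indicator {0..real n} x * f x) \<in> L2 M"
    proof (rule L2_dominated[OF f(1), where C = 1])
      show "(\<lambda>x. indicator {0..real n} x * f x) \<in> borel_measurable M" using L2_measurable[OF f(1)] by measurable
      show "AE x in M. cmod (indicator {0..real n} x * f x) \<le> 1 * cmod (f x)" by (intro AE_I2) (simp add: indicator_def)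
    qed
    ultimately have "h n \<in> L2 M" unfolding h_def[abs_def] right_diff_distrib by (rule L2_diff)
    thus ?thesis unfolding L2_compact_support_def by (auto intro!: exI[of _ "{0..real n}"] simp: h_def)
  qed
  have h0: "AE x in M. h n x = 0" for n
  proof -
    have hD: "h n \<in> D2" and hL: "h n \<in> L2 M" using compact_support_D2[OF h_cs] D2_L2 by auto
    have "AE s in N. J.U (h n) s = T (h n) s" by (rule J.U_eq_T[OF h_cs])
    hence "AE s in N. g s * cnj (T (h n) s) = J.U f s * cnj (J.U (h n) s)"
      using f(2) by eventually_elim simp
    hence "(\<integral>s. g s * cnj (T (h n) s) \<partial>N) = (\<integral>s. J.U f s * cnj (J.U (h n) s) \<partial>N)"
      using L2_integrable_mult[OF gL L2_cnj[OF T_D2_isometry(1)[OF hD]]] 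
        L2_integrable_mult[OF J.U_L2[OF f(1)] L2_cnj[OF J.U_L2[OF hL]]]
      by (intro integral_cong_AE) auto
    also have "\<dots> = of_real (2 * pi) * (\<integral>x. f x * cnj (h n x) \<partial>M)"
      using J.U_inner[OF f(1) hL] by simp
    finally have "(\<integral>x. T' g x * cnj (h n x) \<partial>M) = (\<integral>x. f x * cnj (h n x) \<partial>M)"
      unfolding T_T'_adjoint[OF g D2_L1(1)[OF hD]] by simp
    moreover have i1: "integrable M (\<lambda>x. f x * cnj (h n x))" by (intro L2_integrable_mult f(1) L2_cnj hL)
    moreover have sq: "integrable M (\<lambda>x. h n x * cnj (h n x))" by (intro L2_integrable_mult L2_cnj hL)
    moreover have pt: "T' g x * cnj (h n x) = h n x * cnj (h n x) + f x * cnj (h n x)" for x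
      by (simp add: h_def indicator_def algebra_simps)
    ultimately have "(\<integral>x. h n x * cnj (h n x) \<partial>M) = 0" by simp
    hence "(L2_norm M (h n))\<^sup>2 = 0" unfolding complex_norm_square[symmetric] integral_complex_of_real L2_norm_squared by simp
    thus ?thesis by (simp add: L2_norm_eq_0_iff[OF hL])
  qed
  have "AE x in M. \<forall>n. h n x = 0" using h0 by (simp add: AE_all_countable)
  moreover have "AE x in M. x \<ge> 0" by (rule AE_I2) simp
  ultimately show ae: "AE x in M. T' g x = f x"
  proof eventually_elim
    case (elim x)
    obtain n :: nat where "x \<le> real n" using real_arch_simple by blast
    thus ?case using elim(1)[rule_format, of n] elim(2) by (simp add: h_def)
  qed
  show "T' g \<in> L2 M" by (rule L2_dominated[OF f(1) m, where C = 1]) (use ae in \<open>auto elim: eventually_mono\<close>)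
qed

lemma L2_norm_U_eq:
  assumes "f \<in> L2 M" "k \<in> L2 M" "g \<in> L2 N" "h \<in> L2 N" "AE s in N. J.U f s = g s" "AE s in N. J.U k s = h s"
  shows "L2_norm N (\<lambda>s. g s - h s) = sqrt (2 * pi) * L2_norm M (\<lambda>x. f x - k x)"
proof -
  have "AE s in N. g s - h s = J.U f s - J.U k s" using assms(5,6) by eventually_elim simp
  hence "L2_norm N (\<lambda>s. g s - h s) = L2_norm N (\<lambda>s. J.U f s - J.U k s)"
    by (intro L2_norm_cong_AE L2_measurable[OF L2_diff] assms J.U_L2)
  thus ?thesis by (simp only: J.U_diff_norm[OF assms(1,2)])
qed

lemma T'_norm: 
  assumes g: "g \<in> L2_compact_support N" shows "L2_norm M (T' g) = 1 / sqrt (2 * pi) * L2_norm N g"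
proof -
  have gL: "g \<in> L2 N" using g by (simp add: L2_compact_support_def)
  obtain f where f: "f \<in> L2 M" "AE s in N. J.U f s = g s" using U_surj[OF gL] by blast
  note T' = T'_inverse[OF g f]
  have "L2_norm M (T' g) = L2_norm M f" by (rule L2_norm_cong_AE[OF L2_measurable[OF T'(1)] L2_measurable[OF f(1)] T'(2)])
  moreover have "L2_norm N g = L2_norm N (J.U f)" 
    by (rule L2_norm_cong_AE[OF L2_measurable[OF gL] L2_measurable[OF J.U_L2[OF f(1)]]]) (use f(2) in \<open>auto elim: eventually_mono\<close>)
  ultimately show ?thesis by (simp add: J.U_norm[OF f(1)])
qed

text \<open>Surjectivity enters here: every \<open>g\<close> is a transform up to a null set, so the
  inverse integral inherits the norm law with the reciprocal constant.\<close>

sublocale I: L2_isometry N M T' "1 / sqrt (2 * pi)"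
proof
  show "\<exists>h. (\<forall>n. h n \<in> L2_compact_support N) \<and> L2_tendsto N h f" if "f \<in> L2 N" for f
  proof -
    have "f \<in> L2 (halfline (spectral_weight b c))" using that by (simp only: spectral_measure_halfline)
    from halfline_truncation[OF this] show ?thesis unfolding spectral_measure_halfline
      by (intro exI[of _ "\<lambda>n x. indicator {0..real n} x * f x"] conjI allI)
  qed
  fix g assume g: "g \<in> L2_compact_support N"
  hence gL: "g \<in> L2 N" by (simp add: L2_compact_support_def)
  then obtain f where f: "f \<in> L2 M" "AE s in N. J.U f s = g s" using U_surj by blast
  show "T' g \<in> L2 M" by (rule T'_inverse[OF g f])
  show "L2_norm M (T' g) = 1 / sqrt (2 * pi) * L2_norm N g" by (rule T'_norm[OF g])
qed (auto intro: T'_lincomb)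

lemma T'_tendsto:
  assumes h: "\<And>n. h n \<in> L2_compact_support N" "L2_tendsto N h g" and f: "f \<in> L2 M" "AE s in N. J.U f s = g s"
  shows "L2_tendsto M (\<lambda>n. T' (h n)) f"
proof (rule L2_tendstoI_le[where e = "\<lambda>n. 1 / sqrt (2 * pi) * L2_norm N (\<lambda>s. h n s - g s)"])
  fix n
  have hL: "h n \<in> L2 N" using h(1)[of n] by (simp add: L2_compact_support_def)
  obtain k where k: "k \<in> L2 M" "AE s in N. J.U k s = h n s" using U_surj[OF hL] by blast
  note T' = T'_inverse[OF h(1)[of n] k]
  show "T' (h n) \<in> L2 M" by (rule T'(1))
  have "AE x in M. T' (h n) x - f x = k x - f x" using T'(2) by eventually_elim simp
  hence "L2_norm M (\<lambda>x. T' (h n) x - f x) = L2_norm M (\<lambda>x. k x - f x)"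
    by (intro L2_norm_cong_AE L2_measurable[OF L2_diff] T'(1) f(1) k(1))
  moreover have "L2_norm N (\<lambda>s. h n s - g s) = sqrt (2 * pi) * L2_norm M (\<lambda>x. k x - f x)"
    by (rule L2_norm_U_eq[OF k(1) f(1) hL L2_tendstoD(2)[OF h(2)] k(2) f(2)])
  ultimately show "L2_norm M (\<lambda>x. T' (h n) x - f x) \<le> 1 / sqrt (2 * pi) * L2_norm N (\<lambda>s. h n s - g s)" by simp
next
  show "(\<lambda>n. 1 / sqrt (2 * pi) * L2_norm N (\<lambda>s. h n s - g s)) \<longlonglongrightarrow> 0"
    by (rule tendsto_mult_right_zero[OF L2_tendstoD(3)[OF h(2)]])
qed (rule f(1))

lemma I_U_eq:
  assumes "f \<in> L2 M" "g \<in> L2 N" "AE s in N. J.U f s = g s" shows "AE x in M. I.U g x = f x"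
proof -
  from I.U_approx[OF assms(2)] obtain h where
    h: "\<And>n. h n \<in> L2_compact_support N" "L2_tendsto N h g" "L2_tendsto M (\<lambda>n. T' (h n)) (I.U g)" by blast
  from L2_tendsto_unique[OF h(3) T'_tendsto[OF h(1,2) assms(1,3)]] show ?thesis .
qed

text \<open>Truncating the transform in \<open>s\<close> gives inverse integrals that converge
  absolutely and tend to \<open>f\<close> in L2, hence almost everywhere along a subsequence. At
  points where the full integrand is integrable it dominates the truncated ones, and both limits
  coincide.\<close>

lemma pointwise_inversion:
  assumes f: "f \<in> L2 M"
  shows "AE x in M. integrable N (\<lambda>s. J.U f s * \<phi> s x) \<longrightarrow> 
     f x = of_real (1 / (2 * pi)) * of_real (1 / Gamma (b + c)) * (\<integral>s. J.U f s * \<phi> s x \<partial>N)"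
proof -
  define g where "g = J.U f"
  define h where "h n s = indicator {0..real n} s * g s" for n s
  have gL: "g \<in> L2 (halfline (spectral_weight b c))" using J.U_L2[OF f] by (simp only: g_def spectral_measure_halfline)
  have h: "h n \<in> L2_compact_support N" "L2_tendsto N h g" for n
    using halfline_truncation[OF gL] unfolding spectral_measure_halfline h_def[abs_def] by blast+
  have [measurable]: "g \<in> borel_measurable N" using L2_tendstoD(2)[OF h(2)] by (rule L2_measurable)
  have hm: "h n \<in> borel_measurable N" for n using L2_tendstoD(1)[OF h(2)] by (rule L2_measurable)
  have "L2_tendsto M (\<lambda>n. T' (h n)) f" by (rule T'_tendsto[OF h f]) (simp add: g_def)
  from L2_tendsto_AE_subseq[OF this] obtain r where 
    r: "strict_mono r" "AE x in M. (\<lambda>n. T' (h (r n)) x) \<longlonglongrightarrow> f x" by blast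
  have "AE x in M. x \<ge> 0" by (rule AE_I2) simp
  with r(2) show ?thesis
  proof eventually_elim
    case (elim x)
    show ?case
    proof
      assume int: "integrable N (\<lambda>s. J.U f s * \<phi> s x)"
      have "(\<lambda>n. \<integral>s. h n s * \<phi> s x \<partial>N) \<longlonglongrightarrow> (\<integral>s. g s * \<phi> s x \<partial>N)"
      proof (rule integral_dominated_convergence[where w = "\<lambda>s. norm (g s * \<phi> s x)"])
        show "(\<lambda>s. g s * \<phi> s x) \<in> borel_measurable N" "(\<lambda>s. h n s * \<phi> s x) \<in> borel_measurable N" for n
          using \<phi>_measurable2[OF elim(2)] hm by (auto intro!: borel_measurable_times)
        show "integrable N (\<lambda>s. norm (g s * \<phi> s x))" using int unfolding g_def by (rule integrable_norm)
        show "AE s in N. norm (h n s * \<phi> s x) \<le> norm (g s * \<phi> s x)" for n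
          by (intro AE_I2) (simp add: h_def indicator_def)
        show "AE s in N. (\<lambda>n. h n s * \<phi> s x) \<longlonglongrightarrow> g s * \<phi> s x"
        proof (rule AE_I2, rule tendsto_eventually)
          fix s assume s: "s \<in> space N"
          obtain m :: nat where m: "s \<le> real m" using real_arch_simple by blast
          have "h n s * \<phi> s x = g s * \<phi> s x" if "n \<ge> m" for n
            using that m s by (simp add: h_def indicator_def)
          thus "eventually (\<lambda>n. h n s * \<phi> s x = g s * \<phi> s x) sequentially" 
            unfolding eventually_sequentially by blast
        qed
      qed
      hence "(\<lambda>n. of_real (1 / (2 * pi)) * of_real (1 / Gamma (b + c)) * (\<integral>s. h n s * \<phi> s x \<partial>N)) 
         \<longlonglongrightarrow> of_real (1 / (2 * pi)) * of_real (1 / Gamma (b + c)) * (\<integral>s. g s * \<phi> s x \<partial>N)"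
        by (intro tendsto_mult tendsto_const)
      hence "(\<lambda>n. T' (h n) x) \<longlonglongrightarrow> of_real (1 / (2 * pi)) * of_real (1 / Gamma (b + c)) * (\<integral>s. g s * \<phi> s x \<partial>N)"
        by (simp only: T'_eq(1)[OF hm elim(2)])
      from LIMSEQ_subseq_LIMSEQ[OF this r(1)] 
      have "(\<lambda>n. T' (h (r n)) x) \<longlonglongrightarrow> of_real (1 / (2 * pi)) * of_real (1 / Gamma (b + c)) * (\<integral>s. g s * \<phi> s x \<partial>N)"
        by (simp add: o_def)
      with elim(1) show "f x = of_real (1 / (2 * pi)) * of_real (1 / Gamma (b + c)) * (\<integral>s. J.U f s * \<phi> s x \<partial>N)"
        unfolding g_def by (rule LIMSEQ_unique)
    qed
  qed
qed

section \<open>Weighted integrals, rescaling and the final statement\<close>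

lemma source_integral: 
  fixes f :: "real \<Rightarrow> complex"
  assumes "f \<in> borel_measurable M"
  shows "(LBINT x:{0..}. f x * of_real (source_weight b c x)) = (\<integral>x. f x \<partial>M)"
  using halfline_integral(2)[OF source_weight_measurable[of b c] source_weight_nonneg, where f = f] assms
  by (simp add: source_measure_halfline)

lemma spectral_integral: 
  fixes f :: "real \<Rightarrow> complex"
  assumes "f \<in> borel_measurable N"
  shows "(LBINT x:{0..}. f x * of_real (spectral_weight b c x)) = (\<integral>x. f x \<partial>N)"
  using halfline_integral(2)[OF spectral_weight_measurable[OF b c] spectral_weight_nonneg, where f = f] assms
  by (simp add: spectral_measure_halfline)

text \<open>Dividing the spectral measure by 2 pi removes the factor of the inner product law. A
  positive constant density changes neither null sets nor square-integrability, so the remaining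
  properties are those over the original measure.\<close>

lemma unitary_U: "unitary_L2 M (scale_measure (ennreal (1 / (2 * pi))) N) J.U"
proof -
  define N' where "N' = scale_measure (ennreal (1 / (2 * pi))) N"
  have N': "N' = density N (\<lambda>_. ennreal (1 / (2 * pi)))"
    unfolding N'_def by (rule measure_eqI) (simp_all add: emeasure_density_const)
  have AE: "(AE s in N'. P s) \<longleftrightarrow> (AE s in N. P s)" for P
    unfolding N' by (subst AE_density) auto
  have mN': "f \<in> borel_measurable N' \<longleftrightarrow> f \<in> borel_measurable N" for f :: "real \<Rightarrow> complex"
    unfolding N' by simp
  have sc: "integrable N (\<lambda>x. (1 / (2 * pi)) *\<^sub>R F x) \<longleftrightarrow> integrable N F" for F :: "real \<Rightarrow> real"
  proof
    assume "integrable N (\<lambda>x. (1 / (2 * pi)) *\<^sub>R F x)"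
    hence "integrable N (\<lambda>x. (2 * pi) *\<^sub>R ((1 / (2 * pi)) *\<^sub>R F x))" by (rule integrable_scaleR_right)
    thus "integrable N F" by simp
  qed (rule integrable_scaleR_right)
  have L2: "L2 N' = L2 N"
  proof (intro set_eqI)
    fix f :: "real \<Rightarrow> complex"
    have "integrable N' (\<lambda>x. (cmod (f x))\<^sup>2) \<longleftrightarrow> integrable N (\<lambda>x. (1 / (2 * pi)) *\<^sub>R (cmod (f x))\<^sup>2)" if "f \<in> borel_measurable N"
      unfolding N' using that by (intro integrable_density) auto
    thus "f \<in> L2 N' \<longleftrightarrow> f \<in> L2 N" unfolding L2_def sc by (auto simp: mN')
  qed
  have int: "(\<integral>x. f x \<partial>N') = of_real (1 / (2 * pi)) * (\<integral>x. f x \<partial>N)" if "f \<in> borel_measurable N" for f :: "real \<Rightarrow> complex"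
  proof -
    have "(\<integral>x. f x \<partial>N') = (\<integral>x. (1 / (2 * pi)) *\<^sub>R f x \<partial>N)"
      unfolding N' using that by (intro integral_density) auto
    thus ?thesis by (simp add: scaleR_conv_of_real)
  qed
  show ?thesis
    unfolding unitary_L2_def N'_def[symmetric] L2 AE
  proof (intro conjI ballI allI impI)
    fix f g assume fg: "f \<in> L2 M" "g \<in> L2 M"
    have "(\<lambda>y. J.U f y * cnj (J.U g y)) \<in> borel_measurable N"
      by (intro borel_measurable_times L2_measurable L2_cnj J.U_L2 fg)
    from int[OF this] show "(\<integral>y. J.U f y * cnj (J.U g y) \<partial>N') = (\<integral>x. f x * cnj (g x) \<partial>M)"
      by (simp add: J.U_inner[OF fg])
  qed (auto intro: J.U_L2 J.U_cong J.U_lin U_surj)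
qed

end

text \<open>For a general \<open>f\<close> the integral in the inversion formula need not converge
  absolutely. The formula is therefore stated pointwise where it does, and inversion in general is
  expressed by the extension of the inverse integral, which is a two-sided inverse up to null
  sets.\<close>

theorem theorem1p1:
  fixes b c :: real
  assumes "b > 0" and "c > 0"
  shows
    "(\<forall>f\<in>L2_compact_support (source_measure b c).
        AE s in spectral_measure b c. index_transform b c f s = index_integral b c f s) \<and>
     unitary_L2 (source_measure b c)
       (scale_measure (ennreal (1 / (2 * pi))) (spectral_measure b c)) (index_transform b c) \<and>
     (\<forall>f1\<in>L2 (source_measure b c). \<forall>f2\<in>L2 (source_measure b c).
        (LBINT x:{0..}. f1 x * cnj (f2 x) * of_real (source_weight b c x)) =
        of_real (1 / (2 * pi)) *
        (LBINT s:{0..}. index_transform b c f1 s * cnj (index_transform b c f2 s)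
                          * of_real (spectral_weight b c s))) \<and>
     (\<forall>f\<in>L2 (source_measure b c).
        AE x in source_measure b c. inverse_index_transform b c (index_transform b c f) x = f x) \<and>
     (\<forall>g\<in>L2 (spectral_measure b c).
        inverse_index_transform b c g \<in> L2 (source_measure b c) \<and>
        (AE s in spectral_measure b c.
           index_transform b c (inverse_index_transform b c g) s = g s)) \<and>
     (\<forall>f\<in>L2 (source_measure b c). AE x in source_measure b c.
        set_integrable lborel {0..} (\<lambda>s. index_transform b c f s * index_kernel b c s x
                                         * of_real (spectral_weight b c s)) \<longrightarrow>
        f x = of_real (1 / (2 * pi)) * of_real (1 / Gamma (b + c)) *
          (LBINT s:{0..}. index_transform b c f s * index_kernel b c s x
                            * of_real (spectral_weight b c s)))"
proof -
  interpret index_hypergeometric b c by unfold_locales (rule assms)+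
  show ?thesis
    unfolding index_transform_def inverse_index_transform_def
  proof (intro conjI ballI)
    fix f assume "f \<in> L2_compact_support M"
    thus "AE s in N. J.U f s = T f s" by (rule J.U_eq_T)
  next
    show "unitary_L2 M (scale_measure (ennreal (1 / (2 * pi))) N) J.U" by (rule unitary_U)
  next
    fix f g assume fg: "f \<in> L2 M" "g \<in> L2 M"
    have "(LBINT s:{0..}. J.U f s * cnj (J.U g s) * of_real (spectral_weight b c s)) = (\<integral>s. J.U f s * cnj (J.U g s) \<partial>N)"
      using L2_integrable_mult[OF J.U_L2[OF fg(1)] L2_cnj[OF J.U_L2[OF fg(2)]]] by (intro spectral_integral) auto
    also have "\<dots> = of_real (2 * pi) * (\<integral>x. f x * cnj (g x) \<partial>M)" by (simp add: J.U_inner[OF fg])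
    also have "(\<integral>x. f x * cnj (g x) \<partial>M) = (LBINT x:{0..}. f x * cnj (g x) * of_real (source_weight b c x))"
      using L2_integrable_mult[OF fg(1) L2_cnj[OF fg(2)]] by (intro source_integral[symmetric]) auto
    finally show "(LBINT x:{0..}. f x * cnj (g x) * of_real (source_weight b c x)) = of_real (1 / (2 * pi)) *
        (LBINT s:{0..}. J.U f s * cnj (J.U g s) * of_real (spectral_weight b c s))" by simp
  next
    fix f assume f: "f \<in> L2 M"
    show "AE x in M. I.U (J.U f) x = f x" by (rule I_U_eq[OF f J.U_L2[OF f]]) simp
  next
    fix g assume g: "g \<in> L2 N"
    show "I.U g \<in> L2 M" by (rule I.U_L2[OF g])
    from U_surj[OF g] obtain f where f: "f \<in> L2 M" "AE s in N. J.U f s = g s" by blast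
    \<comment> \<open>\<open>I.U g\<close> agrees almost everywhere with the preimage
      \<open>f\<close> provided by surjectivity, and the extension respects equality up to null
      sets.\<close>
    have "AE s in N. J.U (I.U g) s = J.U f s" by (rule J.U_cong[OF I.U_L2[OF g] f(1) I_U_eq[OF f(1) g f(2)]])
    with f(2) show "AE s in N. J.U (I.U g) s = g s" by eventually_elim simp
  next
    fix f assume f: "f \<in> L2 M"
    note m = L2_measurable[OF J.U_L2[OF f]]
    have "AE x in M. x \<ge> 0" by (rule AE_I2) simp
    with pointwise_inversion[OF f]
    show "AE x in M. set_integrable lborel {0..} (\<lambda>s. J.U f s * index_kernel b c s x * of_real (spectral_weight b c s)) \<longrightarrow>
        f x = of_real (1 / (2 * pi)) * of_real (1 / Gamma (b + c)) *
          (LBINT s:{0..}. J.U f s * index_kernel b c s x * of_real (spectral_weight b c s))"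
    proof eventually_elim
      case (elim x)
      have "(\<lambda>s. J.U f s * index_kernel b c s x) \<in> borel_measurable N"
        using m \<phi>_measurable2[OF elim(2)] by (rule borel_measurable_times)
      from spectral_integral[OF this] elim(1) T'_eq(2)[OF m elim(2)] show ?case by simp
    qed
  qed
qed

end
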